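(* Let $n\in\mathbb N$ and let $E$ be a Banach space. (a) Let $\alpha$ be a finitely generated s-tensor norm of order $n$ and let $P \in \big( \widetilde{\otimes}^{n,s}_\alpha E \big)'$ be a polynomial. Then the Aron-Berner extension $AB(P)$ of $P$ belongs to $\big(\widetilde{\otimes}^{n,s}_\alpha E'' \big)'$ and $$ \|P\|_{( \widetilde{\otimes}^{n,s}_\alpha E )'} = \|AB(P)\|_{( \widetilde{\otimes}^{n,s}_\alpha E'')'}.$$ (b) Therefore, if $\mathcal Q$ is a maximal ideal of $n$-homogeneous polynomials and $P \in \mathcal Q(E)$, then the Aron-Berner extension of $P$ belongs to $\mathcal Q(E'')$ and $$\|P\|_{\mathcal Q(E)}=\|AB(P)\|_{\mathcal Q(E'')}.$$
   Context: Banach spaces are over $\mathbb K=\mathbb R$ or $\mathbb C$. $E''$ is the bidual of $E$, $\mathcal P^n(E)$ is the space of continuous scalar-valued $n$-homogeneous polynomials on $E$, and $FIN(E)$ is the set of finite-dimensional subspaces of $E$. Aron-Berner extension: let $P\in\mathcal P^n(E)$ with associated symmetric $n$-linear form $A$ (so $P(x)=A(x,\dots,x)$). $A$ is extended to an $n$-linear form $\widehat A$ on $E''$ by weak-star continuity one variable at a time, from the last variable to the first: $\widehat A(x_1'',\dots,x_n'')=\lim_{a_1}\cdots\lim_{a_n}A(x^{(1)}_{a_1},\dots,x^{(n)}_{a_n})$, where $(x^{(j)}_{a_j})_{a_j}$ is a bounded net in $E$ converging weak-star to $x_j''$ (the value does not depend on the nets). Then $AB(P)(x'')=\widehat A(x'',\dots,x'')$.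 s-tensor norms: $\otimes^{n,s}E$ is the $n$-fold symmetric tensor product of $E$, spanned by the elements $\otimes^n x=x\otimes\cdots\otimes x$. An s-tensor norm $\alpha$ of order $n$ assigns to each normed space $E$ a norm $\alpha(\cdot\,;\otimes^{n,s}E)$ on $\otimes^{n,s}E$ such that $\alpha(\otimes^n 1;\otimes^{n,s}\mathbb K)=1$ and (metric mapping property) for each bounded linear $T:E\to F$ the induced map $\otimes^{n,s}T$ satisfies $\alpha(\otimes^{n,s}T(w);\otimes^{n,s}F)\le\|T\|^n\alpha(w;\otimes^{n,s}E)$. It is finitely generated if for every Banach space $E$ and $z\in\otimes^{n,s}E$, $\alpha(z;\otimes^{n,s}E)=\inf\{\alpha(z;\otimes^{n,s}M): M\in FIN(E),\ z\in\otimes^{n,s}M\}$. $\widetilde\otimes^{n,s}_\alpha E$ is the completion of $\otimes^{n,s}E$ with norm $\alpha$. Its dual is identified with the space of those $P\in\mathcal P^n(E)$ whose linearization $\langle P,\sum_k\lambda_k\otimes^n x_k\rangle=\sum_k\lambda_kP(x_k)$ is $\alpha$-continuous, with the dual norm. Polynomial ideals: a Banach ideal of continuous scalar-valued $n$-homogeneous polynomials is a pair $(\mathcal Q,\|\cdot\|_{\mathcal Q})$ such that for all Banach spaces: (i) $\mathcal Q(E)=\mathcal Q\cap\mathcal P^n(E)$ is a linear subspace of $\mathcal P^n(E)$ and is a Banach space under $\|\cdot\|_{\mathcal Q(E)}$; (ii) if $T:E_1\to E$ is bounded linear and $P\in\mathcal Q(E)$, then $P\circ T\in\mathcal Q(E_1)$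 with $\|P\circ T\|_{\mathcal Q(E_1)}\le\|P\|_{\mathcal Q(E)}\|T\|^n$; (iii) $z\mapsto z^n$ belongs to $\mathcal Q(\mathbb K)$ with norm $1$. For $P\in\mathcal P^n(E)$ let $\|P\|_{\mathcal Q^{max}(E)}=\sup\{\|P|_M\|_{\mathcal Q(M)}:M\in FIN(E)\}\in[0,\infty]$ and let $\mathcal Q^{max}(E)=\{P\in\mathcal P^n(E):\|P\|_{\mathcal Q^{max}(E)}<\infty\}$. $\mathcal Q$ is maximal if $\mathcal Q=\mathcal Q^{max}$ with equal norms. *)

theory Defs
  imports
    Complex_Main
    "HOL-Library.Multiset"
    "HOL-Library.Extended_Real"
    "HOL-Algebra.Module"
begin

section \<open>Scalars and normed spaces\<close>

text \<open>
  The class of the scalar field. Every instance is isomorphic to the real field (\<open>i = 0\<close>) or to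
  the complex field (\<open>i * i = -1\<close>), and multiplicativity of the norm forces it to be the usual
  absolute value.
\<close>

class rc_field = real_normed_field +
  assumes real_or_complex:
    "\<exists>i. (i = 0 \<or> i * i = - 1) \<and> (\<forall>x. \<exists>a b. x = a *\<^sub>R 1 + b *\<^sub>R i)"

instance real :: rc_field
  by standard (intro exI[of _ 0], auto)

instance complex :: rc_field
proof
  have "x = Re x *\<^sub>R 1 + Im x *\<^sub>R \<i>" for x
    by (simp add: complex_eq_iff)
  then show "\<exists>i::complex. (i = 0 \<or> i * i = - 1) \<and> (\<forall>x. \<exists>a b. x = a *\<^sub>R 1 + b *\<^sub>R i)"
    by (intro exI[of _ \<i>]) (auto simp: complex_eq_iff)
qed

text \<open>
  Normed spaces have explicit carriers, since one has to quantify over all of them, over their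
  subspaces and over their duals. The fields \<open>mult\<close> and \<open>one\<close> inherited from \<open>module\<close> play
  no role, except in \<open>scalar_space\<close>, which also serves as the ring of scalars.
\<close>

record ('k, 'v) nspace = "('k, 'v) module" +
  nrm :: "'v \<Rightarrow> real"

definition scalar_space :: "('k::rc_field, 'k) nspace" where
  "scalar_space = \<lparr>carrier = UNIV, mult = (*), one = 1, zero = 0, add = (+), smult = (*), nrm = norm\<rparr>"

locale normed_space = Module.module scalar_space E
  for E :: "('k::rc_field, 'v) nspace" +
  assumes nrm_eq_0_iff: "x \<in> carrier E \<Longrightarrow> nrm E x = 0 \<longleftrightarrow> x = \<zero>\<^bsub>E\<^esub>"
    and nrm_smult: "x \<in> carrier E \<Longrightarrow> nrm E (c \<odot>\<^bsub>E\<^esub> x) = norm c * nrm E x"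
    and nrm_triangle: "x \<in> carrier E \<Longrightarrow> y \<in> carrier E \<Longrightarrow> nrm E (x \<oplus>\<^bsub>E\<^esub> y) \<le> nrm E x + nrm E y"

locale banach_space = normed_space E for E :: "('k::rc_field, 'v) nspace" +
  assumes complete:
    "(\<And>j. s j \<in> carrier E) \<Longrightarrow>
     (\<And>e. e > 0 \<Longrightarrow> \<exists>N. \<forall>p\<ge>N. \<forall>q\<ge>N. nrm E (s p \<ominus>\<^bsub>E\<^esub> s q) < e) \<Longrightarrow>
     \<exists>l\<in>carrier E. (\<lambda>j::nat. nrm E (s j \<ominus>\<^bsub>E\<^esub> l)) \<longlonglongrightarrow> 0"

text \<open>A set of scalar functions with the pointwise operations.\<close>

definition fun_space :: "('a \<Rightarrow> 'k::rc_field) set \<Rightarrow> (('a \<Rightarrow> 'k) \<Rightarrow> real) \<Rightarrow> ('k, 'a \<Rightarrow> 'k) nspace" where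
  "fun_space S N = \<lparr>carrier = S, mult = undefined, one = undefined, zero = (\<lambda>_. 0),
     add = (\<lambda>f g x. f x + g x), smult = (\<lambda>c f x. c * f x), nrm = N\<rparr>"

definition linear_map :: "('k::rc_field, 'v) nspace \<Rightarrow> ('k, 'w) nspace \<Rightarrow> ('v \<Rightarrow> 'w) \<Rightarrow> bool" where
  "linear_map E F T \<longleftrightarrow> T \<in> carrier E \<rightarrow> carrier F \<and>
     (\<forall>x\<in>carrier E. \<forall>y\<in>carrier E. T (x \<oplus>\<^bsub>E\<^esub> y) = T x \<oplus>\<^bsub>F\<^esub> T y) \<and>
     (\<forall>c. \<forall>x\<in>carrier E. T (c \<odot>\<^bsub>E\<^esub> x) = c \<odot>\<^bsub>F\<^esub> T x)"

definition bounded_linear_map :: "('k::rc_field, 'v) nspace \<Rightarrow> ('k, 'w) nspace \<Rightarrow> ('v \<Rightarrow> 'w) \<Rightarrow> bool" where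
  "bounded_linear_map E F T \<longleftrightarrow> linear_map E F T \<and> (\<exists>C. \<forall>x\<in>carrier E. nrm F (T x) \<le> C * nrm E x)"

definition op_norm :: "('k::rc_field, 'v) nspace \<Rightarrow> ('k, 'w) nspace \<Rightarrow> ('v \<Rightarrow> 'w) \<Rightarrow> real" where
  "op_norm E F T = Sup {nrm F (T x) | x. x \<in> carrier E \<and> nrm E x \<le> 1}"

definition isometric_iso :: "('k::rc_field, 'v) nspace \<Rightarrow> ('k, 'w) nspace \<Rightarrow> ('v \<Rightarrow> 'w) \<Rightarrow> bool" where
  "isometric_iso E F T \<longleftrightarrow> normed_space E \<and> normed_space F \<and> linear_map E F T \<and>
     bij_betw T (carrier E) (carrier F) \<and> (\<forall>x\<in>carrier E. nrm F (T x) = nrm E x)"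

text \<open>Every normed space has an isometric copy in every sufficiently large type.\<close>

lemma isometric_copy_exists:
  fixes V :: "('k::rc_field, 'v) nspace" and j :: "'v \<Rightarrow> 'u"
  assumes V: "normed_space V" and j: "inj_on j (carrier V)"
  shows "\<exists>F \<Phi>. isometric_iso (F :: ('k, 'u) nspace) V \<Phi>"
proof -
  interpret V: normed_space V by (rule V)
  define g where "g = inv_into (carrier V) j"
  define F :: "('k,'u) nspace" where
    "F = \<lparr>carrier = j ` carrier V, mult = undefined, one = undefined, zero = j \<zero>\<^bsub>V\<^esub>,
        add = (\<lambda>x y. j (g x \<oplus>\<^bsub>V\<^esub> g y)), smult = (\<lambda>c x. j (c \<odot>\<^bsub>V\<^esub> g x)), nrm = (\<lambda>x. nrm V (g x))\<rparr>"
  have gj[simp]: "x \<in> carrier V \<Longrightarrow> g (j x) = x" for x by (simp add: g_def j)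
  have sc[simp]: "c \<in> carrier scalar_space" for c :: 'k by (simp add: scalar_space_def)
  have sa[simp]: "a \<oplus>\<^bsub>scalar_space\<^esub> b = a + b" "a \<otimes>\<^bsub>scalar_space\<^esub> b = a * b" for a b :: 'k
    by (simp_all add: scalar_space_def)
  have inj0: "j x = j \<zero>\<^bsub>V\<^esub> \<longleftrightarrow> x = \<zero>\<^bsub>V\<^esub>" if "x \<in> carrier V" for x
    using j that by (auto dest: inj_onD)
  have ab: "abelian_group F"
  proof (rule abelian_groupI)
    fix x assume "x \<in> carrier F"
    then obtain v where v: "v \<in> carrier V" "x = j v" by (auto simp: F_def)
    then show "\<exists>y\<in>carrier F. y \<oplus>\<^bsub>F\<^esub> x = \<zero>\<^bsub>F\<^esub>"
      by (intro bexI[of _ "j (\<ominus>\<^bsub>V\<^esub> v)"]) (auto simp: F_def V.M.l_neg)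
  qed (auto simp: F_def V.M.a_ac)
  have clo[simp]: "c \<odot>\<^bsub>V\<^esub> x \<in> carrier V" if "x \<in> carrier V" for c x using that V.smult_closed[of c x] by simp
  have l: "(a + b) \<odot>\<^bsub>V\<^esub> x = a \<odot>\<^bsub>V\<^esub> x \<oplus>\<^bsub>V\<^esub> b \<odot>\<^bsub>V\<^esub> x" if "x \<in> carrier V" for a b x
    using that V.smult_l_distr[of a b x] by (simp only: sa sc)
  have r: "a \<odot>\<^bsub>V\<^esub> (x \<oplus>\<^bsub>V\<^esub> y) = a \<odot>\<^bsub>V\<^esub> x \<oplus>\<^bsub>V\<^esub> a \<odot>\<^bsub>V\<^esub> y" if "x \<in> carrier V" "y \<in> carrier V" for a x y
    using that V.smult_r_distr[of a x y] by simp
  have m: "(a * b) \<odot>\<^bsub>V\<^esub> x = a \<odot>\<^bsub>V\<^esub> (b \<odot>\<^bsub>V\<^esub> x)" if "x \<in> carrier V" for a b x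
    using that V.smult_assoc1[of a b x] by (simp only: sa sc)
  have "normed_space F"
    apply (intro normed_space.intro normed_space_axioms.intro Module.moduleI V.R.cring_axioms ab)
    apply (auto simp: F_def l r m V.nrm_eq_0_iff V.nrm_smult V.nrm_triangle inj0 clo V.smult_one)
    done
  moreover have "linear_map F V g" by (auto simp: linear_map_def F_def)
  moreover have "bij_betw g (carrier F) (carrier V)"
    unfolding g_def F_def by (simp add: bij_betw_inv_into[OF inj_on_imp_bij_betw[OF j]])
  moreover have "\<forall>x\<in>carrier F. nrm V (g x) = nrm F x" by (simp add: F_def)
  ultimately have "isometric_iso F V g" using V by (simp add: isometric_iso_def)
  then show ?thesis by blast
qed

text \<open>Functions on a space are normalised to be \<open>0\<close> off the carrier.\<close>

definition vanishing_off :: "('k::rc_field, 'v) nspace \<Rightarrow> ('v \<Rightarrow> 'k) \<Rightarrow> bool" where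
  "vanishing_off E f \<longleftrightarrow> (\<forall>x. x \<notin> carrier E \<longrightarrow> f x = 0)"

definition comp_on :: "('k::rc_field, 'v) nspace \<Rightarrow> ('w \<Rightarrow> 'k) \<Rightarrow> ('v \<Rightarrow> 'w) \<Rightarrow> 'v \<Rightarrow> 'k" where
  "comp_on E f T = (\<lambda>x. if x \<in> carrier E then f (T x) else 0)"

definition dual :: "('k::rc_field, 'v) nspace \<Rightarrow> ('k, 'v \<Rightarrow> 'k) nspace" where
  "dual E = fun_space {f. bounded_linear_map E scalar_space f \<and> vanishing_off E f}
                      (op_norm E scalar_space)"

abbreviation bidual :: "('k::rc_field, 'v) nspace \<Rightarrow> ('k, ('v \<Rightarrow> 'k) \<Rightarrow> 'k) nspace" where
  "bidual E \<equiv> dual (dual E)"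

definition FIN :: "('k::rc_field, 'v) nspace \<Rightarrow> ('k, 'v) nspace set" where
  "FIN E = {E\<lparr>carrier := M\<rparr> | M. submodule M (scalar_space :: ('k, 'k) nspace) E \<and>
     (\<exists>B. finite B \<and> B \<subseteq> M \<and> (\<forall>x\<in>M. \<exists>c. x = (\<Oplus>\<^bsub>E\<^esub>b\<in>B. c b \<odot>\<^bsub>E\<^esub> b)))}"


section \<open>Homogeneous polynomials and the Aron-Berner extension\<close>

text \<open>An \<open>n\<close>-linear form is a function on lists, of which only the values at the lists of
  length \<open>n\<close> over the carrier are relevant.\<close>

definition tuples :: "nat \<Rightarrow> ('k::rc_field, 'v) nspace \<Rightarrow> 'v list set" where
  "tuples n E = {xs. length xs = n \<and> set xs \<subseteq> carrier E}"

definition multilinear_form :: "nat \<Rightarrow> ('k::rc_field, 'v) nspace \<Rightarrow> ('v list \<Rightarrow> 'k) \<Rightarrow> bool" where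
  "multilinear_form n E A \<longleftrightarrow>
     (\<forall>xs\<in>tuples n E. \<forall>i<n. linear_map E scalar_space (\<lambda>y. A (xs[i := y])))"

definition associated_form ::
    "nat \<Rightarrow> ('k::rc_field, 'v) nspace \<Rightarrow> ('v \<Rightarrow> 'k) \<Rightarrow> ('v list \<Rightarrow> 'k) \<Rightarrow> bool" where
  "associated_form n E P A \<longleftrightarrow>
     multilinear_form n E A \<and>
     (\<forall>xs\<in>tuples n E. \<forall>ys\<in>tuples n E. mset xs = mset ys \<longrightarrow> A xs = A ys) \<and>
     (\<exists>C. \<forall>xs\<in>tuples n E. norm (A xs) \<le> C * prod_list (map (nrm E) xs)) \<and>
     (\<forall>x\<in>carrier E. P x = A (replicate n x))"

definition polynomials :: "nat \<Rightarrow> ('k::rc_field, 'v) nspace \<Rightarrow> ('v \<Rightarrow> 'k) set" where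
  "polynomials n E = {P. vanishing_off E P \<and> (\<exists>A. associated_form n E P A)}"

text \<open>Bounded nets in \<open>E\<close> converging weak-star to an element of the bidual, as filters.\<close>

definition weak_star_net :: "('k::rc_field, 'v) nspace \<Rightarrow> (('v \<Rightarrow> 'k) \<Rightarrow> 'k) \<Rightarrow> 'v filter \<Rightarrow> bool" where
  "weak_star_net E x'' \<F> \<longleftrightarrow> \<F> \<noteq> bot \<and>
     (\<exists>C. \<forall>\<^sub>F x in \<F>. x \<in> carrier E \<and> nrm E x \<le> C) \<and>
     (\<forall>f\<in>carrier (dual E). (f \<longlongrightarrow> x'' f) \<F>)"

fun iterated_lim :: "'v filter list \<Rightarrow> ('v list \<Rightarrow> 'k::rc_field) \<Rightarrow> 'k" where
  "iterated_lim [] A = A []"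
| "iterated_lim (\<F> # \<F>s) A = Lim \<F> (\<lambda>x. iterated_lim \<F>s (\<lambda>xs. A (x # xs)))"

definition bidual_extension ::
    "('k::rc_field, 'v) nspace \<Rightarrow> ('v list \<Rightarrow> 'k) \<Rightarrow> (('v \<Rightarrow> 'k) \<Rightarrow> 'k) list \<Rightarrow> 'k" where
  "bidual_extension E A xs'' = iterated_lim (map (\<lambda>x''. SOME \<F>. weak_star_net E x'' \<F>) xs'') A"

definition AB :: "nat \<Rightarrow> ('k::rc_field, 'v) nspace \<Rightarrow> ('v \<Rightarrow> 'k) \<Rightarrow> (('v \<Rightarrow> 'k) \<Rightarrow> 'k) \<Rightarrow> 'k" where
  "AB n E P = (\<lambda>x''. if x'' \<in> carrier (bidual E)
     then bidual_extension E (SOME A. associated_form n E P A) (replicate n x'') else 0)"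


section \<open>Symmetric tensor products and s-tensor norms\<close>

text \<open>
  Elements of the \<open>n\<close>-fold algebraic tensor product of \<open>E\<close> are represented as functionals on the
  space of all \<open>n\<close>-linear forms on \<open>E\<close>, the elementary tensor of \<open>x\<^sub>1, \<dots>, x\<^sub>n\<close>
  being evaluation at \<open>(x\<^sub>1, \<dots>, x\<^sub>n)\<close>.
\<close>

definition tensor_power :: "nat \<Rightarrow> ('k::rc_field, 'v) nspace \<Rightarrow> 'v \<Rightarrow> ('v list \<Rightarrow> 'k) \<Rightarrow> 'k" where
  "tensor_power n E x = (\<lambda>A. if multilinear_form n E A then A (replicate n x) else 0)"

definition sym_tensors :: "nat \<Rightarrow> ('k::rc_field, 'v) nspace \<Rightarrow> (('v list \<Rightarrow> 'k) \<Rightarrow> 'k) set" where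
  "sym_tensors n E = {z. \<exists>(m::nat) c x. (\<forall>j<m. x j \<in> carrier E) \<and>
     z = (\<lambda>A. \<Sum>j<m. c j * tensor_power n E (x j) A)}"

text \<open>The induced map of \<open>T\<close> into the tensor product of \<open>F\<close>: it sends the power of \<open>x\<close> to the
  power of \<open>T x\<close>.\<close>

definition tensor_map ::
    "nat \<Rightarrow> ('k::rc_field, 'w) nspace \<Rightarrow> ('v \<Rightarrow> 'w) \<Rightarrow> (('v list \<Rightarrow> 'k) \<Rightarrow> 'k) \<Rightarrow> ('w list \<Rightarrow> 'k) \<Rightarrow> 'k" where
  "tensor_map n F T z = (\<lambda>A. if multilinear_form n F A then z (\<lambda>xs. A (map T xs)) else 0)"

definition linearization ::
    "nat \<Rightarrow> ('k::rc_field, 'v) nspace \<Rightarrow> ('v \<Rightarrow> 'k) \<Rightarrow> (('v list \<Rightarrow> 'k) \<Rightarrow> 'k) \<Rightarrow> 'k" where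
  "linearization n E P z = (THE v. \<exists>(m::nat) c x. (\<forall>j<m. x j \<in> carrier E) \<and>
     z = (\<lambda>A. \<Sum>j<m. c j * tensor_power n E (x j) A) \<and> v = (\<Sum>j<m. c j * P (x j)))"

text \<open>
  A map defined on ``all'' normed spaces is rendered as a map defined on all normed spaces whose
  carrier is a subset of the type \<open>'u\<close>. The type \<open>'u\<close> is an arbitrary universe: no closure property
  of it is assumed. A space that does not literally live in \<open>'u\<close>, such as the scalar field or a
  bidual, is replaced by its isometric copies in \<open>'u\<close> (see \<open>isometric_copy_exists\<close>).
\<close>

type_synonym ('k, 'u) tensor_norm = "('k, 'u) nspace \<Rightarrow> (('u list \<Rightarrow> 'k) \<Rightarrow> 'k) \<Rightarrow> real"

definition s_tensor_norm :: "nat \<Rightarrow> ('k::rc_field, 'u) tensor_norm \<Rightarrow> bool" where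
  "s_tensor_norm n \<alpha> \<longleftrightarrow>
     (\<forall>E. normed_space E \<longrightarrow> normed_space (fun_space (sym_tensors n E) (\<alpha> E))) \<and>
     (\<forall>L \<psi> u. isometric_iso L (scalar_space :: ('k, 'k) nspace) \<psi> \<and> u \<in> carrier L \<and> \<psi> u = 1 \<longrightarrow>
        \<alpha> L (tensor_power n L u) = 1) \<and>
     (\<forall>E F T. normed_space E \<and> normed_space F \<and> bounded_linear_map E F T \<longrightarrow>
        (\<forall>w\<in>sym_tensors n E. \<alpha> F (tensor_map n F T w) \<le> op_norm E F T ^ n * \<alpha> E w))"

definition finitely_generated :: "nat \<Rightarrow> ('k::rc_field, 'u) tensor_norm \<Rightarrow> bool" where
  "finitely_generated n \<alpha> \<longleftrightarrow>
     (\<forall>E. banach_space E \<longrightarrow> (\<forall>z\<in>sym_tensors n E.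
        \<alpha> E z = Inf {\<alpha> M w | M w. M \<in> FIN E \<and> w \<in> sym_tensors n M \<and>
                                 tensor_map n E (\<lambda>x. x) w = z}))"

text \<open>The dual of the completed symmetric tensor product, as a space of polynomials.\<close>

definition tensor_dual ::
    "('k::rc_field, 'u) tensor_norm \<Rightarrow> nat \<Rightarrow> ('k, 'u) nspace \<Rightarrow> ('u \<Rightarrow> 'k) set" where
  "tensor_dual \<alpha> n E = {P \<in> polynomials n E.
     \<exists>C. \<forall>z\<in>sym_tensors n E. norm (linearization n E P z) \<le> C * \<alpha> E z}"

definition tensor_dual_norm ::
    "('k::rc_field, 'u) tensor_norm \<Rightarrow> nat \<Rightarrow> ('k, 'u) nspace \<Rightarrow> ('u \<Rightarrow> 'k) \<Rightarrow> real" where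
  "tensor_dual_norm \<alpha> n E P =
     Sup {norm (linearization n E P z) | z. z \<in> sym_tensors n E \<and> \<alpha> E z \<le> 1}"


section \<open>Polynomial ideals\<close>

definition banach_polynomial_ideal ::
    "nat \<Rightarrow> (('k::rc_field, 'u) nspace \<Rightarrow> ('u \<Rightarrow> 'k) set) \<Rightarrow>
     (('k, 'u) nspace \<Rightarrow> ('u \<Rightarrow> 'k) \<Rightarrow> real) \<Rightarrow> bool" where
  "banach_polynomial_ideal n Q q \<longleftrightarrow>
     (\<forall>E. banach_space E \<longrightarrow> Q E \<subseteq> polynomials n E \<and> banach_space (fun_space (Q E) (q E))) \<and>
     (\<forall>E1 E T. banach_space E1 \<and> banach_space E \<and> bounded_linear_map E1 E T \<longrightarrow>
        (\<forall>P\<in>Q E. comp_on E1 P T \<in> Q E1 \<and> q E1 (comp_on E1 P T) \<le> q E P * op_norm E1 E T ^ n)) \<and>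
     (\<forall>L \<psi>. isometric_iso L (scalar_space :: ('k, 'k) nspace) \<psi> \<longrightarrow>
        comp_on L (\<lambda>z. z ^ n) \<psi> \<in> Q L \<and> q L (comp_on L (\<lambda>z. z ^ n) \<psi>) = 1)"

definition max_norm ::
    "(('k::rc_field, 'u) nspace \<Rightarrow> ('u \<Rightarrow> 'k) \<Rightarrow> real) \<Rightarrow> ('k, 'u) nspace \<Rightarrow> ('u \<Rightarrow> 'k) \<Rightarrow> ereal" where
  "max_norm q E P = (SUP M\<in>FIN E. ereal (q M (comp_on M P (\<lambda>x. x))))"

definition maximal_ideal ::
    "nat \<Rightarrow> (('k::rc_field, 'u) nspace \<Rightarrow> ('u \<Rightarrow> 'k) set) \<Rightarrow>
     (('k, 'u) nspace \<Rightarrow> ('u \<Rightarrow> 'k) \<Rightarrow> real) \<Rightarrow> bool" where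
  "maximal_ideal n Q q \<longleftrightarrow> banach_polynomial_ideal n Q q \<and>
     (\<forall>E. banach_space E \<longrightarrow>
        Q E = {P \<in> polynomials n E. max_norm q E P < \<infinity>} \<and>
        (\<forall>P\<in>Q E. ereal (q E P) = max_norm q E P))"

end

theory Submission
  imports Defs "HOL-Combinatorics.Permutations"
begin

text \<open>
  Let \<open>M\<close> be a finite-dimensional subspace of the bidual. Helly's theorem gives operators
  \<open>T : M \<rightarrow> E\<close> of norm at most \<open>1 + \<epsilon>\<close> that act correctly on finitely many prescribed functionals.
  Choosing such operators one after another and averaging them, as Davie and Gamelin do for single
  vectors, one obtains \<open>T\<close> of norm at most \<open>1 + \<epsilon>\<close> with \<open>P (T x)\<close> as close as desired to
  \<open>AB P x\<close> at finitely many points \<open>x\<close> of \<open>M\<close>. Finitely generated norms and maximal ideals are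
  determined by such \<open>M\<close>, and they are contractive along \<open>T\<close> up to the factor \<open>(1 + \<epsilon>)^n\<close>; this
  bounds the norm of the extension by that of \<open>P\<close>. The reverse bound comes from restricting the
  extension along the canonical embedding of \<open>E\<close>.
\<close>

section \<open>The scalar field\<close>

text \<open>The obstacle is that the extension is an iterated limit in a fixed order, and it need
  not be symmetric even when the form is. One operator \<open>T\<close> inserted in all
  \<open>n\<close> variables at once realises no iterated limit, so weak-star approximation alone
  does not control the values of the form at \<open>(T x, ..., T x)\<close>. Distinct operators
  inserted in the order of their choice do realise it, even exactly, since at each stage only
  finitely many functionals have to be matched; symmetry of the form on \<open>E\<close> then brings
  any tuple of distinct operators into that order. Only the tuples with repetitions remain
  uncontrolled, and averaging makes them negligible. For this purpose \<open>T\<close> has to match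
  functionals rather than to fix the vectors of \<open>M\<close> that come from \<open>E\<close>;
  this form of local reflexivity follows from Helly's theorem and Hahn-Banach. It also supplies the
  bounded nets chosen in the definition of the extension. Finite dimension is exploited through one
  device: a function in a finite-dimensional function space is recovered linearly from its values at
  finitely many points.\<close>

lemma norm_imaginary_ge_cmod:
  fixes i :: "'k::rc_field" and z :: complex
  assumes i: "i * i = - 1"
  shows "cmod z \<le> norm (of_real (Re z) + of_real (Im z) * i)"
proof -
  define f where "f z = of_real (Re z) + of_real (Im z) * i" for z
  have f_mult: "f (z * w) = f z * f w" for z w
  proof -
    have "f z * f w = of_real (Re z * Re w) + of_real (Im z * Im w) * (i * i)
        + of_real (Re z * Im w + Im z * Re w) * i"
      by (simp add: f_def algebra_simps)
    also have "\<dots> = f (z * w)" by (simp add: i f_def)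
    finally show ?thesis ..
  qed
  have f_pow: "f (z ^ n) = f z ^ n" for z n
    by (induction n) (simp_all add: f_mult, simp add: f_def)
  have "norm i * norm i = 1" by (metis i norm_minus_cancel norm_mult norm_one)
  then have ni: "norm i = 1" using abs_square_eq_1[of "norm i"] by (simp add: power2_eq_square)
  \<comment> \<open>A crude bound with factor 2: \<open>f z * f (cnj z)\<close> is the square of
    \<open>cmod z\<close>, and the second factor has norm at most \<open>2 * cmod z\<close> by the
    triangle inequality.\<close>
  have lower: "cmod z \<le> 2 * norm (f z)" for z
  proof (cases "z = 0")
    case False
    have "f z * f (cnj z) = of_real ((cmod z)\<^sup>2)"
      by (simp add: f_mult[symmetric] complex_mult_cnj cmod_power2) (simp add: f_def)
    then have "norm (f z * f (cnj z)) = (cmod z)\<^sup>2" by (simp only: norm_of_real) simp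
    then have "norm (f z) * norm (f (cnj z)) = (cmod z)\<^sup>2" by (simp only: norm_mult)
    moreover have "norm (f (cnj z)) \<le> \<bar>Re z\<bar> + \<bar>Im z\<bar>"
      unfolding f_def by (rule order_trans[OF norm_triangle_ineq]) (simp add: norm_mult ni)
    moreover have "\<bar>Re z\<bar> + \<bar>Im z\<bar> \<le> cmod z + cmod z"
      by (intro add_mono abs_Re_le_cmod abs_Im_le_cmod)
    ultimately have "cmod z * cmod z \<le> norm (f z) * (cmod z + cmod z)"
      using mult_left_mono[of "norm (f (cnj z))" "cmod z + cmod z" "norm (f z)"] by (simp add: power2_eq_square)
    then have "cmod z * cmod z \<le> (2 * norm (f z)) * cmod z" by (simp add: algebra_simps)
    then show ?thesis using False by simp
  qed (simp add: f_def)
  show ?thesis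
  proof (rule ccontr)
    assume "\<not> ?thesis"
    then have lt: "norm (f z) < cmod z" by (simp add: f_def)
    \<comment> \<open>The crude bound is applied to \<open>z ^ n\<close>. Multiplicativity turns it
      into a bound between n-th powers, whose growth defeats the factor 2.\<close>
    have pw: "cmod z ^ n \<le> 2 * norm (f z) ^ n" for n
      using lower[of "z ^ n"] by (simp add: f_pow norm_power)
    have "norm (f z) \<noteq> 0" using pw[of 1] lt by auto
    then have pos: "0 < norm (f z)" by simp
    then have "1 < cmod z / norm (f z)" using lt by simp
    then obtain n where "2 < (cmod z / norm (f z)) ^ n" using real_arch_pow by blast
    then show False using pw[of n] pos by (simp add: power_divide field_simps)
  qed
qed

text \<open>The real and the complex case are treated at once by allowing \<open>i = 0\<close>,
  where \<open>im\<close> is constantly 0. The two Lipschitz bounds transfer limits and grids from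
  the reals. The last clause controls the real coordinate of a combination with arbitrary real
  \<open>a\<close> and \<open>b\<close>; Hahn-Banach uses it to compare a functional with its real
  part.\<close>

lemma rc_field_coordinates:
  obtains i :: "'k::rc_field" and re im :: "'k \<Rightarrow> real" where
    "i = 0 \<or> i * i = - 1"
    "\<And>x. x = of_real (re x) + of_real (im x) * i"
    "\<And>x y. \<bar>re x - re y\<bar> \<le> norm (x - y)"
    "\<And>x y. \<bar>im x - im y\<bar> \<le> norm (x - y)"
    "\<And>a b. \<bar>a\<bar> \<le> norm (of_real a + of_real b * i)"
proof -
  obtain i :: 'k where i: "i = 0 \<or> i * i = - 1" and ex: "\<forall>x. \<exists>a b. x = a *\<^sub>R 1 + b *\<^sub>R i"
    using real_or_complex by blast
  show ?thesis
  proof (cases "i = 0")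
    case True
    then have "\<forall>x::'k. \<exists>a. x = of_real a" using ex by (simp add: of_real_def)
    then obtain re where re: "\<And>x::'k. x = of_real (re x)" by metis
    have "\<bar>re x - re y\<bar> \<le> norm (x - y)" for x y
    proof -
      have "x - y = of_real (re x - re y)" using re[of x] re[of y] by simp
      then show ?thesis by (metis norm_of_real order_refl)
    qed
    then show ?thesis using True re by (intro that[of i re "\<lambda>_. 0"]) auto
  next
    case False
    then have ii: "i * i = - 1" using i by simp
    have "\<exists>a b. x = of_real a + of_real b * i" for x :: 'k
      using ex by (simp add: of_real_def)
    then obtain re im where dec: "\<And>x. x = of_real (re x) + of_real (im x) * i" by metis
    have bnd: "\<bar>a\<bar> \<le> norm (of_real a + of_real b * i)" "\<bar>b\<bar> \<le> norm (of_real a + of_real b * i)" for a b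
      using norm_imaginary_ge_cmod[OF ii, of "Complex a b"] abs_Re_le_cmod[of "Complex a b"]
        abs_Im_le_cmod[of "Complex a b"] by simp_all
    have d: "x - y = of_real (re x - re y) + of_real (im x - im y) * i" for x y
    proof -
      have "x - y = (of_real (re x) + of_real (im x) * i) - (of_real (re y) + of_real (im y) * i)"
        by (rule arg_cong2[of _ _ _ _ minus]) (rule dec)+
      then show ?thesis by (simp add: algebra_simps)
    qed
    have "\<bar>re x - re y\<bar> \<le> norm (x - y)" "\<bar>im x - im y\<bar> \<le> norm (x - y)" for x y
      using bnd[where a="re x - re y" and b="im x - im y"] by (simp_all add: d[of x y])
    then show ?thesis using ii dec bnd by (intro that[of i re im]) auto
  qed
qed

lemma rc_field_Cauchy_convergent:
  fixes s :: "nat \<Rightarrow> 'k::rc_field"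
  assumes "\<And>e. e > 0 \<Longrightarrow> \<exists>N. \<forall>p\<ge>N. \<forall>q\<ge>N. norm (s p - s q) < e"
  shows "\<exists>l. s \<longlonglongrightarrow> l"
proof -
  obtain i :: 'k and re im where dec: "\<And>x. x = of_real (re x) + of_real (im x) * i"
    and re: "\<And>x y. \<bar>re x - re y\<bar> \<le> norm (x - y)" and im: "\<And>x y. \<bar>im x - im y\<bar> \<le> norm (x - y)"
    using rc_field_coordinates by metis
  have C: "\<exists>l. (\<lambda>n. g (s n)) \<longlonglongrightarrow> l" if g: "\<And>x y. \<bar>g x - g y\<bar> \<le> norm (x - y)" for g :: "'k \<Rightarrow> real"
  proof -
    have "Cauchy (\<lambda>n. g (s n))"
      unfolding Cauchy_def dist_real_def using assms g by (meson order_le_less_trans)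
    then show ?thesis using Cauchy_convergent_iff convergent_def by blast
  qed
  obtain a b where "(\<lambda>n. re (s n)) \<longlonglongrightarrow> a" "(\<lambda>n. im (s n)) \<longlonglongrightarrow> b" using C[OF re] C[OF im] by blast
  then have "(\<lambda>n. of_real (re (s n)) + of_real (im (s n)) * i) \<longlonglongrightarrow> of_real a + of_real b * i"
    by (intro tendsto_intros)
  then show ?thesis unfolding dec[symmetric] by blast
qed

text \<open>A square grid: the cell of a number consists of the integer parts of its coordinates
  divided by \<open>d\<close>. This labelling takes the place of compactness of balls in the scalar
  field.\<close>

lemma rc_field_totally_bounded:
  fixes \<delta> R :: real
  assumes "\<delta> > 0"
  obtains cell :: "'k::rc_field \<Rightarrow> int \<times> int" where
    "finite (cell ` {x. norm x \<le> R})" "\<And>x y. cell x = cell y \<Longrightarrow> norm (x - y) \<le> \<delta>"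
proof -
  obtain i :: 'k and re im where i: "i = 0 \<or> i * i = - 1"
    and dec: "\<And>x. x = of_real (re x) + of_real (im x) * i"
    and re: "\<And>x y. \<bar>re x - re y\<bar> \<le> norm (x - y)" and im: "\<And>x y. \<bar>im x - im y\<bar> \<le> norm (x - y)"
    using rc_field_coordinates by metis
  have ni: "norm i \<le> 1"
  proof (cases "i = 0")
    case False
    then have "norm i * norm i = 1" using i by (metis norm_minus_cancel norm_mult norm_one)
    then show ?thesis using abs_square_eq_1[of "norm i"] by (simp add: power2_eq_square)
  qed simp
  \<comment> \<open>The side is half of \<open>\<delta>\<close> because the errors in the two
    coordinates add.\<close>
  define d where "d = \<delta> / 2"
  have d: "d > 0" using assms by (simp add: d_def)
  define cell where "cell x = (\<lfloor>re x / d\<rfloor>, \<lfloor>im x / d\<rfloor>)" for x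
  have fin: "finite ((\<lambda>x. \<lfloor>g x / d\<rfloor>) ` {x::'k. norm x \<le> R})"
    if g: "\<And>x y. \<bar>g x - g y\<bar> \<le> norm (x - y)" for g :: "'k \<Rightarrow> real"
  proof -
    have "(\<lambda>x. \<lfloor>g x / d\<rfloor>) ` {x::'k. norm x \<le> R} \<subseteq> {\<lfloor>(g 0 - R) / d\<rfloor>..\<lfloor>(g 0 + R) / d\<rfloor>}"
    proof clarify
      fix x :: 'k assume "norm x \<le> R"
      then have "g x \<le> g 0 + R" "g 0 - R \<le> g x" using g[of x 0] by auto
      then show "\<lfloor>g x / d\<rfloor> \<in> {\<lfloor>(g 0 - R) / d\<rfloor>..\<lfloor>(g 0 + R) / d\<rfloor>}"
        using d by (auto intro!: floor_mono divide_right_mono)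
    qed
    then show ?thesis by (rule finite_subset) simp
  qed
  have close: "\<bar>a - b\<bar> \<le> d" if "\<lfloor>a / d\<rfloor> = \<lfloor>b / d\<rfloor>" for a b
  proof -
    have "\<bar>a / d - b / d\<bar> \<le> 1" using that by linarith
    then show ?thesis using d by (simp add: diff_divide_distrib[symmetric] abs_divide)
  qed
  show ?thesis
  proof (rule that[of cell])
    have "cell ` {x. norm x \<le> R} \<subseteq> ((\<lambda>x. \<lfloor>re x / d\<rfloor>) ` {x. norm x \<le> R}) \<times> ((\<lambda>x. \<lfloor>im x / d\<rfloor>) ` {x. norm x \<le> R})"
      by (auto simp: cell_def)
    then show "finite (cell ` {x. norm x \<le> R})"
      by (rule finite_subset) (intro finite_cartesian_product fin re im)
  next
    fix x y assume "cell x = cell y"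
    then have a: "\<bar>re x - re y\<bar> \<le> d" and b: "\<bar>im x - im y\<bar> \<le> d"
      by (auto simp: cell_def intro: close)
    have "x - y = (of_real (re x) + of_real (im x) * i) - (of_real (re y) + of_real (im y) * i)"
      by (rule arg_cong2[of _ _ _ _ minus]) (rule dec)+
    also have "\<dots> = of_real (re x - re y) + of_real (im x - im y) * i" by (simp add: algebra_simps)
    also have "norm \<dots> \<le> \<bar>re x - re y\<bar> + \<bar>im x - im y\<bar> * norm i"
      by (rule order_trans[OF norm_triangle_ineq]) (simp only: norm_mult norm_of_real order_refl)
    also have "\<dots> \<le> d + d * 1" using a b ni d by (intro add_mono mult_mono) auto
    finally show "norm (x - y) \<le> \<delta>" by (simp add: d_def)
  qed
qed

lemma unit_rotation:
  fixes a :: "'k::rc_field"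
  obtains c where "norm c = 1" "c * a = of_real (norm a)"
proof (cases "a = 0")
  case False
  then show ?thesis by (intro that[of "of_real (norm a) / a"]) (auto simp: norm_divide)
qed (auto intro: that[of 1])

section \<open>Vector spaces and the Hahn-Banach theorem\<close>

lemma scalar_space_simps [simp]:
  "carrier scalar_space = UNIV" "a \<oplus>\<^bsub>scalar_space\<^esub> b = a + b" "a \<otimes>\<^bsub>scalar_space\<^esub> b = a * b"
  "a \<odot>\<^bsub>scalar_space\<^esub> b = a * b" "\<zero>\<^bsub>scalar_space\<^esub> = 0" "\<one>\<^bsub>scalar_space\<^esub> = 1" "nrm scalar_space = norm"
  by (simp_all add: scalar_space_def)

lemma cring_scalar_space: "cring (scalar_space :: ('k::rc_field, 'k) nspace)"
proof -
  have "\<exists>y. y + x = 0" for x :: 'k by (rule exI[of _ "- x"]) simp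
  then show ?thesis
    by (intro cringI abelian_groupI comm_monoidI) (auto simp: algebra_simps)
qed

text \<open>Vector spaces without a norm: Hahn-Banach is applied later to a power of a space, where
  only a seminorm is at hand.\<close>

locale vspace = Module.module scalar_space E for E :: "('k::rc_field, 'v) nspace"

sublocale normed_space \<subseteq> vspace ..

context vspace
begin

lemma smult_cl [simp, intro]: "x \<in> carrier E \<Longrightarrow> c \<odot>\<^bsub>E\<^esub> x \<in> carrier E"
  using smult_closed[of c x] by simp

lemma smult_l: "x \<in> carrier E \<Longrightarrow> (a + b) \<odot>\<^bsub>E\<^esub> x = a \<odot>\<^bsub>E\<^esub> x \<oplus>\<^bsub>E\<^esub> b \<odot>\<^bsub>E\<^esub> x"
  using smult_l_distr[of a b x] by (simp only: scalar_space_simps UNIV_I)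

lemma smult_r: "x \<in> carrier E \<Longrightarrow> y \<in> carrier E \<Longrightarrow> a \<odot>\<^bsub>E\<^esub> (x \<oplus>\<^bsub>E\<^esub> y) = a \<odot>\<^bsub>E\<^esub> x \<oplus>\<^bsub>E\<^esub> a \<odot>\<^bsub>E\<^esub> y"
  using smult_r_distr[of a x y] by simp

lemma smult_assoc: "x \<in> carrier E \<Longrightarrow> a \<odot>\<^bsub>E\<^esub> (b \<odot>\<^bsub>E\<^esub> x) = (a * b) \<odot>\<^bsub>E\<^esub> x"
  using smult_assoc1[of a b x] by (simp only: scalar_space_simps UNIV_I)

lemma smult_1 [simp]: "x \<in> carrier E \<Longrightarrow> 1 \<odot>\<^bsub>E\<^esub> x = x"
  using smult_one[of x] by simp

lemma smult_0 [simp]: "x \<in> carrier E \<Longrightarrow> 0 \<odot>\<^bsub>E\<^esub> x = \<zero>\<^bsub>E\<^esub>"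
  using smult_l_null[of x] by simp

lemma smult_zero [simp]: "c \<odot>\<^bsub>E\<^esub> \<zero>\<^bsub>E\<^esub> = \<zero>\<^bsub>E\<^esub>"
  using smult_r_null[of c] by simp

lemma a_inv_smult: "x \<in> carrier E \<Longrightarrow> \<ominus>\<^bsub>E\<^esub> x = (- 1) \<odot>\<^bsub>E\<^esub> x"
proof -
  assume x: "x \<in> carrier E"
  have "(- 1) \<odot>\<^bsub>E\<^esub> x \<oplus>\<^bsub>E\<^esub> x = (- 1 + 1) \<odot>\<^bsub>E\<^esub> x" using x by (simp only: smult_l smult_1)
  also have "\<dots> = \<zero>\<^bsub>E\<^esub>" using x by simp
  finally show ?thesis using x by (intro M.minus_equality) auto
qed

lemma a_minus_smult: "y \<in> carrier E \<Longrightarrow> x \<ominus>\<^bsub>E\<^esub> y = x \<oplus>\<^bsub>E\<^esub> (- 1) \<odot>\<^bsub>E\<^esub> y"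
  by (simp add: a_minus_def a_inv_smult)

section \<open>Sublinear functionals\<close>

definition sublinear :: "('v \<Rightarrow> real) \<Rightarrow> bool" where
  "sublinear q \<longleftrightarrow> (\<forall>x\<in>carrier E. \<forall>y\<in>carrier E. q (x \<oplus>\<^bsub>E\<^esub> y) \<le> q x + q y) \<and>
     (\<forall>x\<in>carrier E. \<forall>t\<ge>0. q (of_real t \<odot>\<^bsub>E\<^esub> x) \<le> t * q x)"

lemma sublinearD:
  assumes "sublinear q"
  shows sublinear_add: "x \<in> carrier E \<Longrightarrow> y \<in> carrier E \<Longrightarrow> q (x \<oplus>\<^bsub>E\<^esub> y) \<le> q x + q y"
    and sublinear_scale_le: "x \<in> carrier E \<Longrightarrow> t \<ge> 0 \<Longrightarrow> q (of_real t \<odot>\<^bsub>E\<^esub> x) \<le> t * q x"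
  using assms by (auto simp: sublinear_def)

lemma sublinear_zero: "sublinear q \<Longrightarrow> q \<zero>\<^bsub>E\<^esub> = 0"
  using sublinear_add[of q "\<zero>\<^bsub>E\<^esub>" "\<zero>\<^bsub>E\<^esub>"] sublinear_scale_le[of q "\<zero>\<^bsub>E\<^esub>" 0] by simp

text \<open>Scaling back by \<open>1 / t\<close> turns the inequality of the definition into an
  equality, so that newly built functionals have to be checked for the inequality only.\<close>

lemma sublinear_scale:
  assumes q: "sublinear q" and x: "x \<in> carrier E" and t: "t \<ge> 0"
  shows "q (of_real t \<odot>\<^bsub>E\<^esub> x) = t * q x"
proof (cases "t = 0")
  case False
  have "q (of_real (1 / t) \<odot>\<^bsub>E\<^esub> (of_real t \<odot>\<^bsub>E\<^esub> x)) \<le> (1 / t) * q (of_real t \<odot>\<^bsub>E\<^esub> x)"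
    using sublinear_scale_le[OF q, of "of_real t \<odot>\<^bsub>E\<^esub> x" "1 / t"] x t by simp
  then have "q x \<le> q (of_real t \<odot>\<^bsub>E\<^esub> x) / t"
    using x False by (simp add: smult_assoc of_real_mult[symmetric] del: of_real_mult)
  then have "t * q x \<le> q (of_real t \<odot>\<^bsub>E\<^esub> x)" using t False by (simp add: field_simps)
  then show ?thesis using sublinear_scale_le[OF q x t] by simp
qed (use x sublinear_zero[OF q] in simp)

lemma smult_minus_add: "x \<in> carrier E \<Longrightarrow> x \<oplus>\<^bsub>E\<^esub> (- 1) \<odot>\<^bsub>E\<^esub> x = \<zero>\<^bsub>E\<^esub>"
  by (metis M.r_neg a_inv_smult)

lemma sublinear_lower:
  assumes "sublinear q" "x \<in> carrier E" shows "- q ((- 1) \<odot>\<^bsub>E\<^esub> x) \<le> q x"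
  using sublinear_add[OF assms(1), of x "(- 1) \<odot>\<^bsub>E\<^esub> x"] assms
  by (simp add: smult_minus_add sublinear_zero)

text \<open>The shift of \<open>q\<close> along \<open>v\<close> is the infimum over
  \<open>t \<ge> 0\<close> of \<open>q (y + t v) - t * q v\<close>. It lies below \<open>q\<close>
  by \<open>t = 0\<close>. If \<open>q\<close> is minimal it equals its shift, and
  \<open>t = 1\<close> yields superadditivity. At \<open>- v\<close> the shift is at most
  \<open>- q v\<close>, which will pin the value at \<open>v\<close>. Vanishing off the carrier
  makes the pointwise order usable for functions on the whole type.\<close>

lemma sublinear_shift:
  assumes q: "sublinear q" and v: "v \<in> carrier E"
  obtains q' where "sublinear q'" "\<And>y. y \<notin> carrier E \<Longrightarrow> q' y = 0"
    "\<And>y t. y \<in> carrier E \<Longrightarrow> t \<ge> 0 \<Longrightarrow> q' y \<le> q (y \<oplus>\<^bsub>E\<^esub> of_real t \<odot>\<^bsub>E\<^esub> v) - t * q v"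
proof -
  define S where "S y = {q (y \<oplus>\<^bsub>E\<^esub> of_real t \<odot>\<^bsub>E\<^esub> v) - t * q v | t. t \<ge> 0}" for y
  define q' where "q' y = (if y \<in> carrier E then Inf (S y) else 0)" for y
  \<comment> \<open>The lower bound comes from \<open>t v = (y + t v) + (- y)\<close> and
    \<open>q (t v) = t * q v\<close>.\<close>
  have bdd: "bdd_below (S y)" if y: "y \<in> carrier E" for y
  proof (rule bdd_belowI[of _ "- q ((- 1) \<odot>\<^bsub>E\<^esub> y)"])
    fix r assume "r \<in> S y"
    then obtain t where t: "t \<ge> 0" "r = q (y \<oplus>\<^bsub>E\<^esub> of_real t \<odot>\<^bsub>E\<^esub> v) - t * q v" by (auto simp: S_def)
    have "of_real t \<odot>\<^bsub>E\<^esub> v = (y \<oplus>\<^bsub>E\<^esub> of_real t \<odot>\<^bsub>E\<^esub> v) \<oplus>\<^bsub>E\<^esub> (- 1) \<odot>\<^bsub>E\<^esub> y"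
      using y v by (simp add: a_inv_smult[symmetric] M.a_ac M.r_neg1)
        (metis M.a_ac(2) M.a_inv_closed M.r_neg1 M.r_neg2 smult_cl)
    then have "t * q v \<le> q (y \<oplus>\<^bsub>E\<^esub> of_real t \<odot>\<^bsub>E\<^esub> v) + q ((- 1) \<odot>\<^bsub>E\<^esub> y)"
      using sublinear_add[OF q, of "y \<oplus>\<^bsub>E\<^esub> of_real t \<odot>\<^bsub>E\<^esub> v" "(- 1) \<odot>\<^bsub>E\<^esub> y"] sublinear_scale[OF q v t(1)] y v by simp
    then show "- q ((- 1) \<odot>\<^bsub>E\<^esub> y) \<le> r" using t by simp
  qed
  have ne: "S y \<noteq> {}" for y by (auto simp: S_def intro: exI[of _ 0])
  have le: "q' y \<le> q (y \<oplus>\<^bsub>E\<^esub> of_real t \<odot>\<^bsub>E\<^esub> v) - t * q v" if "y \<in> carrier E" "t \<ge> 0" for y t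
    using that by (auto simp: q'_def S_def intro!: cInf_lower bdd[unfolded S_def])
  have ge: "r \<le> q' y" if "y \<in> carrier E" "\<And>t. t \<ge> 0 \<Longrightarrow> r \<le> q (y \<oplus>\<^bsub>E\<^esub> of_real t \<odot>\<^bsub>E\<^esub> v) - t * q v" for y r
    using that ne[of y] by (auto simp: q'_def S_def intro!: cInf_greatest)
  show ?thesis
  proof (rule that[of q'])
    show "sublinear q'" unfolding sublinear_def
    proof (intro conjI ballI allI impI)
      fix x y assume x: "x \<in> carrier E" and y: "y \<in> carrier E"
      have "q' (x \<oplus>\<^bsub>E\<^esub> y) \<le> (q (x \<oplus>\<^bsub>E\<^esub> of_real s \<odot>\<^bsub>E\<^esub> v) - s * q v) + (q (y \<oplus>\<^bsub>E\<^esub> of_real t \<odot>\<^bsub>E\<^esub> v) - t * q v)"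
        if that: "s \<ge> 0" "t \<ge> 0" for s t
      proof -
        have "(x \<oplus>\<^bsub>E\<^esub> y) \<oplus>\<^bsub>E\<^esub> of_real (s + t) \<odot>\<^bsub>E\<^esub> v = (x \<oplus>\<^bsub>E\<^esub> of_real s \<odot>\<^bsub>E\<^esub> v) \<oplus>\<^bsub>E\<^esub> (y \<oplus>\<^bsub>E\<^esub> of_real t \<odot>\<^bsub>E\<^esub> v)"
          using x y v by (simp add: smult_l M.a_ac)
        then show ?thesis
          using le[of "x \<oplus>\<^bsub>E\<^esub> y" "s + t"] that x y v
            sublinear_add[OF q, of "x \<oplus>\<^bsub>E\<^esub> of_real s \<odot>\<^bsub>E\<^esub> v" "y \<oplus>\<^bsub>E\<^esub> of_real t \<odot>\<^bsub>E\<^esub> v"]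
          by (simp add: algebra_simps)
      qed
      then have "q' (x \<oplus>\<^bsub>E\<^esub> y) - (q (x \<oplus>\<^bsub>E\<^esub> of_real s \<odot>\<^bsub>E\<^esub> v) - s * q v) \<le> q' y" if "s \<ge> 0" for s
        using y that by (intro ge) (fastforce simp: diff_le_eq add.commute)+
      then have "q' (x \<oplus>\<^bsub>E\<^esub> y) - q' y \<le> q' x" using x by (intro ge) (auto simp: algebra_simps)
      then show "q' (x \<oplus>\<^bsub>E\<^esub> y) \<le> q' x + q' y" by simp
    next
      fix x and t :: real assume x: "x \<in> carrier E" and t: "t \<ge> 0"
      show "q' (of_real t \<odot>\<^bsub>E\<^esub> x) \<le> t * q' x"
      proof (cases "t = 0")
        case True
        then show ?thesis using le[of "\<zero>\<^bsub>E\<^esub>" 0] x v sublinear_zero[OF q] by simp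
      next
        case False
        have "q' (of_real t \<odot>\<^bsub>E\<^esub> x) / t \<le> q' x"
        proof (rule ge[OF x])
          fix s :: real assume s: "s \<ge> 0"
          have "of_real t \<odot>\<^bsub>E\<^esub> x \<oplus>\<^bsub>E\<^esub> of_real (t * s) \<odot>\<^bsub>E\<^esub> v = of_real t \<odot>\<^bsub>E\<^esub> (x \<oplus>\<^bsub>E\<^esub> of_real s \<odot>\<^bsub>E\<^esub> v)"
            using x v by (simp add: smult_r smult_assoc)
          then have "q' (of_real t \<odot>\<^bsub>E\<^esub> x) \<le> t * (q (x \<oplus>\<^bsub>E\<^esub> of_real s \<odot>\<^bsub>E\<^esub> v) - s * q v)"
            using le[of "of_real t \<odot>\<^bsub>E\<^esub> x" "t * s"] sublinear_scale_le[OF q, of "x \<oplus>\<^bsub>E\<^esub> of_real s \<odot>\<^bsub>E\<^esub> v" t] x v s t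
            by (simp add: algebra_simps)
          then show "q' (of_real t \<odot>\<^bsub>E\<^esub> x) / t \<le> q (x \<oplus>\<^bsub>E\<^esub> of_real s \<odot>\<^bsub>E\<^esub> v) - s * q v"
            using t False by (simp add: field_simps)
        qed
        then show ?thesis using t False by (simp add: field_simps)
      qed
    qed
    show "q' y = 0" if "y \<notin> carrier E" for y using that by (simp add: q'_def)
  qed (rule le)
qed

text \<open>Subadditivity needs the chain: for \<open>q\<close> at \<open>x\<close> and
  \<open>r\<close> at \<open>y\<close>, the smaller of the two serves both points. The values stay
  bounded below because each member satisfies
  \<open>q x \<ge> - q (- x) \<ge> - p (- x)\<close>.\<close>

lemma sublinear_chain_Inf:
  assumes C: "C \<noteq> {}" "\<And>q. q \<in> C \<Longrightarrow> sublinear q"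
    and chain: "\<And>q r. q \<in> C \<Longrightarrow> r \<in> C \<Longrightarrow> (\<forall>x. q x \<le> r x) \<or> (\<forall>x. r x \<le> q x)"
    and p: "\<And>q x. q \<in> C \<Longrightarrow> x \<in> carrier E \<Longrightarrow> q x \<le> p x"
  shows "sublinear (\<lambda>x. INF q\<in>C. q x)" "\<And>x q. x \<in> carrier E \<Longrightarrow> q \<in> C \<Longrightarrow> (INF q\<in>C. q x) \<le> q x"
proof -
  have bdd: "bdd_below ((\<lambda>q. q x) ` C)" if x: "x \<in> carrier E" for x
  proof (rule bdd_belowI2)
    fix q assume "q \<in> C"
    then show "- p ((- 1) \<odot>\<^bsub>E\<^esub> x) \<le> q x"
      using sublinear_lower[OF C(2) x, of q] p[of q "(- 1) \<odot>\<^bsub>E\<^esub> x"] x by fastforce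
  qed
  show le: "(INF q\<in>C. q x) \<le> q x" if "x \<in> carrier E" "q \<in> C" for x q
    using cINF_lower[OF bdd[OF that(1)] that(2)] by simp
  have ge: "r \<le> (INF q\<in>C. q x)" if "\<And>q. q \<in> C \<Longrightarrow> r \<le> q x" for r x
    using cINF_greatest[OF C(1), of r "\<lambda>q. q x"] that by blast
  show "sublinear (\<lambda>x. INF q\<in>C. q x)" unfolding sublinear_def
  proof (intro conjI ballI allI impI)
    fix x y assume x: "x \<in> carrier E" and y: "y \<in> carrier E"
    have *: "(INF q\<in>C. q (x \<oplus>\<^bsub>E\<^esub> y)) \<le> q x + r y" if qr: "q \<in> C" "r \<in> C" for q r
    proof -
      have "(\<forall>x. q x \<le> r x) \<or> (\<forall>x. r x \<le> q x)" using chain qr by blast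
      then obtain s where s: "s \<in> C" "s x \<le> q x" "s y \<le> r y" using qr by blast
      then show ?thesis
        using le[of "x \<oplus>\<^bsub>E\<^esub> y" s] sublinear_add[OF C(2)[OF s(1)] x y] x y by simp
    qed
    have "(INF q\<in>C. q (x \<oplus>\<^bsub>E\<^esub> y)) - q x \<le> (INF q\<in>C. q y)" if "q \<in> C" for q
      using that * by (intro ge) (fastforce simp: diff_le_eq add.commute)
    then have "(INF q\<in>C. q (x \<oplus>\<^bsub>E\<^esub> y)) - (INF q\<in>C. q y) \<le> (INF q\<in>C. q x)"
      by (intro ge) (simp add: algebra_simps)
    then show "(INF q\<in>C. q (x \<oplus>\<^bsub>E\<^esub> y)) \<le> (INF q\<in>C. q x) + (INF q\<in>C. q y)" by simp
  next
    fix x and t :: real assume x: "x \<in> carrier E" and t: "t \<ge> 0"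
    show "(INF q\<in>C. q (of_real t \<odot>\<^bsub>E\<^esub> x)) \<le> t * (INF q\<in>C. q x)"
    proof (cases "t = 0")
      case True
      obtain q where q: "q \<in> C" using C by blast
      then show ?thesis using le[of "\<zero>\<^bsub>E\<^esub>" q] True x sublinear_zero[OF C(2)[OF q]] by simp
    next
      case False
      have "(INF q\<in>C. q (of_real t \<odot>\<^bsub>E\<^esub> x)) / t \<le> (INF q\<in>C. q x)"
      proof (rule ge)
        fix q assume q: "q \<in> C"
        show "(INF q\<in>C. q (of_real t \<odot>\<^bsub>E\<^esub> x)) / t \<le> q x"
          using le[of "of_real t \<odot>\<^bsub>E\<^esub> x" q] sublinear_scale_le[OF C(2)[OF q] x t] x q t False
          by (simp add: field_simps)
      qed
      then show ?thesis using t False by (simp add: field_simps)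
    qed
  qed
qed

text \<open>A minimal sublinear functional below a given one is additive; this avoids extending
  functionals from subspaces.\<close>

lemma Hahn_Banach_real:
  assumes p: "sublinear p" and v: "v \<in> carrier E"
  obtains u where "sublinear u" "\<And>x. x \<in> carrier E \<Longrightarrow> u x \<le> p x" "u v = p v"
    "\<And>x y. x \<in> carrier E \<Longrightarrow> y \<in> carrier E \<Longrightarrow> u (x \<oplus>\<^bsub>E\<^esub> y) = u x + u y"
proof -
  \<comment> \<open>The search starts from the shift of \<open>p\<close> along \<open>v\<close>:
    everything below it is at most \<open>- p v\<close> at \<open>- v\<close>, hence at least
    \<open>p v\<close> at \<open>v\<close> once it is additive.\<close>
  obtain p' where p': "sublinear p'" "\<And>y. y \<notin> carrier E \<Longrightarrow> p' y = 0"
    and p'_le: "\<And>y t. y \<in> carrier E \<Longrightarrow> t \<ge> 0 \<Longrightarrow> p' y \<le> p (y \<oplus>\<^bsub>E\<^esub> of_real t \<odot>\<^bsub>E\<^esub> v) - t * p v"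
    using sublinear_shift[OF p v] by metis
  define A where "A = {q. sublinear q \<and> (\<forall>x\<in>carrier E. q x \<le> p' x) \<and> (\<forall>x. x \<notin> carrier E \<longrightarrow> q x = 0)}"
  \<comment> \<open>The reversed pointwise order, so that the maximal element given by Zorn's lemma
    is a minimal sublinear functional.\<close>
  define R where "R = (\<lambda>q q' :: 'v \<Rightarrow> real. \<forall>x. q' x \<le> q x)"
  have "\<exists>m\<in>A. \<forall>a\<in>A. R m a \<longrightarrow> a = m"
  proof (rule predicate_Zorn)
    show "partial_order_on A (relation_of R A)"
      by (rule partial_order_on_relation_ofI) (auto simp: R_def fun_eq_iff intro: order_trans antisym)
  next
    fix C assume C: "C \<in> Chains (relation_of R A)"
    then have CA: "q \<in> A" if "q \<in> C" for q using that by (auto simp: Chains_def relation_of_def)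
    show "\<exists>u\<in>A. \<forall>a\<in>C. R a u"
    proof (cases "C = {}")
      case True
      then show ?thesis using p' by (auto simp: A_def)
    next
      case False
      have ch: "(\<forall>x. q x \<le> r x) \<or> (\<forall>x. r x \<le> q x)" if "q \<in> C" "r \<in> C" for q r
        using C that by (auto simp: Chains_def relation_of_def R_def)
      have Cs: "sublinear q" "\<And>x. x \<in> carrier E \<Longrightarrow> q x \<le> p' x" "\<And>x. x \<notin> carrier E \<Longrightarrow> q x = 0" if "q \<in> C" for q
        using CA[OF that] by (auto simp: A_def)
      have inf1: "sublinear (\<lambda>x. INF q\<in>C. q x)"
        and inf2: "\<And>x q. x \<in> carrier E \<Longrightarrow> q \<in> C \<Longrightarrow> (INF q\<in>C. q x) \<le> q x"
        using sublinear_chain_Inf[of C p'] False Cs ch by blast+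
      have off: "(INF q\<in>C. q x) = 0" if "x \<notin> carrier E" for x
        using False that by (simp add: Cs(3) cong: INF_cong)
      obtain q0 where q0: "q0 \<in> C" using False by blast
      have "(INF q\<in>C. q x) \<le> p' x" if "x \<in> carrier E" for x
        using inf2[OF that q0] Cs(2)[OF q0 that] by force
      then have "(\<lambda>x. INF q\<in>C. q x) \<in> A" using inf1 off by (auto simp: A_def)
      moreover have "(INF q\<in>C. q x) \<le> q x" if "q \<in> C" for q x
        using inf2[OF _ that, of x] off[of x] Cs(3)[OF that, of x] by (cases "x \<in> carrier E") auto
      ultimately show ?thesis unfolding R_def by (intro bexI[of _ "\<lambda>x. INF q\<in>C. q x"]) auto
    qed
  qed
  then obtain u where u: "u \<in> A" and min: "\<And>a. a \<in> A \<Longrightarrow> R u a \<Longrightarrow> a = u" by blast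
  have us: "sublinear u" and up': "\<And>x. x \<in> carrier E \<Longrightarrow> u x \<le> p' x" and uoff: "\<And>x. x \<notin> carrier E \<Longrightarrow> u x = 0"
    using u by (auto simp: A_def)
  have add: "u (x \<oplus>\<^bsub>E\<^esub> y) = u x + u y" if x: "x \<in> carrier E" and y: "y \<in> carrier E" for x y
  proof -
    \<comment> \<open>The shift of \<open>u\<close> along \<open>y\<close> again belongs to
      \<open>A\<close> and lies below \<open>u\<close>, so minimality makes the two equal; the shift
      inequality at \<open>t = 1\<close> is then superadditivity of \<open>u\<close>.\<close>
    obtain w where w: "sublinear w" "\<And>z. z \<notin> carrier E \<Longrightarrow> w z = 0"
      and w_le: "\<And>z t. z \<in> carrier E \<Longrightarrow> t \<ge> 0 \<Longrightarrow> w z \<le> u (z \<oplus>\<^bsub>E\<^esub> of_real t \<odot>\<^bsub>E\<^esub> y) - t * u y"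
      using sublinear_shift[OF us y] by metis
    have wu: "w z \<le> u z" for z using w_le[of z 0] w(2)[of z] uoff[of z] y by (cases "z \<in> carrier E") auto
    then have "w \<in> A" using w up' by (force simp: A_def intro: order_trans)
    then have "w = u" using min wu by (auto simp: R_def)
    then have "u x + u y \<le> u (x \<oplus>\<^bsub>E\<^esub> y)" using w_le[OF x, of 1] y by simp
    then show ?thesis using sublinear_add[OF us x y] by simp
  qed
  have up: "u x \<le> p x" if "x \<in> carrier E" for x
    using up'[OF that] p'_le[OF that, of 0] v that by simp
  have "u ((- 1) \<odot>\<^bsub>E\<^esub> v) \<le> p (((- 1) \<odot>\<^bsub>E\<^esub> v) \<oplus>\<^bsub>E\<^esub> v) - p v"
    using up'[of "(- 1) \<odot>\<^bsub>E\<^esub> v"] p'_le[of "(- 1) \<odot>\<^bsub>E\<^esub> v" 1] v by simp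
  also have "\<dots> = - p v" using v smult_minus_add[OF v] sublinear_zero[OF p] by (simp add: M.a_comm)
  finally have "p v \<le> u v"
    using add[of v "(- 1) \<odot>\<^bsub>E\<^esub> v"] v smult_minus_add[OF v] sublinear_zero[OF us] by simp
  then have "u v = p v" using up[OF v] by simp
  then show ?thesis using that us up add by blast
qed

text \<open>A real functional \<open>u\<close> below \<open>p\<close> is completed to a scalar one
  by subtracting \<open>i * u (i x)\<close>. The bound survives because the vector can be rotated
  until the value is a nonnegative real, which \<open>u\<close> controls; the condition on
  \<open>p\<close> for all scalars \<open>c\<close> is what permits this rotation.\<close>

theorem Hahn_Banach:
  fixes p :: "'v \<Rightarrow> real"
  assumes sub: "\<And>x y. x \<in> carrier E \<Longrightarrow> y \<in> carrier E \<Longrightarrow> p (x \<oplus>\<^bsub>E\<^esub> y) \<le> p x + p y"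
    and hom: "\<And>c x. x \<in> carrier E \<Longrightarrow> p (c \<odot>\<^bsub>E\<^esub> x) \<le> norm c * p x"
    and v: "v \<in> carrier E"
  obtains \<phi> where "linear_map E scalar_space \<phi>" "\<And>x. x \<in> carrier E \<Longrightarrow> norm (\<phi> x) \<le> p x" "p v \<le> norm (\<phi> v)"
proof -
  obtain i :: 'k and re im where i: "i = 0 \<or> i * i = - 1"
    and dec: "\<And>x. x = of_real (re x) + of_real (im x) * i"
    and re: "\<And>a b. \<bar>a\<bar> \<le> norm (of_real a + of_real b * i)"
    using rc_field_coordinates by metis
  have p: "sublinear p" unfolding sublinear_def
    using sub hom[of _ "of_real t" for t] by (metis abs_of_nonneg norm_of_real)
  obtain u where us: "sublinear u" and up: "\<And>x. x \<in> carrier E \<Longrightarrow> u x \<le> p x" and uv: "u v = p v"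
    and add: "\<And>x y. x \<in> carrier E \<Longrightarrow> y \<in> carrier E \<Longrightarrow> u (x \<oplus>\<^bsub>E\<^esub> y) = u x + u y"
    using Hahn_Banach_real[OF p v] by metis
  have neg: "u ((- 1) \<odot>\<^bsub>E\<^esub> x) = - u x" if "x \<in> carrier E" for x
    using add[of x "(- 1) \<odot>\<^bsub>E\<^esub> x"] that smult_minus_add sublinear_zero[OF us] by simp
  have scale: "u (of_real t \<odot>\<^bsub>E\<^esub> x) = t * u x" if "x \<in> carrier E" for t x
  proof (cases "t \<ge> 0")
    case True
    then show ?thesis using sublinear_scale[OF us that] by simp
  next
    case False
    have "of_real t \<odot>\<^bsub>E\<^esub> x = of_real (- t) \<odot>\<^bsub>E\<^esub> ((- 1) \<odot>\<^bsub>E\<^esub> x)" using that by (simp add: smult_assoc)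
    then show ?thesis using sublinear_scale[OF us, of "(- 1) \<odot>\<^bsub>E\<^esub> x" "- t"] False that neg by simp
  qed
  \<comment> \<open>For \<open>i = 0\<close> the second term vanishes and \<open>\<phi>\<close> is
    \<open>u\<close> itself, so both scalar fields share the formula.\<close>
  define \<phi> where "\<phi> x = of_real (u x) - i * of_real (u (i \<odot>\<^bsub>E\<^esub> x))" for x
  have \<phi>_add: "\<phi> (x \<oplus>\<^bsub>E\<^esub> y) = \<phi> x + \<phi> y" if "x \<in> carrier E" "y \<in> carrier E" for x y
    using that by (simp add: \<phi>_def smult_r add algebra_simps)
  have \<phi>_real: "\<phi> (of_real t \<odot>\<^bsub>E\<^esub> x) = of_real t * \<phi> x" if x: "x \<in> carrier E" for t x
  proof -
    have "i \<odot>\<^bsub>E\<^esub> (of_real t \<odot>\<^bsub>E\<^esub> x) = of_real t \<odot>\<^bsub>E\<^esub> (i \<odot>\<^bsub>E\<^esub> x)"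
      using x by (simp add: smult_assoc mult.commute)
    then show ?thesis using x by (simp add: \<phi>_def scale algebra_simps)
  qed
  have \<phi>_i: "\<phi> (i \<odot>\<^bsub>E\<^esub> x) = i * \<phi> x" if x: "x \<in> carrier E" for x
  proof (cases "i = 0")
    case True
    then show ?thesis using x sublinear_zero[OF us] by (simp add: \<phi>_def)
  next
    case False
    then have ii: "i * i = - 1" using i by simp
    have "i \<odot>\<^bsub>E\<^esub> (i \<odot>\<^bsub>E\<^esub> x) = (- 1) \<odot>\<^bsub>E\<^esub> x" using x by (simp add: smult_assoc ii)
    then have "\<phi> (i \<odot>\<^bsub>E\<^esub> x) = of_real (u (i \<odot>\<^bsub>E\<^esub> x)) + i * of_real (u x)" using x by (simp add: \<phi>_def neg)
    also have "\<dots> = - (i * i) * of_real (u (i \<odot>\<^bsub>E\<^esub> x)) + i * of_real (u x)" by (simp add: ii)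
    also have "\<dots> = i * \<phi> x" by (simp add: \<phi>_def algebra_simps)
    finally show ?thesis .
  qed
  have \<phi>_smult: "\<phi> (c \<odot>\<^bsub>E\<^esub> x) = c * \<phi> x" if x: "x \<in> carrier E" for c x
  proof -
    have "c \<odot>\<^bsub>E\<^esub> x = (of_real (re c) + of_real (im c) * i) \<odot>\<^bsub>E\<^esub> x" using dec[of c] by simp
    also have "\<dots> = of_real (re c) \<odot>\<^bsub>E\<^esub> x \<oplus>\<^bsub>E\<^esub> of_real (im c) \<odot>\<^bsub>E\<^esub> (i \<odot>\<^bsub>E\<^esub> x)"
      using x by (simp add: smult_l smult_assoc)
    finally have "\<phi> (c \<odot>\<^bsub>E\<^esub> x) = of_real (re c) * \<phi> x + of_real (im c) * (i * \<phi> x)"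
      using x by (simp add: \<phi>_add \<phi>_real \<phi>_i)
    also have "\<dots> = (of_real (re c) + of_real (im c) * i) * \<phi> x" by (simp add: algebra_simps)
    finally show ?thesis using dec[of c] by simp
  qed
  have u_le: "\<bar>u x\<bar> \<le> norm (\<phi> x)" for x
    using re[of "u x" "- u (i \<odot>\<^bsub>E\<^esub> x)"] by (simp add: \<phi>_def mult.commute)
  have "norm (\<phi> x) \<le> p x" if x: "x \<in> carrier E" for x
  proof -
    obtain c where c: "norm c = 1" "c * \<phi> x = of_real (norm (\<phi> x))" using unit_rotation by blast
    define y where "y = c \<odot>\<^bsub>E\<^esub> x"
    have y: "y \<in> carrier E" "\<phi> y = of_real (norm (\<phi> x))" using x c by (simp_all add: y_def \<phi>_smult)
    have "norm (\<phi> x) \<le> u y"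
    proof (cases "i = 0")
      case True
      then have "of_real (u y) = (of_real (norm (\<phi> x)) :: 'k)" using y by (simp add: \<phi>_def)
      then show ?thesis by (simp only: of_real_eq_iff order_refl)
    next
      case False
      have "of_real (u y) - i * of_real (u (i \<odot>\<^bsub>E\<^esub> y)) = of_real (norm (\<phi> x))" using y(2) by (simp add: \<phi>_def)
      then have "of_real (u y - norm (\<phi> x)) + of_real (- u (i \<odot>\<^bsub>E\<^esub> y)) * i = 0" by (simp add: algebra_simps)
      then show ?thesis using re[of "u y - norm (\<phi> x)" "- u (i \<odot>\<^bsub>E\<^esub> y)"] by simp
    qed
    also have "\<dots> \<le> p x" using up[OF y(1)] hom[OF x, of c] c by (simp add: y_def)
    finally show ?thesis .
  qed
  moreover have "p v \<le> norm (\<phi> v)" using u_le[of v] uv by simp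
  moreover have "linear_map E scalar_space \<phi>" by (simp add: linear_map_def \<phi>_add \<phi>_smult)
  ultimately show ?thesis using that by blast
qed

end

section \<open>Finite-dimensional spaces of functions\<close>

definition fun_subspace :: "('a \<Rightarrow> 'k::rc_field) set \<Rightarrow> bool" where
  "fun_subspace S \<longleftrightarrow> (\<lambda>_. 0) \<in> S \<and> (\<forall>f\<in>S. \<forall>g\<in>S. (\<lambda>x. f x + g x) \<in> S) \<and> (\<forall>c. \<forall>f\<in>S. (\<lambda>x. c * f x) \<in> S)"

lemma fun_subspaceD:
  assumes "fun_subspace S"
  shows fun_subspace_zero: "(\<lambda>_. 0) \<in> S"
    and fun_subspace_add: "f \<in> S \<Longrightarrow> g \<in> S \<Longrightarrow> (\<lambda>x. f x + g x) \<in> S"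
    and fun_subspace_smult: "f \<in> S \<Longrightarrow> (\<lambda>x. c * f x) \<in> S"
  using assms by (auto simp: fun_subspace_def)

lemma fun_subspace_sum:
  assumes S: "fun_subspace S" and "finite I" "\<And>i. i \<in> I \<Longrightarrow> b i \<in> S"
  shows "(\<lambda>x. \<Sum>i\<in>I. c i * b i x) \<in> S"
  using assms(2,3)
  by (induction I rule: finite_induct)
    (auto simp: fun_subspace_zero[OF S] intro!: fun_subspace_add[OF S] fun_subspace_smult[OF S])

lemma fun_subspace_diff:
  assumes S: "fun_subspace S" and "f \<in> S" "g \<in> S"
  shows "(\<lambda>x. f x - g x) \<in> S"
  using fun_subspace_add[OF S assms(2) fun_subspace_smult[OF S assms(3), of "- 1"]] by simp

text \<open>Induction on the index set. If the points for the smaller family do not suffice, some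
  combination \<open>a\<close> vanishes on them but not at a point \<open>z\<close>. It must involve
  the new function, so it can be used to eliminate that function from any other combination, and
  adding the single point \<open>z\<close> is enough.\<close>

lemma determining_points:
  fixes b :: "'i \<Rightarrow> 'a \<Rightarrow> 'k::rc_field"
  assumes "finite I"
  obtains Z where "finite Z"
    "\<And>c. (\<And>z. z \<in> Z \<Longrightarrow> (\<Sum>i\<in>I. c i * b i z) = 0) \<Longrightarrow> \<forall>x. (\<Sum>i\<in>I. c i * b i x) = 0"
proof -
  have "\<exists>Z. finite Z \<and> (\<forall>c. (\<forall>z\<in>Z. (\<Sum>i\<in>I. c i * b i z) = 0) \<longrightarrow> (\<forall>x. (\<Sum>i\<in>I. c i * b i x) = 0))"
    using assms
  proof (induction I rule: finite_induct)
    case (insert j I)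
    define comb where "comb c x = (\<Sum>i\<in>I. c i * b i x)" for c x
    have ins: "(\<Sum>i\<in>insert j I. c i * b i x) = c j * b j x + comb c x" for c x
      using insert.hyps by (simp add: comb_def)
    obtain Z where Z: "finite Z" "\<And>c. (\<forall>z\<in>Z. comb c z = 0) \<Longrightarrow> (\<forall>x. comb c x = 0)"
      using insert.IH by (auto simp: comb_def)
    show ?case
    proof (cases "\<exists>c z. (\<forall>z\<in>Z. c j * b j z + comb c z = 0) \<and> c j * b j z + comb c z \<noteq> 0")
      case False
      then have "\<And>c z. (\<forall>z\<in>Z. c j * b j z + comb c z = 0) \<Longrightarrow> c j * b j z + comb c z = 0" by metis
      then show ?thesis unfolding ins using Z(1) by (intro exI[of _ Z] conjI allI impI) simp_all
    next
      case True
      then obtain a z where a: "\<forall>z\<in>Z. a j * b j z + comb a z = 0" "a j * b j z + comb a z \<noteq> 0" by blast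
      have aj: "a j \<noteq> 0"
      proof
        assume "a j = 0"
        then show False using a Z(2)[of a] by auto
      qed
      have *: "c j * b j x + comb c x = 0"
        if c: "\<forall>y\<in>insert z Z. c j * b j y + comb c y = 0" for c x
      proof -
        \<comment> \<open>The multiple \<open>r\<close> of \<open>a\<close> cancels the component at
          \<open>j\<close>. The remaining combination \<open>d\<close> vanishes on \<open>Z\<close>,
          hence everywhere, and evaluation at \<open>z\<close> forces \<open>r = 0\<close>.\<close>
        define r where "r = c j / a j"
        define d where "d i = c i - r * a i" for i
        have cr: "c j = r * a j" using aj by (simp add: r_def)
        have d: "comb d y = (c j * b j y + comb c y) - r * (a j * b j y + comb a y)" for y
          by (simp add: comb_def d_def left_diff_distrib sum_subtractf sum_distrib_left cr algebra_simps)
        then have 0: "comb d y = 0" for y using Z(2)[of d] c a by auto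
        then have "r = 0" using d[of z] c a(2) by auto
        then show ?thesis using d[of x] 0 by simp
      qed
      show ?thesis unfolding ins
        by (rule exI[of _ "insert z Z"]) (use Z(1) in \<open>intro conjI allI impI *; simp\<close>)
    qed
  qed auto
  then obtain Z where Z: "finite Z"
    "\<forall>c. (\<forall>z\<in>Z. (\<Sum>i\<in>I. c i * b i z) = 0) \<longrightarrow> (\<forall>x. (\<Sum>i\<in>I. c i * b i x) = 0)" by (elim exE conjE)
  show ?thesis by (rule that[OF Z(1)]) (simp add: Z(2)[rule_format])
qed

text \<open>Lagrange interpolation by induction on the points: the functions vanishing at the new
  point \<open>y\<close> are covered by the induction hypothesis. The points may be redundant, so
  \<open>e z\<close> need not have value 1 at \<open>z\<close>; if all functions of the current
  space vanish at \<open>y\<close>, its function is 0.\<close>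

lemma interpolation:
  fixes S :: "('a \<Rightarrow> 'k::rc_field) set"
  assumes "fun_subspace S" "finite Z" "\<And>g. g \<in> S \<Longrightarrow> \<forall>z\<in>Z. g z = 0 \<Longrightarrow> g = (\<lambda>_. 0)"
  shows "\<exists>e. (\<forall>z\<in>Z. e z \<in> S) \<and> (\<forall>g\<in>S. \<forall>x. g x = (\<Sum>z\<in>Z. g z * e z x))"
  using assms(2,1,3)
proof (induction Z arbitrary: S rule: finite_induct)
  case empty
  then show ?case by auto
next
  case (insert y Z)
  note S = insert.prems(1)
  define S0 where "S0 = {g \<in> S. g y = 0}"
  have "fun_subspace S0"
    using S by (simp add: S0_def fun_subspace_def)
  moreover have "g = (\<lambda>_. 0)" if "g \<in> S0" "\<forall>z\<in>Z. g z = 0" for g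
    using that insert.prems(2)[of g] by (auto simp: S0_def)
  ultimately obtain e where e: "\<And>z. z \<in> Z \<Longrightarrow> e z \<in> S0" and eq: "\<And>g x. g \<in> S0 \<Longrightarrow> g x = (\<Sum>z\<in>Z. g z * e z x)"
    using insert.IH[of S0] by blast
  have eS: "z \<in> Z \<Longrightarrow> e z \<in> S" for z using e by (auto simp: S0_def)
  have upd: "(\<Sum>z\<in>insert y Z. g z * (e(y := h)) z x) = g y * h x + (\<Sum>z\<in>Z. g z * e z x)" for g h x
  proof -
    have "(\<Sum>z\<in>Z. g z * (e(y := h)) z x) = (\<Sum>z\<in>Z. g z * e z x)"
      using insert.hyps by (intro sum.cong) auto
    then show ?thesis using insert.hyps by simp
  qed
  show ?case
  proof (cases "\<exists>h\<in>S. h y \<noteq> 0")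
    case False
    then have "S0 = S" by (auto simp: S0_def)
    then show ?thesis using eq eS fun_subspace_zero[OF S] upd
      by (intro exI[of _ "e(y := \<lambda>_. 0)"]) auto
  next
    case True
    then obtain h0 where h0: "h0 \<in> S" "h0 y \<noteq> 0" by blast
    define h where "h x = inverse (h0 y) * h0 x" for x
    have h: "h \<in> S" "h y = 1" using h0 fun_subspace_smult[OF S h0(1)] by (auto simp: h_def[abs_def])
    \<comment> \<open>The correction removes from \<open>h\<close> what the interpolation at the
      points of \<open>Z\<close> already produces, so that \<open>k\<close> carries exactly the
      contribution of the value at \<open>y\<close>.\<close>
    define k where "k x = h x - (\<Sum>z\<in>Z. h z * e z x)" for x
    have "k \<in> S" unfolding k_def[abs_def]
      using fun_subspace_diff[OF S h(1) fun_subspace_sum[OF S insert.hyps(1), of e h]] eS by simp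
    moreover have "g x = g y * k x + (\<Sum>z\<in>Z. g z * e z x)" if g: "g \<in> S" for g x
    proof -
      have "(\<lambda>x. g x - g y * h x) \<in> S0"
        using fun_subspace_diff[OF S g fun_subspace_smult[OF S h(1), of "g y"]] h by (simp add: S0_def)
      from eq[OF this, of x]
      have "g x - g y * h x = (\<Sum>z\<in>Z. g z * e z x) - g y * (\<Sum>z\<in>Z. h z * e z x)"
        by (simp add: left_diff_distrib sum_subtractf sum_distrib_left mult.assoc)
      then show ?thesis by (simp add: k_def algebra_simps)
    qed
    ultimately show ?thesis using eS upd by (intro exI[of _ "e(y := k)"]) auto
  qed
qed

lemma finite_interpolation:
  fixes S :: "('a \<Rightarrow> 'k::rc_field) set" and b :: "'i \<Rightarrow> 'a \<Rightarrow> 'k"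
  assumes S: "fun_subspace S" and I: "finite I"
    and span: "\<And>g. g \<in> S \<Longrightarrow> \<exists>c. \<forall>x. g x = (\<Sum>i\<in>I. c i * b i x)"
    and off: "\<And>g x. g \<in> S \<Longrightarrow> x \<notin> X \<Longrightarrow> g x = 0"
  obtains Z e where "finite Z" "Z \<subseteq> X" "\<And>z. z \<in> Z \<Longrightarrow> e z \<in> S" "\<And>g x. g \<in> S \<Longrightarrow> g x = (\<Sum>z\<in>Z. g z * e z x)"
proof -
  obtain Z where Z: "finite Z"
    "\<And>c. (\<And>z. z \<in> Z \<Longrightarrow> (\<Sum>i\<in>I. c i * b i z) = 0) \<Longrightarrow> \<forall>x. (\<Sum>i\<in>I. c i * b i x) = 0"
    using determining_points[OF I, of b] by blast
  have "g = (\<lambda>_. 0)" if g: "g \<in> S" "\<forall>z\<in>Z \<inter> X. g z = 0" for g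
  proof -
    obtain c where c: "\<forall>x. g x = (\<Sum>i\<in>I. c i * b i x)" using span g by blast
    then show ?thesis using Z(2)[of c] g off[OF g(1)] by fastforce
  qed
  then have "\<exists>e. (\<forall>z\<in>Z \<inter> X. e z \<in> S) \<and> (\<forall>g\<in>S. \<forall>x. g x = (\<Sum>z\<in>Z \<inter> X. g z * e z x))"
    by (intro interpolation[OF S]) (use Z in auto)
  then show ?thesis using that[of "Z \<inter> X"] Z by blast
qed

section \<open>Linear combinations, linear maps and operator norms\<close>

text \<open>Coefficients and vectors are indexed separately, so vectors may repeat, and an element
  of the bidual can serve as the coefficient function on a set of functionals.\<close>

definition lincomb :: "('k::rc_field, 'v) nspace \<Rightarrow> 'i set \<Rightarrow> ('i \<Rightarrow> 'k) \<Rightarrow> ('i \<Rightarrow> 'v) \<Rightarrow> 'v" where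
  "lincomb E I c b = (\<Oplus>\<^bsub>E\<^esub>i\<in>I. c i \<odot>\<^bsub>E\<^esub> b i)"

lemma linear_mapD:
  assumes "linear_map E F T"
  shows linear_map_cl: "x \<in> carrier E \<Longrightarrow> T x \<in> carrier F"
    and linear_map_add: "x \<in> carrier E \<Longrightarrow> y \<in> carrier E \<Longrightarrow> T (x \<oplus>\<^bsub>E\<^esub> y) = T x \<oplus>\<^bsub>F\<^esub> T y"
    and linear_map_smult: "x \<in> carrier E \<Longrightarrow> T (c \<odot>\<^bsub>E\<^esub> x) = c \<odot>\<^bsub>F\<^esub> T x"
  using assms by (auto simp: linear_map_def)

lemma linear_form_iff:
  "linear_map E scalar_space f \<longleftrightarrow> (\<forall>x\<in>carrier E. \<forall>y\<in>carrier E. f (x \<oplus>\<^bsub>E\<^esub> y) = f x + f y) \<and>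
     (\<forall>c. \<forall>x\<in>carrier E. f (c \<odot>\<^bsub>E\<^esub> x) = c * f x)"
  by (auto simp: linear_map_def)

context vspace
begin

lemma zero_cl [simp, intro]: "\<zero>\<^bsub>E\<^esub> \<in> carrier E" by simp

lemma lincomb_cl [simp, intro]: "(\<And>i. i \<in> I \<Longrightarrow> b i \<in> carrier E) \<Longrightarrow> lincomb E I c b \<in> carrier E"
  unfolding lincomb_def by (rule M.finsum_closed) auto

lemma lincomb_empty [simp]: "lincomb E {} c b = \<zero>\<^bsub>E\<^esub>"
  by (simp add: lincomb_def)

lemma lincomb_insert:
  assumes "finite I" "j \<notin> I" "b j \<in> carrier E" "\<And>i. i \<in> I \<Longrightarrow> b i \<in> carrier E"
  shows "lincomb E (insert j I) c b = c j \<odot>\<^bsub>E\<^esub> b j \<oplus>\<^bsub>E\<^esub> lincomb E I c b"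
  unfolding lincomb_def using assms by (intro M.finsum_insert) auto

lemma lincomb_cong: "(\<And>i. i \<in> I \<Longrightarrow> c i = d i) \<Longrightarrow> (\<And>i. i \<in> I \<Longrightarrow> b i = b' i) \<Longrightarrow> 
    (\<And>i. i \<in> I \<Longrightarrow> b' i \<in> carrier E) \<Longrightarrow> lincomb E I c b = lincomb E I d b'"
  unfolding lincomb_def by (intro M.finsum_cong') auto

lemma lincomb_add:
  assumes "finite I" "\<And>i. i \<in> I \<Longrightarrow> b i \<in> carrier E"
  shows "lincomb E I (\<lambda>i. c i + d i) b = lincomb E I c b \<oplus>\<^bsub>E\<^esub> lincomb E I d b"
  using assms by (induction I rule: finite_induct) (simp_all add: lincomb_insert smult_l M.a_ac)

lemma lincomb_add_vec:
  assumes "finite I" "\<And>i. i \<in> I \<Longrightarrow> b i \<in> carrier E" "\<And>i. i \<in> I \<Longrightarrow> b' i \<in> carrier E"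
  shows "lincomb E I c (\<lambda>i. b i \<oplus>\<^bsub>E\<^esub> b' i) = lincomb E I c b \<oplus>\<^bsub>E\<^esub> lincomb E I c b'"
  using assms by (induction I rule: finite_induct) (simp_all add: lincomb_insert smult_r M.a_ac)

lemma lincomb_smult:
  assumes "finite I" "\<And>i. i \<in> I \<Longrightarrow> b i \<in> carrier E"
  shows "lincomb E I (\<lambda>i. a * c i) b = a \<odot>\<^bsub>E\<^esub> lincomb E I c b"
  using assms by (induction I rule: finite_induct) (simp_all add: lincomb_insert smult_r smult_assoc)

lemma lincomb_smult_vec:
  assumes "finite I" "\<And>i. i \<in> I \<Longrightarrow> b i \<in> carrier E"
  shows "lincomb E I c (\<lambda>i. a \<odot>\<^bsub>E\<^esub> b i) = a \<odot>\<^bsub>E\<^esub> lincomb E I c b"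
  using assms
  by (induction I rule: finite_induct) (simp_all add: lincomb_insert smult_r smult_assoc mult.commute)

lemma linear_map_zero:
  assumes "linear_map E F T" "vspace F" shows "T \<zero>\<^bsub>E\<^esub> = \<zero>\<^bsub>F\<^esub>"
proof -
  interpret F: vspace F by fact
  have "T (0 \<odot>\<^bsub>E\<^esub> \<zero>\<^bsub>E\<^esub>) = 0 \<odot>\<^bsub>F\<^esub> T \<zero>\<^bsub>E\<^esub>" using assms(1) by (rule linear_map_smult) simp
  then show ?thesis using linear_map_cl[OF assms(1), of "\<zero>\<^bsub>E\<^esub>"] by simp
qed

lemma linear_map_lincomb:
  assumes T: "linear_map E F T" "vspace F" and "finite I" "\<And>i. i \<in> I \<Longrightarrow> b i \<in> carrier E"
  shows "T (lincomb E I c b) = lincomb F I c (\<lambda>i. T (b i))"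
proof -
  interpret F: vspace F by fact
  show ?thesis using assms(3,4)
    by (induction I rule: finite_induct)
      (simp_all add: linear_map_zero[OF T] lincomb_insert F.lincomb_insert linear_mapD[OF T(1)])
qed

end

lemma normed_space_scalar_space: "normed_space (scalar_space :: ('k::rc_field, 'k) nspace)"
proof -
  have "\<exists>y. y + x = 0" for x :: 'k by (rule exI[of _ "- x"]) simp
  then show ?thesis
    by (intro normed_space.intro normed_space_axioms.intro Module.moduleI cring_scalar_space abelian_groupI)
      (auto simp: algebra_simps norm_mult intro: norm_triangle_ineq)
qed

lemma vspace_scalar_space: "vspace scalar_space"
  using normed_space_scalar_space normed_space_def vspace_def by blast

lemma lincomb_scalar_space: "finite I \<Longrightarrow> lincomb scalar_space I c b = (\<Sum>i\<in>I. c i * b i)"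
proof -
  interpret vspace scalar_space by (rule vspace_scalar_space)
  show "finite I \<Longrightarrow> ?thesis" by (induction I rule: finite_induct) (simp_all add: lincomb_insert)
qed

context vspace
begin

lemma linear_form_lincomb:
  assumes "linear_map E scalar_space f" "finite I" "\<And>i. i \<in> I \<Longrightarrow> b i \<in> carrier E"
  shows "f (lincomb E I c b) = (\<Sum>i\<in>I. c i * f (b i))"
  using linear_map_lincomb[OF assms(1) vspace_scalar_space assms(2), of b c] assms
  by (simp add: lincomb_scalar_space)

lemma linear_form_zero: "linear_map E scalar_space f \<Longrightarrow> f \<zero>\<^bsub>E\<^esub> = 0"
  using linear_map_zero[OF _ vspace_scalar_space] by fastforce

lemma linear_form_diff:
  "linear_map E scalar_space f \<Longrightarrow> x \<in> carrier E \<Longrightarrow> y \<in> carrier E \<Longrightarrow> f (x \<ominus>\<^bsub>E\<^esub> y) = f x - f y"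
  by (simp add: a_minus_smult linear_mapD)

end

context normed_space
begin

lemma nrm_zero [simp]: "nrm E \<zero>\<^bsub>E\<^esub> = 0"
  using nrm_eq_0_iff[of "\<zero>\<^bsub>E\<^esub>"] by simp

lemma nrm_uminus: "x \<in> carrier E \<Longrightarrow> nrm E ((- 1) \<odot>\<^bsub>E\<^esub> x) = nrm E x"
  by (simp add: nrm_smult)

lemma nrm_nonneg [simp]: "x \<in> carrier E \<Longrightarrow> 0 \<le> nrm E x"
  using nrm_triangle[of x "(- 1) \<odot>\<^bsub>E\<^esub> x"] by (simp add: smult_minus_add nrm_uminus)

lemma nrm_lincomb_le:
  assumes "finite I" "\<And>i. i \<in> I \<Longrightarrow> b i \<in> carrier E"
  shows "nrm E (lincomb E I c b) \<le> (\<Sum>i\<in>I. norm (c i) * nrm E (b i))"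
  using assms
proof (induction I rule: finite_induct)
  case (insert j I)
  then show ?case using nrm_triangle[of "c j \<odot>\<^bsub>E\<^esub> b j" "lincomb E I c b"]
    by (simp add: lincomb_insert nrm_smult)
qed simp

lemma eq_if_nrm_diff_0: "x \<in> carrier E \<Longrightarrow> y \<in> carrier E \<Longrightarrow> nrm E (x \<ominus>\<^bsub>E\<^esub> y) = 0 \<Longrightarrow> x = y"
  using nrm_eq_0_iff[of "x \<ominus>\<^bsub>E\<^esub> y"] M.minus_equality[of x "\<ominus>\<^bsub>E\<^esub> y"] by (simp add: a_minus_def)

end

lemma op_norm_bound:
  assumes E: "normed_space E" and F: "normed_space F" and T: "bounded_linear_map E F T" and x: "x \<in> carrier E"
  shows "nrm F (T x) \<le> op_norm E F T * nrm E x"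
proof -
  interpret E: normed_space E by fact
  interpret F: normed_space F by fact
  obtain C where C: "\<And>x. x \<in> carrier E \<Longrightarrow> nrm F (T x) \<le> C * nrm E x" and lin: "linear_map E F T"
    using T by (auto simp: bounded_linear_map_def)
  show ?thesis
  proof (cases "nrm E x = 0")
    case True
    then show ?thesis using C[OF x] by simp
  next
    case False
    then have pos: "nrm E x > 0" using x E.nrm_nonneg[OF x] by linarith
    define y where "y = of_real (1 / nrm E x) \<odot>\<^bsub>E\<^esub> x"
    have y: "y \<in> carrier E" "nrm E y = 1" using x pos by (simp_all add: y_def E.nrm_smult norm_divide)
    have "nrm F (T y) \<le> op_norm E F T" unfolding op_norm_def
    proof (rule cSup_upper)
      show "bdd_above {nrm F (T x) |x. x \<in> carrier E \<and> nrm E x \<le> 1}"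
      proof (rule bdd_aboveI, clarify)
        fix x assume x: "x \<in> carrier E" "nrm E x \<le> 1"
        have "nrm F (T x) \<le> C * nrm E x" using C x by blast
        also have "\<dots> \<le> \<bar>C\<bar> * nrm E x" using x by (intro mult_right_mono) auto
        also have "\<dots> \<le> \<bar>C\<bar> * 1" using x by (intro mult_left_mono) auto
        finally show "nrm F (T x) \<le> \<bar>C\<bar>" by simp
      qed
    qed (use y in auto)
    moreover have "T y = of_real (1 / nrm E x) \<odot>\<^bsub>F\<^esub> T x"
      unfolding y_def using lin x by (rule linear_map_smult)
    then have "nrm F (T y) = nrm F (T x) / nrm E x"
      using linear_map_cl[OF lin x] pos by (simp add: F.nrm_smult norm_divide)
    ultimately show ?thesis using pos by (simp add: field_simps)
  qed
qed

lemma op_norm_le: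
  assumes E: "normed_space E" and C: "C \<ge> 0" "\<And>x. x \<in> carrier E \<Longrightarrow> nrm F (T x) \<le> C * nrm E x"
  shows "op_norm E F T \<le> C"
proof -
  interpret E: normed_space E by fact
  show ?thesis unfolding op_norm_def
  proof (rule cSup_least)
    show "{nrm F (T x) |x. x \<in> carrier E \<and> nrm E x \<le> 1} \<noteq> {}"
      by (auto intro: exI[of _ "\<zero>\<^bsub>E\<^esub>"])
    fix r assume "r \<in> {nrm F (T x) |x. x \<in> carrier E \<and> nrm E x \<le> 1}"
    then obtain x where x: "x \<in> carrier E" "nrm E x \<le> 1" "r = nrm F (T x)" by blast
    then show "r \<le> C" using C(2)[OF x(1)] mult_left_mono[OF x(2) C(1)] by simp
  qed
qed

lemma op_norm_nonneg:
  assumes "normed_space E" "normed_space F" "bounded_linear_map E F T"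
  shows "0 \<le> op_norm E F T"
proof -
  interpret E: normed_space E by fact
  interpret F: normed_space F by fact
  have T: "linear_map E F T" using assms by (simp add: bounded_linear_map_def)
  obtain C where C: "\<And>x. x \<in> carrier E \<Longrightarrow> nrm F (T x) \<le> C * nrm E x"
    using assms by (auto simp: bounded_linear_map_def)
  show ?thesis
  proof (cases "\<exists>x\<in>carrier E. nrm E x \<noteq> 0")
    case True
    then obtain x where x: "x \<in> carrier E" "nrm E x > 0" using E.nrm_nonneg by fastforce
    have "0 \<le> nrm F (T x)" using linear_map_cl[OF T x(1)] by simp
    also have "\<dots> \<le> op_norm E F T * nrm E x" using op_norm_bound[OF assms x(1)] .
    finally show ?thesis using x by (simp add: zero_le_mult_iff)
  next
    case False
    then have "x \<in> carrier E \<Longrightarrow> x = \<zero>\<^bsub>E\<^esub>" for x using E.nrm_eq_0_iff by blast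
    then have "{nrm F (T x) |x. x \<in> carrier E \<and> nrm E x \<le> 1} = {nrm F (T \<zero>\<^bsub>E\<^esub>)}" by force
    then show ?thesis using linear_map_cl[OF T, of "\<zero>\<^bsub>E\<^esub>"] by (simp add: op_norm_def)
  qed
qed

section \<open>Function spaces and duals\<close>

lemma fun_space_simps [simp]:
  "carrier (fun_space S N) = S" "f \<oplus>\<^bsub>fun_space S N\<^esub> g = (\<lambda>x. f x + g x)"
  "c \<odot>\<^bsub>fun_space S N\<^esub> f = (\<lambda>x. c * f x)" "\<zero>\<^bsub>fun_space S N\<^esub> = (\<lambda>_. 0)" "nrm (fun_space S N) = N"
  by (simp_all add: fun_space_def)

lemma vspace_fun_space:
  assumes S: "fun_subspace S" shows "vspace (fun_space S N)"
proof -
  have "\<exists>g\<in>S. \<forall>x. g x + f x = 0" if "f \<in> S" for f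
    using fun_subspace_smult[OF S that, of "- 1"] by (intro bexI[of _ "\<lambda>x. - 1 * f x"]) auto
  then show ?thesis
    unfolding vspace_def
    by (intro Module.moduleI cring_scalar_space abelian_groupI)
      (auto simp: fun_subspaceD[OF S] algebra_simps fun_eq_iff)
qed

lemma a_minus_fun_space:
  assumes "fun_subspace S" "g \<in> S"
  shows "f \<ominus>\<^bsub>fun_space S N\<^esub> g = (\<lambda>x. f x - g x)"
  using vspace.a_minus_smult[OF vspace_fun_space[OF assms(1)], of g N f] assms(2) by simp

lemma fun_subspace_carrier:
  assumes "vspace (fun_space S N)" shows "fun_subspace S"
proof -
  interpret vspace "fun_space S N" by fact
  show ?thesis
    using zero_cl M.a_closed smult_cl by (simp add: fun_subspace_def)
qed

lemma dual_iff:
  "f \<in> carrier (dual E) \<longleftrightarrow> linear_map E scalar_space f \<and>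
     (\<exists>C. \<forall>x\<in>carrier E. norm (f x) \<le> C * nrm E x) \<and> vanishing_off E f"
  by (simp add: dual_def bounded_linear_map_def)

lemma dual_simps [simp]:
  "f \<oplus>\<^bsub>dual E\<^esub> g = (\<lambda>x. f x + g x)" "c \<odot>\<^bsub>dual E\<^esub> f = (\<lambda>x. c * f x)" "\<zero>\<^bsub>dual E\<^esub> = (\<lambda>_. 0)"
  "nrm (dual E) = op_norm E scalar_space"
  by (simp_all add: dual_def)

lemma dual_fun_space: "dual E = fun_space (carrier (dual E)) (op_norm E scalar_space)"
  by (simp add: dual_def)

lemma dualI:
  assumes "\<And>x y. x \<in> carrier E \<Longrightarrow> y \<in> carrier E \<Longrightarrow> f (x \<oplus>\<^bsub>E\<^esub> y) = f x + f y"
    "\<And>c x. x \<in> carrier E \<Longrightarrow> f (c \<odot>\<^bsub>E\<^esub> x) = c * f x"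
    "\<And>x. x \<in> carrier E \<Longrightarrow> norm (f x) \<le> C * nrm E x" "\<And>x. x \<notin> carrier E \<Longrightarrow> f x = 0"
  shows "f \<in> carrier (dual E)"
  unfolding dual_iff linear_form_iff vanishing_off_def using assms
  by (intro conjI exI[of _ C]) simp_all

lemma dualD:
  assumes "f \<in> carrier (dual E)"
  shows dual_linear: "linear_map E scalar_space f"
    and dual_add: "x \<in> carrier E \<Longrightarrow> y \<in> carrier E \<Longrightarrow> f (x \<oplus>\<^bsub>E\<^esub> y) = f x + f y"
    and dual_smult: "x \<in> carrier E \<Longrightarrow> f (c \<odot>\<^bsub>E\<^esub> x) = c * f x"
    and dual_off: "x \<notin> carrier E \<Longrightarrow> f x = 0"
  using assms by (auto simp: dual_iff linear_form_iff vanishing_off_def)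

context normed_space
begin

lemma fun_subspace_dual: "fun_subspace (carrier (dual E))"
  unfolding fun_subspace_def
proof (intro conjI ballI allI)
  show "(\<lambda>_. 0) \<in> carrier (dual E)" by (rule dualI[where C=0]) auto
next
  fix f g assume f: "f \<in> carrier (dual E)" and g: "g \<in> carrier (dual E)"
  obtain C D where "\<forall>x\<in>carrier E. norm (f x) \<le> C * nrm E x" "\<forall>x\<in>carrier E. norm (g x) \<le> D * nrm E x"
    using f g by (auto simp: dual_iff)
  then have "norm (f x + g x) \<le> (C + D) * nrm E x" if "x \<in> carrier E" for x
    using norm_triangle_le[OF add_mono, of "f x" "C * nrm E x" "g x" "D * nrm E x"] that
    by (simp add: distrib_right)
  then show "(\<lambda>x. f x + g x) \<in> carrier (dual E)"
    by (intro dualI[where C="C + D"]) (auto simp: dualD[OF f] dualD[OF g] algebra_simps)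
next
  fix c f assume f: "f \<in> carrier (dual E)"
  obtain C where "\<forall>x\<in>carrier E. norm (f x) \<le> C * nrm E x" using f by (auto simp: dual_iff)
  then have "norm (c * f x) \<le> (norm c * C) * nrm E x" if "x \<in> carrier E" for x
    using that by (simp add: norm_mult mult_left_mono mult.assoc)
  then show "(\<lambda>x. c * f x) \<in> carrier (dual E)"
    by (intro dualI[where C="norm c * C"]) (auto simp: dualD[OF f] algebra_simps)
qed

lemma vspace_dual: "vspace (dual E)"
  by (subst dual_fun_space) (rule vspace_fun_space[OF fun_subspace_dual])

lemma dual_bound: "f \<in> carrier (dual E) \<Longrightarrow> x \<in> carrier E \<Longrightarrow> norm (f x) \<le> op_norm E scalar_space f * nrm E x"
  using op_norm_bound[OF normed_space_axioms normed_space_scalar_space, of f x]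
  by (simp add: dual_iff bounded_linear_map_def)

lemma dual_nonneg: "f \<in> carrier (dual E) \<Longrightarrow> 0 \<le> op_norm E scalar_space f"
  using op_norm_nonneg[OF normed_space_axioms normed_space_scalar_space, of f]
  by (simp add: dual_iff bounded_linear_map_def)

lemma dual_norm_le: "C \<ge> 0 \<Longrightarrow> (\<And>x. x \<in> carrier E \<Longrightarrow> norm (f x) \<le> C * nrm E x) \<Longrightarrow> op_norm E scalar_space f \<le> C"
  using op_norm_le[OF normed_space_axioms, of C scalar_space f] by simp

lemma normed_space_dual: "normed_space (dual E)"
proof -
  interpret D: vspace "dual E" by (rule vspace_dual)
  have add: "op_norm E scalar_space (\<lambda>x. f x + g x) \<le> op_norm E scalar_space f + op_norm E scalar_space g"
    if f: "f \<in> carrier (dual E)" and g: "g \<in> carrier (dual E)" for f g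
  proof (rule dual_norm_le)
    fix x assume x: "x \<in> carrier E"
    show "norm (f x + g x) \<le> (op_norm E scalar_space f + op_norm E scalar_space g) * nrm E x"
      using norm_triangle_le[OF add_mono[OF dual_bound[OF f x] dual_bound[OF g x]]] by (simp add: distrib_right)
  qed (simp add: dual_nonneg f g)
  have le: "op_norm E scalar_space (\<lambda>x. c * f x) \<le> norm c * op_norm E scalar_space f"
    if f: "f \<in> carrier (dual E)" for c f
    by (rule dual_norm_le) (auto simp: dual_nonneg f norm_mult mult.assoc intro!: mult_left_mono dual_bound)
  have smult: "op_norm E scalar_space (\<lambda>x. c * f x) = norm c * op_norm E scalar_space f"
    if f: "f \<in> carrier (dual E)" for c f
  proof (cases "c = 0")
    case True
    then show ?thesis using le[OF f, of 0] dual_nonneg[OF fun_subspace_zero[OF fun_subspace_dual]] by simp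
  next
    case False
    have "op_norm E scalar_space (\<lambda>x. inverse c * (c * f x)) \<le> norm (inverse c) * op_norm E scalar_space (\<lambda>x. c * f x)"
      by (rule le) (rule fun_subspace_smult[OF fun_subspace_dual f])
    moreover have "(\<lambda>x. inverse c * (c * f x)) = f" using False by auto
    ultimately have "norm c * op_norm E scalar_space f \<le> op_norm E scalar_space (\<lambda>x. c * f x)"
      using False by (simp add: norm_divide field_simps)
    then show ?thesis using le[OF f, of c] by simp
  qed
  have "f = (\<lambda>_. 0)" if f: "f \<in> carrier (dual E)" and "op_norm E scalar_space f = 0" for f
  proof
    fix x show "f x = 0" using dual_bound[OF f, of x] dual_off[OF f, of x] that by (cases "x \<in> carrier E") auto
  qed
  moreover have "op_norm E scalar_space (\<lambda>_. 0) = 0"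
    using smult[OF fun_subspace_zero[OF fun_subspace_dual], of 0] by simp
  ultimately show ?thesis
    using D.module_axioms by (intro normed_space.intro normed_space_axioms.intro) (auto simp: smult add)
qed

lemma a_minus_dual: "g \<in> carrier (dual E) \<Longrightarrow> f \<ominus>\<^bsub>dual E\<^esub> g = (\<lambda>x. f x - g x)"
  by (subst dual_fun_space) (rule a_minus_fun_space[OF fun_subspace_dual])

text \<open>A Cauchy sequence converges pointwise, and its estimate relative to
  \<open>nrm E x\<close> survives in the limit. Completeness is wanted for the bidual, because
  finite generation and the ideal axioms speak of Banach spaces.\<close>

lemma banach_space_dual: "banach_space (dual E)"
proof -
  interpret D: normed_space "dual E" by (rule normed_space_dual)
  show ?thesis
  proof (intro banach_space.intro banach_space_axioms.intro normed_space_dual)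
    fix s :: "nat \<Rightarrow> 'v \<Rightarrow> 'k"
    assume s: "\<And>j. s j \<in> carrier (dual E)"
      and cau: "\<And>e. e > 0 \<Longrightarrow> \<exists>N. \<forall>p\<ge>N. \<forall>q\<ge>N. nrm (dual E) (s p \<ominus>\<^bsub>dual E\<^esub> s q) < e"
    have bnd: "\<exists>N. \<forall>p\<ge>N. \<forall>q\<ge>N. \<forall>x\<in>carrier E. norm (s p x - s q x) \<le> e * nrm E x" if e: "e > 0" for e
    proof -
      obtain N where N: "\<And>p q. p \<ge> N \<Longrightarrow> q \<ge> N \<Longrightarrow> op_norm E scalar_space (\<lambda>x. s p x - s q x) < e"
        using cau[OF e] s by (auto simp: a_minus_dual)
      have "norm (s p x - s q x) \<le> e * nrm E x" if "p \<ge> N" "q \<ge> N" "x \<in> carrier E" for p q x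
        using dual_bound[OF fun_subspace_diff[OF fun_subspace_dual s[of p] s[of q]] that(3)]
          mult_right_mono[OF less_imp_le[OF N[OF that(1,2)]] nrm_nonneg[OF that(3)]] by simp
      then show ?thesis by blast
    qed
    have "\<exists>l. (\<lambda>j. s j x) \<longlonglongrightarrow> l" if x: "x \<in> carrier E" for x
    proof (rule rc_field_Cauchy_convergent)
      fix e :: real assume e: "e > 0"
      define d where "d = e / (nrm E x + 1)"
      have d: "d > 0" "d * nrm E x < e" using e nrm_nonneg[OF x] by (auto simp: d_def field_simps add_pos_nonneg)
      then show "\<exists>N. \<forall>p\<ge>N. \<forall>q\<ge>N. norm (s p x - s q x) < e" using bnd[OF d(1)] x by (meson order_le_less_trans)
    qed
    then obtain l0 where l0: "\<And>x. x \<in> carrier E \<Longrightarrow> (\<lambda>j. s j x) \<longlonglongrightarrow> l0 x" by metis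
    define l where "l x = (if x \<in> carrier E then l0 x else 0)" for x
    have lim: "(\<lambda>j. s j x) \<longlonglongrightarrow> l x" if "x \<in> carrier E" for x using l0[OF that] that by (simp add: l_def)
    have tail: "\<exists>N. \<forall>p\<ge>N. \<forall>x\<in>carrier E. norm (s p x - l x) \<le> e * nrm E x" if e: "e > 0" for e
    proof -
      obtain N where N: "\<And>p q x. p \<ge> N \<Longrightarrow> q \<ge> N \<Longrightarrow> x \<in> carrier E \<Longrightarrow> norm (s p x - s q x) \<le> e * nrm E x"
        using bnd[OF e] by blast
      have "norm (s p x - l x) \<le> e * nrm E x" if "p \<ge> N" "x \<in> carrier E" for p x
      proof (rule tendsto_upperbound)
        show "(\<lambda>q. norm (s p x - s q x)) \<longlonglongrightarrow> norm (s p x - l x)" by (intro tendsto_intros lim that)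
        show "\<forall>\<^sub>F q in sequentially. norm (s p x - s q x) \<le> e * nrm E x"
          using N that by (auto simp: eventually_sequentially)
      qed simp
      then show ?thesis by blast
    qed
    obtain N where N: "\<And>x. x \<in> carrier E \<Longrightarrow> norm (s N x - l x) \<le> 1 * nrm E x" using tail[of 1] by auto
    have l: "l \<in> carrier (dual E)"
    proof (rule dualI)
      fix x y assume x: "x \<in> carrier E" and y: "y \<in> carrier E"
      have "(\<lambda>j. s j x + s j y) \<longlonglongrightarrow> l (x \<oplus>\<^bsub>E\<^esub> y)"
        using lim[of "x \<oplus>\<^bsub>E\<^esub> y"] x y by (simp add: dual_add[OF s])
      then show "l (x \<oplus>\<^bsub>E\<^esub> y) = l x + l y"
        using LIMSEQ_unique tendsto_add[OF lim[OF x] lim[OF y]] by blast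
    next
      fix c x assume x: "x \<in> carrier E"
      have "(\<lambda>j. c * s j x) \<longlonglongrightarrow> l (c \<odot>\<^bsub>E\<^esub> x)"
        using lim[of "c \<odot>\<^bsub>E\<^esub> x"] x by (simp add: dual_smult[OF s])
      then show "l (c \<odot>\<^bsub>E\<^esub> x) = c * l x"
        using LIMSEQ_unique tendsto_mult_left[OF lim[OF x], of c] by blast
    next
      fix x assume x: "x \<in> carrier E"
      have "norm (l x) \<le> norm (s N x) + norm (s N x - l x)"
        using norm_triangle_ineq2[of "l x" "s N x"] by (simp add: norm_minus_commute)
      also have "\<dots> \<le> (op_norm E scalar_space (s N) + 1) * nrm E x"
        using dual_bound[OF s x, of N] N[OF x] by (simp add: distrib_right)
      finally show "norm (l x) \<le> (op_norm E scalar_space (s N) + 1) * nrm E x" .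
    qed (simp add: l_def)
    have "(\<lambda>j. op_norm E scalar_space (\<lambda>x. s j x - l x)) \<longlonglongrightarrow> 0"
    proof (rule LIMSEQ_I)
      fix r :: real assume r: "r > 0"
      then obtain N where N: "\<And>p x. p \<ge> N \<Longrightarrow> x \<in> carrier E \<Longrightarrow> norm (s p x - l x) \<le> (r / 2) * nrm E x"
        using tail[of "r / 2"] by auto
      have "\<bar>op_norm E scalar_space (\<lambda>x. s p x - l x)\<bar> \<le> r / 2" if "p \<ge> N" for p
        using dual_norm_le[of "r / 2"] N[OF that] r
          dual_nonneg[OF fun_subspace_diff[OF fun_subspace_dual s[of p] l]] by simp
      then show "\<exists>no. \<forall>n\<ge>no. norm (op_norm E scalar_space (\<lambda>x. s n x - l x) - 0) < r"
        using r by (intro exI[of _ N]) fastforce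
    qed
    then show "\<exists>l\<in>carrier (dual E). (\<lambda>j. nrm (dual E) (s j \<ominus>\<^bsub>dual E\<^esub> l)) \<longlonglongrightarrow> 0"
      using l by (intro bexI[of _ l]) (simp_all add: a_minus_dual)
  qed
qed

end

section \<open>Helly's theorem\<close>

context vspace
begin

lemma lincomb_zero_vec: "finite I \<Longrightarrow> lincomb E I c (\<lambda>_. \<zero>\<^bsub>E\<^esub>) = \<zero>\<^bsub>E\<^esub>"
  by (induction I rule: finite_induct) (simp_all add: lincomb_insert)

lemma lincomb_diff_vec:
  assumes "finite I" "\<And>i. i \<in> I \<Longrightarrow> b i \<in> carrier E" "\<And>i. i \<in> I \<Longrightarrow> b' i \<in> carrier E"
  shows "lincomb E I c (\<lambda>i. b i \<ominus>\<^bsub>E\<^esub> b' i) = lincomb E I c b \<ominus>\<^bsub>E\<^esub> lincomb E I c b'"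
proof -
  have "lincomb E I c (\<lambda>i. b i \<ominus>\<^bsub>E\<^esub> b' i) = lincomb E I c (\<lambda>i. b i \<oplus>\<^bsub>E\<^esub> (- 1) \<odot>\<^bsub>E\<^esub> b' i)"
    using assms by (intro lincomb_cong) (auto simp: a_minus_smult)
  also have "\<dots> = lincomb E I c b \<oplus>\<^bsub>E\<^esub> (- 1) \<odot>\<^bsub>E\<^esub> lincomb E I c b'"
    using assms by (simp add: lincomb_add_vec lincomb_smult_vec)
  also have "\<dots> = lincomb E I c b \<ominus>\<^bsub>E\<^esub> lincomb E I c b'"
    using assms by (simp add: a_minus_smult)
  finally show ?thesis .
qed

lemma a_minus_cl [simp, intro]: "x \<in> carrier E \<Longrightarrow> y \<in> carrier E \<Longrightarrow> x \<ominus>\<^bsub>E\<^esub> y \<in> carrier E"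
  by (rule M.minus_closed)

end

text \<open>The almost norming vector is rotated until the value is a nonnegative real; values of
  several functionals then add up without cancellation.\<close>

lemma (in normed_space) dual_norm_approx:
  assumes f: "f \<in> carrier (dual E)" and e: "e > 0"
  obtains x r where "x \<in> carrier E" "nrm E x \<le> 1" "f x = of_real r" "0 \<le> r" "op_norm E scalar_space f - e \<le> r"
proof -
  have "op_norm E scalar_space f - e < Sup {nrm scalar_space (f x) | x. x \<in> carrier E \<and> nrm E x \<le> 1}"
    using e by (simp add: op_norm_def)
  moreover have "{nrm scalar_space (f x) | x. x \<in> carrier E \<and> nrm E x \<le> 1} \<noteq> {}"
    by (auto intro: exI[of _ "\<zero>\<^bsub>E\<^esub>"])
  ultimately obtain s where "s \<in> {nrm scalar_space (f x) | x. x \<in> carrier E \<and> nrm E x \<le> 1}"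
    "op_norm E scalar_space f - e < s"
    by (rule less_cSupE)
  then obtain y where y: "y \<in> carrier E" "nrm E y \<le> 1" "op_norm E scalar_space f - e < norm (f y)"
    by auto
  obtain c where "norm c = 1" "c * f y = of_real (norm (f y))" using unit_rotation by blast
  then show ?thesis using y by (intro that[of "c \<odot>\<^bsub>E\<^esub> y" "norm (f y)"]) (auto simp: nrm_smult dual_smult[OF f])
qed

text \<open>Families over a whole index type, of which only finitely many coordinates will count.
  The seminorm for Hahn-Banach is supplied separately.\<close>

definition power_space :: "('k::rc_field, 'v) nspace \<Rightarrow> ('k, 'i \<Rightarrow> 'v) nspace" where
  "power_space E = \<lparr>carrier = {w. \<forall>i. w i \<in> carrier E}, mult = undefined, one = undefined,
     zero = (\<lambda>_. \<zero>\<^bsub>E\<^esub>), add = (\<lambda>v w i. v i \<oplus>\<^bsub>E\<^esub> w i), smult = (\<lambda>c w i. c \<odot>\<^bsub>E\<^esub> w i), nrm = undefined\<rparr>"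

lemma power_space_simps [simp]:
  "w \<in> carrier (power_space E) \<longleftrightarrow> (\<forall>i. w i \<in> carrier E)"
  "v \<oplus>\<^bsub>power_space E\<^esub> w = (\<lambda>i. v i \<oplus>\<^bsub>E\<^esub> w i)" "c \<odot>\<^bsub>power_space E\<^esub> w = (\<lambda>i. c \<odot>\<^bsub>E\<^esub> w i)"
  "\<zero>\<^bsub>power_space E\<^esub> = (\<lambda>_. \<zero>\<^bsub>E\<^esub>)"
  by (simp_all add: power_space_def)

context vspace
begin

lemma vspace_power_space: "vspace (power_space E :: ('k, 'i \<Rightarrow> 'v) nspace)"
proof -
  have "\<exists>v\<in>carrier (power_space E). v \<oplus>\<^bsub>power_space E\<^esub> w = \<zero>\<^bsub>power_space E\<^esub>"
    if "w \<in> carrier (power_space E)" for w :: "'i \<Rightarrow> 'v"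
    using that by (intro bexI[of _ "\<lambda>i. \<ominus>\<^bsub>E\<^esub> w i"]) (auto simp: M.l_neg)
  then show ?thesis
    unfolding vspace_def
    by (intro Module.moduleI cring_scalar_space abelian_groupI)
      (auto simp: smult_l smult_r smult_assoc M.a_ac)
qed

text \<open>The part of \<open>w\<close> off \<open>Y\<close> is annihilated by
  \<open>\<phi>\<close> through \<open>support\<close>; the rest is a finite sum of families with at
  most one nonzero coordinate.\<close>

lemma linear_form_power_space:
  assumes \<phi>: "linear_map (power_space E) scalar_space \<phi>" and "finite Y" and w: "\<And>y. w y \<in> carrier E"
    and support: "\<And>v. (\<And>y. v y \<in> carrier E) \<Longrightarrow> (\<And>y. y \<in> Y \<Longrightarrow> v y = \<zero>\<^bsub>E\<^esub>) \<Longrightarrow> \<phi> v = 0"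
  shows "\<phi> w = (\<Sum>y\<in>Y. \<phi> (\<lambda>j. if j = y then w y else \<zero>\<^bsub>E\<^esub>))"
proof -
  have add: "\<phi> (\<lambda>i. u i \<oplus>\<^bsub>E\<^esub> v i) = \<phi> u + \<phi> v" if "\<And>y. u y \<in> carrier E" "\<And>y. v y \<in> carrier E" for u v
    using linear_map_add[OF \<phi>, of u v] that by simp
  have "\<phi> (\<lambda>j. if j \<in> I then w j else \<zero>\<^bsub>E\<^esub>) = (\<Sum>y\<in>I. \<phi> (\<lambda>j. if j = y then w y else \<zero>\<^bsub>E\<^esub>))"
    if "finite I" for I using that
  proof (induction I rule: finite_induct)
    case empty
    then show ?case using support[of "\<lambda>_. \<zero>\<^bsub>E\<^esub>"] by simp
  next
    case (insert y I)
    have "(\<lambda>j. if j \<in> insert y I then w j else \<zero>\<^bsub>E\<^esub>) =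
        (\<lambda>j. (if j = y then w y else \<zero>\<^bsub>E\<^esub>) \<oplus>\<^bsub>E\<^esub> (if j \<in> I then w j else \<zero>\<^bsub>E\<^esub>))"
      using insert.hyps w by auto
    then show ?case using insert w by (simp add: add)
  qed
  moreover have "\<phi> w = \<phi> (\<lambda>j. if j \<in> Y then w j else \<zero>\<^bsub>E\<^esub>) + \<phi> (\<lambda>j. if j \<in> Y then \<zero>\<^bsub>E\<^esub> else w j)"
  proof -
    have "w = (\<lambda>j. (if j \<in> Y then w j else \<zero>\<^bsub>E\<^esub>) \<oplus>\<^bsub>E\<^esub> (if j \<in> Y then \<zero>\<^bsub>E\<^esub> else w j))"
      using w by auto
    then show ?thesis using add[of "\<lambda>j. if j \<in> Y then w j else \<zero>\<^bsub>E\<^esub>" "\<lambda>j. if j \<in> Y then \<zero>\<^bsub>E\<^esub> else w j"] w by simp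
  qed
  ultimately show ?thesis using assms(2) support[of "\<lambda>j. if j \<in> Y then \<zero>\<^bsub>E\<^esub> else w j"] w by simp
qed

end

lemma (in normed_space) lincomb_dual:
  assumes "finite I" "\<And>i. i \<in> I \<Longrightarrow> b i \<in> carrier (dual E)"
  shows "lincomb (dual E) I c b = (\<lambda>x. \<Sum>i\<in>I. c i * b i x)"
proof -
  interpret D: vspace "dual E" by (rule vspace_dual)
  show ?thesis using assms by (induction I rule: finite_induct) (simp_all add: D.lincomb_insert)
qed

lemma (in normed_space) bidual_sum:
  assumes "e \<in> carrier (bidual E)" "finite I" "\<And>i. i \<in> I \<Longrightarrow> b i \<in> carrier (dual E)"
  shows "e (\<lambda>x. \<Sum>i\<in>I. c i * b i x) = (\<Sum>i\<in>I. c i * e (b i))"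
  using vspace.linear_form_lincomb[OF vspace_dual dual_linear[OF assms(1)] assms(2), of b c] assms(3)
    lincomb_dual[OF assms(2), of b c] by simp

text \<open>The functional obtained from Hahn-Banach is represented by finitely many \<open>h y\<close> in the dual,
  of total norm at most one. It annihilates the vectors \<open>J \<eta>\<close> coming from the common kernel of
  \<open>F\<close>, so the \<open>\<psi> z\<close> are combinations of \<open>F\<close> and \<open>e z\<close> can be applied to them.\<close>

lemma (in normed_space) Helly:
  fixes e :: "'z \<Rightarrow> ('v \<Rightarrow> 'k) \<Rightarrow> 'k" and a :: "'y \<Rightarrow> 'z \<Rightarrow> 'k"
  assumes Z: "finite Z" and Y: "finite Y" and F: "finite F" "F \<subseteq> carrier (dual E)"
    and e: "\<And>z. z \<in> Z \<Longrightarrow> e z \<in> carrier (bidual E)"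
    and a: "\<And>y g. y \<in> Y \<Longrightarrow> g \<in> carrier (dual E) \<Longrightarrow> norm (\<Sum>z\<in>Z. a y z * e z g) \<le> op_norm E scalar_space g"
    and \<delta>: "\<delta> > 0"
  obtains \<xi> where "\<And>z. z \<in> Z \<Longrightarrow> \<xi> z \<in> carrier E" "\<And>f z. f \<in> F \<Longrightarrow> z \<in> Z \<Longrightarrow> f (\<xi> z) = e z f"
    "\<And>y. y \<in> Y \<Longrightarrow> nrm E (lincomb E Z (a y) \<xi>) \<le> 1 + \<delta>"
proof -
  note sub = fun_subspace_dual
  \<comment> \<open>The span of \<open>F\<close>: matching on \<open>F\<close> amounts to matching
    on \<open>SF\<close>, where interpolation is available.\<close>
  define SF where "SF = {g. \<exists>c. g = (\<lambda>x. \<Sum>f\<in>F. c f * f x)}"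
  have SF: "fun_subspace SF"
    unfolding fun_subspace_def
  proof (intro conjI ballI allI)
    show "(\<lambda>_. 0) \<in> SF" by (auto simp: SF_def intro!: exI[of _ "\<lambda>_. 0"])
    fix f g assume "f \<in> SF" "g \<in> SF"
    then obtain c d where "f = (\<lambda>x. \<Sum>f\<in>F. c f * f x)" "g = (\<lambda>x. \<Sum>f\<in>F. d f * f x)" by (auto simp: SF_def)
    then show "(\<lambda>x. f x + g x) \<in> SF"
      by (auto simp: SF_def sum.distrib distrib_right intro!: exI[of _ "\<lambda>f. c f + d f"])
  next
    fix r f assume "f \<in> SF"
    then obtain c where "f = (\<lambda>x. \<Sum>f\<in>F. c f * f x)" by (auto simp: SF_def)
    then show "(\<lambda>x. r * f x) \<in> SF"
      by (auto simp: SF_def sum_distrib_left mult.assoc intro!: exI[of _ "\<lambda>f. r * c f"])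
  qed
  have SF_dual: "g \<in> carrier (dual E)" if "g \<in> SF" for g
    using that fun_subspace_sum[OF sub F(1), of "\<lambda>f. f"] F(2) by (auto simp: SF_def)
  have F_SF: "f \<in> SF" if "f \<in> F" for f
    using that F(1) by (auto simp: SF_def if_distrib[of "\<lambda>c. c * _"] cong: if_cong
        intro!: exI[of _ "\<lambda>g. if g = f then 1 else 0"])
  obtain D d where D: "finite D" "D \<subseteq> carrier E" and d: "\<And>u. u \<in> D \<Longrightarrow> d u \<in> SF"
    and interp: "\<And>g x. g \<in> SF \<Longrightarrow> g x = (\<Sum>u\<in>D. g u * d u x)"
    using finite_interpolation[OF SF F(1), of "\<lambda>f. f" "carrier E"] dual_off[OF SF_dual]
    by (auto simp: SF_def)
  have d_dual: "u \<in> D \<Longrightarrow> d u \<in> carrier (dual E)" for u using d SF_dual by blast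
  have lD: "lincomb E D c (\<lambda>u. u) \<in> carrier E" for c using D by auto
  have glD: "g (lincomb E D c (\<lambda>u. u)) = (\<Sum>u\<in>D. c u * g u)" if "g \<in> carrier (dual E)" for g c
    using D by (intro linear_form_lincomb dual_linear that) auto
  \<comment> \<open>A first solution of the equations on \<open>F\<close>, without control of norms:
    the wanted values \<open>e z (d u)\<close> are taken as coefficients of the interpolation points
    \<open>u\<close>.\<close>
  define \<xi>0 where "\<xi>0 z = lincomb E D (\<lambda>u. e z (d u)) (\<lambda>u. u)" for z
  have \<xi>0_cl: "\<xi>0 z \<in> carrier E" for z by (simp add: \<xi>0_def lD)
  have \<xi>0: "g (\<xi>0 z) = e z g" if g: "g \<in> SF" and z: "z \<in> Z" for g z
  proof -
    have "g (\<xi>0 z) = (\<Sum>u\<in>D. g u * e z (d u))" by (simp add: \<xi>0_def glD SF_dual g mult.commute)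
    also have "\<dots> = e z (\<lambda>x. \<Sum>u\<in>D. g u * d u x)"
      by (rule bidual_sum[OF e[OF z] D(1) d_dual, symmetric])
    finally show ?thesis by (simp add: interp[OF g, symmetric])
  qed
  \<comment> \<open>Solutions of the homogeneous equations. Subtracting any \<open>\<eta>\<close> in
    \<open>N\<close> from \<open>\<xi>0\<close> keeps the equations, and \<open>J\<close> collects
    the combinations whose norms have to become small.\<close>
  define N where "N = {\<eta>. (\<forall>z. \<eta> z \<in> carrier E) \<and> (\<forall>z\<in>Z. \<forall>f\<in>F. f (\<eta> z) = 0)}"
  define J where "J \<eta> y = lincomb E Z (a y) \<eta>" for \<eta> y
  have J_cl: "J \<eta> y \<in> carrier E" if "\<And>z. \<eta> z \<in> carrier E" for \<eta> y using that by (auto simp: J_def)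
  have zero_N: "(\<lambda>_. \<zero>\<^bsub>E\<^esub>) \<in> N"
    using F(2) by (auto simp: N_def intro!: linear_form_zero dual_linear)
  have N_cl: "\<eta> z \<in> carrier E" if "\<eta> \<in> N" for \<eta> z using that by (auto simp: N_def)
  have N_ker: "f (\<eta> z) = 0" if "\<eta> \<in> N" "z \<in> Z" "f \<in> F" for \<eta> z f using that by (auto simp: N_def)
  have NI: "\<eta> \<in> N" if "\<And>z. \<eta> z \<in> carrier E" "\<And>z f. z \<in> Z \<Longrightarrow> f \<in> F \<Longrightarrow> f (\<eta> z) = 0" for \<eta>
    using that by (auto simp: N_def)
  have F_dual: "f \<in> carrier (dual E)" if "f \<in> F" for f using that F(2) by blast
  have J0: "J (\<lambda>_. \<zero>\<^bsub>E\<^esub>) y = \<zero>\<^bsub>E\<^esub>" for y using Z by (simp add: J_def lincomb_zero_vec)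
  have diff0: "x \<ominus>\<^bsub>E\<^esub> \<zero>\<^bsub>E\<^esub> = x" if "x \<in> carrier E" for x using that by (simp add: a_minus_smult)
  \<comment> \<open>\<open>Pw w\<close> collects the upper bounds for the distance of
    \<open>w\<close> from some point of \<open>J N\<close>, measured by the largest norm over
    \<open>Y\<close>; the infimum \<open>p w\<close> is the quotient seminorm modulo
    \<open>J N\<close>. The goal becomes \<open>p (J \<xi>0) < 1 + \<delta>\<close>. The condition
    \<open>0 \<le> r\<close> keeps the set bounded below even for empty \<open>Y\<close>.\<close>
  define Pw where "Pw w = {r. 0 \<le> r \<and> (\<exists>\<eta>\<in>N. \<forall>y\<in>Y. nrm E (w y \<ominus>\<^bsub>E\<^esub> J \<eta> y) \<le> r)}" for w :: "'y \<Rightarrow> 'v"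
  define p where "p w = Inf (Pw w)" for w
  have bdd: "bdd_below (Pw w)" for w by (auto simp: Pw_def intro: bdd_belowI[of _ 0])
  have p_le: "p w \<le> r" if "r \<in> Pw w" for w r using that bdd by (auto simp: p_def intro: cInf_lower)
  have Pw_norm: "r \<in> Pw w" if "\<And>y. w y \<in> carrier E" "0 \<le> r" "\<And>y. y \<in> Y \<Longrightarrow> nrm E (w y) \<le> r" for w r
    using that zero_N by (auto simp: Pw_def J0 diff0 intro!: bexI[of _ "\<lambda>_. \<zero>\<^bsub>E\<^esub>"])
  have ne: "Pw w \<noteq> {}" if w: "\<And>y. w y \<in> carrier E" for w
  proof -
    have "(\<Sum>y\<in>Y. nrm E (w y)) \<in> Pw w"
      using w Y by (intro Pw_norm) (auto intro!: sum_nonneg member_le_sum)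
    then show ?thesis by blast
  qed
  have p_ge: "s \<le> p w" if "\<And>y. w y \<in> carrier E" "\<And>r. r \<in> Pw w \<Longrightarrow> s \<le> r" for w s
    using cInf_greatest[OF ne] that by (auto simp: p_def)
  let ?V = "power_space E :: ('k, 'y \<Rightarrow> 'v) nspace"
  interpret V: vspace ?V by (rule vspace_power_space)
  have p_sub: "p (v \<oplus>\<^bsub>?V\<^esub> w) \<le> p v + p w" if v: "v \<in> carrier ?V" and w: "w \<in> carrier ?V" for v w
  proof -
    have *: "p (\<lambda>i. v i \<oplus>\<^bsub>E\<^esub> w i) \<le> r + s" if "r \<in> Pw v" and "s \<in> Pw w" for r s
    proof (rule p_le)
      obtain \<eta> \<theta> where \<eta>: "\<eta> \<in> N" "\<And>y. y \<in> Y \<Longrightarrow> nrm E (v y \<ominus>\<^bsub>E\<^esub> J \<eta> y) \<le> r" "0 \<le> r"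
        and \<theta>: "\<theta> \<in> N" "\<And>y. y \<in> Y \<Longrightarrow> nrm E (w y \<ominus>\<^bsub>E\<^esub> J \<theta> y) \<le> s" "0 \<le> s"
        using \<open>r \<in> Pw v\<close> \<open>s \<in> Pw w\<close> by (auto simp: Pw_def)
      have "(\<lambda>z. \<eta> z \<oplus>\<^bsub>E\<^esub> \<theta> z) \<in> N"
      proof (rule NI)
        show "f (\<eta> z \<oplus>\<^bsub>E\<^esub> \<theta> z) = 0" if "z \<in> Z" "f \<in> F" for z f
          using N_ker[OF \<eta>(1) that] N_ker[OF \<theta>(1) that] N_cl[OF \<eta>(1)] N_cl[OF \<theta>(1)]
          by (simp add: dual_add[OF F_dual[OF that(2)]])
      qed (simp add: N_cl[OF \<eta>(1)] N_cl[OF \<theta>(1)])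
      moreover have "nrm E ((v y \<oplus>\<^bsub>E\<^esub> w y) \<ominus>\<^bsub>E\<^esub> J (\<lambda>z. \<eta> z \<oplus>\<^bsub>E\<^esub> \<theta> z) y) \<le> r + s" if "y \<in> Y" for y
      proof -
        have "J (\<lambda>z. \<eta> z \<oplus>\<^bsub>E\<^esub> \<theta> z) y = J \<eta> y \<oplus>\<^bsub>E\<^esub> J \<theta> y"
          unfolding J_def by (intro lincomb_add_vec Z N_cl \<eta>(1) \<theta>(1))
        then have "(v y \<oplus>\<^bsub>E\<^esub> w y) \<ominus>\<^bsub>E\<^esub> J (\<lambda>z. \<eta> z \<oplus>\<^bsub>E\<^esub> \<theta> z) y = (v y \<ominus>\<^bsub>E\<^esub> J \<eta> y) \<oplus>\<^bsub>E\<^esub> (w y \<ominus>\<^bsub>E\<^esub> J \<theta> y)"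
          using v w J_cl[OF N_cl[OF \<eta>(1)]] J_cl[OF N_cl[OF \<theta>(1)]] by (simp add: a_minus_smult smult_r M.a_ac)
        then show ?thesis
          using \<eta>(2)[OF that] \<theta>(2)[OF that] v w J_cl[OF N_cl[OF \<eta>(1)]] J_cl[OF N_cl[OF \<theta>(1)]]
            nrm_triangle[of "v y \<ominus>\<^bsub>E\<^esub> J \<eta> y" "w y \<ominus>\<^bsub>E\<^esub> J \<theta> y"] by force
      qed
      ultimately show "r + s \<in> Pw (\<lambda>i. v i \<oplus>\<^bsub>E\<^esub> w i)"
        using \<eta>(3) \<theta>(3) by (auto simp: Pw_def)
    qed
    have "p (\<lambda>i. v i \<oplus>\<^bsub>E\<^esub> w i) - r \<le> p w" if r: "r \<in> Pw v" for r
    proof (rule p_ge)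
      show "p (\<lambda>i. v i \<oplus>\<^bsub>E\<^esub> w i) - r \<le> s" if "s \<in> Pw w" for s using *[OF r that] by simp
    qed (use w in simp)
    then have "p (\<lambda>i. v i \<oplus>\<^bsub>E\<^esub> w i) - p w \<le> p v"
      using v by (intro p_ge) (simp, fastforce)
    then show ?thesis by simp
  qed
  have p_hom: "p (c \<odot>\<^bsub>?V\<^esub> w) \<le> norm c * p w" if w: "w \<in> carrier ?V" for c w
  proof -
    have *: "p (\<lambda>i. c \<odot>\<^bsub>E\<^esub> w i) \<le> norm c * r" if r: "r \<in> Pw w" for r
    proof (rule p_le)
      obtain \<eta> where \<eta>: "\<eta> \<in> N" "\<And>y. y \<in> Y \<Longrightarrow> nrm E (w y \<ominus>\<^bsub>E\<^esub> J \<eta> y) \<le> r" "0 \<le> r"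
        using r by (auto simp: Pw_def)
      have "(\<lambda>z. c \<odot>\<^bsub>E\<^esub> \<eta> z) \<in> N"
      proof (rule NI)
        show "f (c \<odot>\<^bsub>E\<^esub> \<eta> z) = 0" if "z \<in> Z" "f \<in> F" for z f
          using N_ker[OF \<eta>(1) that] N_cl[OF \<eta>(1)] by (simp add: dual_smult[OF F_dual[OF that(2)]])
      qed (simp add: N_cl[OF \<eta>(1)])
      moreover have "nrm E ((c \<odot>\<^bsub>E\<^esub> w y) \<ominus>\<^bsub>E\<^esub> J (\<lambda>z. c \<odot>\<^bsub>E\<^esub> \<eta> z) y) \<le> norm c * r" if "y \<in> Y" for y
      proof -
        have "J (\<lambda>z. c \<odot>\<^bsub>E\<^esub> \<eta> z) y = c \<odot>\<^bsub>E\<^esub> J \<eta> y"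
          unfolding J_def by (intro lincomb_smult_vec Z N_cl \<eta>(1))
        then have "(c \<odot>\<^bsub>E\<^esub> w y) \<ominus>\<^bsub>E\<^esub> J (\<lambda>z. c \<odot>\<^bsub>E\<^esub> \<eta> z) y = c \<odot>\<^bsub>E\<^esub> (w y \<ominus>\<^bsub>E\<^esub> J \<eta> y)"
          using w J_cl[OF N_cl[OF \<eta>(1)]] by (simp add: a_minus_smult smult_r smult_assoc)
        then show ?thesis
          using \<eta>(2)[OF that] w J_cl[OF N_cl[OF \<eta>(1)]] by (simp add: nrm_smult mult_left_mono)
      qed
      ultimately show "norm c * r \<in> Pw (\<lambda>i. c \<odot>\<^bsub>E\<^esub> w i)"
        using \<eta>(3) by (auto simp: Pw_def)
    qed
    show ?thesis
    proof (cases "c = 0")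
      case True
      obtain r where "r \<in> Pw w" using ne[of w] w by auto
      then show ?thesis using * True by fastforce
    next
      case False
      have "p (\<lambda>i. c \<odot>\<^bsub>E\<^esub> w i) / norm c \<le> p w"
        using * False w by (intro p_ge) (auto simp: field_simps)
      then show ?thesis using False by (simp add: field_simps)
    qed
  qed
  have w0: "J \<xi>0 \<in> carrier ?V" using \<xi>0_cl J_cl by auto
  obtain \<phi> where \<phi>: "linear_map ?V scalar_space \<phi>" "\<And>w. w \<in> carrier ?V \<Longrightarrow> norm (\<phi> w) \<le> p w"
    and \<phi>w0: "p (J \<xi>0) \<le> norm (\<phi> (J \<xi>0))"
    using V.Hahn_Banach[of p, OF p_sub p_hom w0] by blast
  have \<phi>_0: "\<phi> w = 0" if "w \<in> carrier ?V" "0 \<in> Pw w" for w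
    using order_trans[OF \<phi>(2)[OF that(1)] p_le[OF that(2)]] by simp
  define h where "h y x = (if x \<in> carrier E then \<phi> (\<lambda>j. if j = y then x else \<zero>\<^bsub>E\<^esub>) else 0)" for y x
  have h_dual: "h y \<in> carrier (dual E)" for y
  proof (rule dualI)
    fix x x' assume x: "x \<in> carrier E" "x' \<in> carrier E"
    have "(\<lambda>j. if j = y then x \<oplus>\<^bsub>E\<^esub> x' else \<zero>\<^bsub>E\<^esub>) =
        (\<lambda>j. if j = y then x else \<zero>\<^bsub>E\<^esub>) \<oplus>\<^bsub>?V\<^esub> (\<lambda>j. if j = y then x' else \<zero>\<^bsub>E\<^esub>)" by auto
    then show "h y (x \<oplus>\<^bsub>E\<^esub> x') = h y x + h y x'"
      using linear_map_add[OF \<phi>(1), of "\<lambda>j. if j = y then x else \<zero>\<^bsub>E\<^esub>" "\<lambda>j. if j = y then x' else \<zero>\<^bsub>E\<^esub>"] x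
      by (simp add: h_def)
  next
    fix c x assume x: "x \<in> carrier E"
    have "(\<lambda>j. if j = y then c \<odot>\<^bsub>E\<^esub> x else \<zero>\<^bsub>E\<^esub>) = c \<odot>\<^bsub>?V\<^esub> (\<lambda>j. if j = y then x else \<zero>\<^bsub>E\<^esub>)" by auto
    then show "h y (c \<odot>\<^bsub>E\<^esub> x) = c * h y x"
      using linear_map_smult[OF \<phi>(1), of "\<lambda>j. if j = y then x else \<zero>\<^bsub>E\<^esub>" c] x by (simp add: h_def)
  next
    fix x assume x: "x \<in> carrier E"
    have "norm (h y x) \<le> p (\<lambda>j. if j = y then x else \<zero>\<^bsub>E\<^esub>)" using x \<phi>(2) by (simp add: h_def)
    also have "\<dots> \<le> nrm E x" using x by (intro p_le Pw_norm) auto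
    finally show "norm (h y x) \<le> 1 * nrm E x" by simp
  qed (simp add: h_def)
  have \<phi>_h: "\<phi> w = (\<Sum>y\<in>Y. h y (w y))" if w: "\<And>y. w y \<in> carrier E" for w
  proof -
    have "\<phi> v = 0" if "\<And>y. v y \<in> carrier E" "\<And>y. y \<in> Y \<Longrightarrow> v y = \<zero>\<^bsub>E\<^esub>" for v
      using that by (intro \<phi>_0 Pw_norm) auto
    then show ?thesis using linear_form_power_space[OF \<phi>(1) Y, of w] w by (simp add: h_def)
  qed
  \<comment> \<open>The dual of a maximum norm is a sum norm: almost norming unit vectors for the
    separate \<open>h y\<close> form one family \<open>x\<close> with \<open>p x \<le> 1\<close>,
    and \<open>\<phi> x\<close> is the sum of their values.\<close>
  have h_sum: "(\<Sum>y\<in>Y. op_norm E scalar_space (h y)) \<le> 1"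
  proof (rule field_le_epsilon)
    fix \<epsilon> :: real assume \<epsilon>: "\<epsilon> > 0"
    \<comment> \<open>The loss is shared among the members of \<open>Y\<close>; adding 1 avoids
      division by zero for empty \<open>Y\<close>.\<close>
    define \<epsilon>' where "\<epsilon>' = \<epsilon> / (real (card Y) + 1)"
    have \<epsilon>': "\<epsilon>' > 0" "real (card Y) * \<epsilon>' \<le> \<epsilon>" using \<epsilon> by (auto simp: \<epsilon>'_def field_simps)
    have "\<exists>x r. x \<in> carrier E \<and> nrm E x \<le> 1 \<and> h y x = of_real r \<and> 0 \<le> r \<and> op_norm E scalar_space (h y) - \<epsilon>' \<le> r" for y
      using dual_norm_approx[OF h_dual \<epsilon>'(1)] by metis
    then obtain x r where x: "\<And>y. x y \<in> carrier E" "\<And>y. nrm E (x y) \<le> 1" "\<And>y. h y (x y) = of_real (r y)"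
      and r: "\<And>y. 0 \<le> r y" "\<And>y. op_norm E scalar_space (h y) - \<epsilon>' \<le> r y" by metis
    have "norm (\<phi> x) \<le> p x" using x(1) by (intro \<phi>(2)) auto
    also have "\<dots> \<le> 1" using x by (intro p_le Pw_norm) auto
    finally have "norm (of_real (\<Sum>y\<in>Y. r y) :: 'k) \<le> 1" using \<phi>_h[of x] x by simp
    then have "(\<Sum>y\<in>Y. r y) \<le> 1" by (simp only: norm_of_real abs_le_iff)
    moreover have "(\<Sum>y\<in>Y. op_norm E scalar_space (h y) - \<epsilon>') \<le> (\<Sum>y\<in>Y. r y)" by (intro sum_mono r)
    ultimately show "(\<Sum>y\<in>Y. op_norm E scalar_space (h y)) \<le> 1 + \<epsilon>" using \<epsilon>'(2) by (simp add: sum_subtractf)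
  qed
  define \<psi> where "\<psi> z x = (\<Sum>y\<in>Y. a y z * h y x)" for z x
  have \<psi>_dual: "\<psi> z \<in> carrier (dual E)" for z
    unfolding \<psi>_def[abs_def] by (intro fun_subspace_sum sub Y h_dual)
  have \<phi>J: "\<phi> (J \<eta>) = (\<Sum>z\<in>Z. \<psi> z (\<eta> z))" if \<eta>: "\<And>z. \<eta> z \<in> carrier E" for \<eta>
  proof -
    have "\<phi> (J \<eta>) = (\<Sum>y\<in>Y. \<Sum>z\<in>Z. a y z * h y (\<eta> z))"
      using \<eta> J_cl by (simp add: \<phi>_h J_def linear_form_lincomb dual_linear h_dual Z)
    also have "\<dots> = (\<Sum>z\<in>Z. \<psi> z (\<eta> z))" unfolding \<psi>_def by (rule sum.swap)
    finally show ?thesis .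
  qed
  have \<psi>_ker: "\<psi> z x = 0" if z: "z \<in> Z" and x: "x \<in> carrier E" "\<And>f. f \<in> F \<Longrightarrow> f x = 0" for z x
  proof -
    \<comment> \<open>The family with the single entry \<open>x\<close> at \<open>z\<close> lies in
      \<open>N\<close>; its image under \<open>J\<close> has seminorm 0, so \<open>\<phi>\<close>
      annihilates it.\<close>
    define \<eta> where "\<eta> z' = (if z' = z then x else \<zero>\<^bsub>E\<^esub>)" for z'
    have "\<eta> \<in> N" using x F(2) by (auto simp: N_def \<eta>_def intro!: linear_form_zero dual_linear)
    then have cl: "\<eta> z' \<in> carrier E" for z' by (rule N_cl)
    have "J \<eta> y \<ominus>\<^bsub>E\<^esub> J \<eta> y = \<zero>\<^bsub>E\<^esub>" for y using J_cl[OF cl] by (simp add: a_minus_smult smult_minus_add)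
    then have "0 \<in> Pw (J \<eta>)" using \<open>\<eta> \<in> N\<close> by (auto simp: Pw_def intro!: bexI[of _ \<eta>])
    then have "0 = (\<Sum>z'\<in>Z. \<psi> z' (\<eta> z'))" using \<phi>_0[of "J \<eta>"] \<phi>J[OF cl] J_cl[OF cl] by simp
    also have "\<dots> = (\<Sum>z'\<in>Z. if z' = z then \<psi> z x else 0)"
      by (intro sum.cong) (auto simp: \<eta>_def linear_form_zero dual_linear \<psi>_dual)
    finally show ?thesis using z Z by simp
  qed
  have \<psi>_exp: "\<psi> z x = (\<Sum>u\<in>D. \<psi> z u * d u x)" if z: "z \<in> Z" for z x
  proof (cases "x \<in> carrier E")
    case False
    then show ?thesis using dual_off[OF \<psi>_dual False] dual_off[OF d_dual False] by simp
  next
    case True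
    \<comment> \<open>The subtracted combination of interpolation points takes the same values under
      \<open>F\<close> as \<open>x\<close>, so \<open>x'\<close> lies in the common kernel and
      \<open>\<psi> z\<close> vanishes on it.\<close>
    define x' where "x' = x \<ominus>\<^bsub>E\<^esub> lincomb E D (\<lambda>u. d u x) (\<lambda>u. u)"
    have g: "g x' = g x - (\<Sum>u\<in>D. d u x * g u)" if "g \<in> carrier (dual E)" for g
      using True lD by (simp add: x'_def linear_form_diff dual_linear that glD)
    have "f x' = 0" if "f \<in> F" for f
      using interp[OF F_SF[OF that], of x] g[of f] that F(2) by (auto simp: mult.commute)
    then have "\<psi> z x' = 0" using \<psi>_ker[OF z, of x'] True lD by (simp add: x'_def)
    then show ?thesis using g[OF \<psi>_dual, of z] by (simp add: mult.commute)
  qed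
  \<comment> \<open>Here \<open>\<xi>0\<close> is eliminated: under the functions \<open>d u\<close>
    it takes the values prescribed by \<open>e z\<close>, so \<open>e z\<close> ends up applied to
    \<open>\<psi> z\<close> itself. Regrouping by \<open>y\<close> brings in the hypothesis on the
    combinations of the \<open>e z\<close>.\<close>
  have "\<phi> (J \<xi>0) = (\<Sum>z\<in>Z. \<Sum>u\<in>D. \<psi> z u * d u (\<xi>0 z))"
    unfolding \<phi>J[OF \<xi>0_cl] by (intro sum.cong refl \<psi>_exp)
  also have "\<dots> = (\<Sum>z\<in>Z. \<Sum>u\<in>D. \<psi> z u * e z (d u))" by (simp add: \<xi>0 d)
  also have "\<dots> = (\<Sum>z\<in>Z. e z (\<psi> z))"
  proof (rule sum.cong[OF refl])
    fix z assume z: "z \<in> Z"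
    have "(\<lambda>x. \<Sum>u\<in>D. \<psi> z u * d u x) = \<psi> z" by (rule ext) (rule \<psi>_exp[OF z, symmetric])
    then show "(\<Sum>u\<in>D. \<psi> z u * e z (d u)) = e z (\<psi> z)"
      using bidual_sum[OF e[OF z] D(1), of d "\<psi> z"] d_dual by simp
  qed
  also have "\<dots> = (\<Sum>z\<in>Z. \<Sum>y\<in>Y. a y z * e z (h y))"
    unfolding \<psi>_def[abs_def] by (intro sum.cong refl bidual_sum e Y h_dual)
  also have "\<dots> = (\<Sum>y\<in>Y. \<Sum>z\<in>Z. a y z * e z (h y))" by (rule sum.swap)
  finally have "norm (\<phi> (J \<xi>0)) = norm (\<Sum>y\<in>Y. \<Sum>z\<in>Z. a y z * e z (h y))" by simp
  also have "\<dots> \<le> (\<Sum>y\<in>Y. op_norm E scalar_space (h y))"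
    by (rule order_trans[OF norm_sum]) (intro sum_mono a h_dual)
  also have "\<dots> \<le> 1" by (rule h_sum)
  finally have "p (J \<xi>0) < 1 + \<delta>" using \<phi>w0 \<delta> by simp
  then obtain r where "r \<in> Pw (J \<xi>0)" "r < 1 + \<delta>"
    using cInf_lessD[OF ne[of "J \<xi>0"]] w0 by (auto simp: p_def)
  then obtain \<eta> where \<eta>: "\<eta> \<in> N" "\<And>y. y \<in> Y \<Longrightarrow> nrm E (J \<xi>0 y \<ominus>\<^bsub>E\<^esub> J \<eta> y) \<le> 1 + \<delta>"
    by (force simp: Pw_def)
  show ?thesis
  proof (rule that[of "\<lambda>z. \<xi>0 z \<ominus>\<^bsub>E\<^esub> \<eta> z"])
    show "\<xi>0 z \<ominus>\<^bsub>E\<^esub> \<eta> z \<in> carrier E" for z using \<xi>0_cl N_cl[OF \<eta>(1)] by simp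
    show "f (\<xi>0 z \<ominus>\<^bsub>E\<^esub> \<eta> z) = e z f" if "f \<in> F" "z \<in> Z" for f z
    proof -
      have "f (\<xi>0 z \<ominus>\<^bsub>E\<^esub> \<eta> z) = f (\<xi>0 z) - f (\<eta> z)"
        by (rule linear_form_diff[OF dual_linear \<xi>0_cl N_cl[OF \<eta>(1)]]) (use that F(2) in auto)
      then show ?thesis using \<xi>0[OF F_SF that(2)] that \<eta>(1) by (auto simp: N_def)
    qed
    show "nrm E (lincomb E Z (a y) (\<lambda>z. \<xi>0 z \<ominus>\<^bsub>E\<^esub> \<eta> z)) \<le> 1 + \<delta>" if "y \<in> Y" for y
      using \<eta>(2)[OF that] lincomb_diff_vec[OF Z, of \<xi>0 \<eta> "a y"] \<xi>0_cl N_cl[OF \<eta>(1)] by (simp add: J_def)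
  qed
qed

section \<open>Finite-dimensional subspaces\<close>

lemma FIN_simps:
  assumes "M \<in> FIN E"
  shows "x \<oplus>\<^bsub>M\<^esub> y = x \<oplus>\<^bsub>E\<^esub> y" "c \<odot>\<^bsub>M\<^esub> x = c \<odot>\<^bsub>E\<^esub> x" "\<zero>\<^bsub>M\<^esub> = \<zero>\<^bsub>E\<^esub>" "nrm M = nrm E"
  using assms by (auto simp: FIN_def)

context normed_space
begin

lemma FIN_D:
  assumes "M \<in> FIN E"
  shows FIN_subset: "carrier M \<subseteq> carrier E"
    and normed_space_FIN: "normed_space M"
    and FIN_span: "\<exists>B. finite B \<and> B \<subseteq> carrier M \<and> (\<forall>x\<in>carrier M. \<exists>c. x = lincomb E B c (\<lambda>b. b))"
proof -
  obtain C B where M: "M = E\<lparr>carrier := C\<rparr>" and sub: "submodule C (scalar_space :: ('k, 'k) nspace) E"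
    and B: "finite B" "B \<subseteq> C" "\<forall>x\<in>C. \<exists>c. x = (\<Oplus>\<^bsub>E\<^esub>b\<in>B. c b \<odot>\<^bsub>E\<^esub> b)"
    using assms by (auto simp: FIN_def)
  show s: "carrier M \<subseteq> carrier E" using submoduleE(1)[OF sub] by (simp add: M)
  have "Module.module scalar_space M"
    unfolding M by (rule submodule.submodule_is_module[OF sub module_axioms])
  then show "normed_space M"
    by (rule normed_space.intro) (use s in \<open>unfold_locales, auto simp: M nrm_eq_0_iff nrm_smult nrm_triangle subset_iff\<close>)
  show "\<exists>B. finite B \<and> B \<subseteq> carrier M \<and> (\<forall>x\<in>carrier M. \<exists>c. x = lincomb E B c (\<lambda>b. b))"
    using B by (auto simp: M lincomb_def)
qed

lemma a_minus_FIN: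
  assumes M: "M \<in> FIN E" and x: "x \<in> carrier M" "y \<in> carrier M"
  shows "x \<ominus>\<^bsub>M\<^esub> y = x \<ominus>\<^bsub>E\<^esub> y"
proof -
  interpret M: normed_space M by (rule normed_space_FIN[OF M])
  show ?thesis using x FIN_subset[OF M] by (simp add: M.a_minus_smult a_minus_smult FIN_simps[OF M] subset_iff)
qed

lemma lincomb_FIN:
  assumes M: "M \<in> FIN E" and "finite I" "\<And>i. i \<in> I \<Longrightarrow> b i \<in> carrier M"
  shows "lincomb M I c b = lincomb E I c b"
proof -
  interpret M: normed_space M by (rule normed_space_FIN[OF M])
  have "b i \<in> carrier E" if "b i \<in> carrier M" for i using that FIN_subset[OF M] by blast
  with assms(2,3) show ?thesis
    by (induction I rule: finite_induct) (simp_all add: lincomb_insert M.lincomb_insert FIN_simps[OF M])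
qed

lemma FIN_containing:
  assumes X: "finite X" "X \<subseteq> carrier E"
  obtains M where "M \<in> FIN E" "X \<subseteq> carrier M"
proof -
  define C where "C = range (\<lambda>c. lincomb E X c (\<lambda>x. x))"
  have Xc: "x \<in> X \<Longrightarrow> x \<in> carrier E" for x using X by blast
  have CE: "C \<subseteq> carrier E" using Xc by (auto simp: C_def)
  have smC: "a \<odot>\<^bsub>E\<^esub> x \<in> C" if xC: "x \<in> C" for a x
  proof -
    obtain c where "x = lincomb E X c (\<lambda>x. x)" using xC by (auto simp: C_def)
    then have "a \<odot>\<^bsub>E\<^esub> x = lincomb E X (\<lambda>i. a * c i) (\<lambda>x. x)"
      using lincomb_smult[OF X(1), of "\<lambda>x. x" a c] Xc by simp
    then show ?thesis by (simp add: C_def)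
  qed
  have "submodule C (scalar_space :: ('k, 'k) nspace) E"
  proof (rule submoduleI)
    show "\<zero>\<^bsub>E\<^esub> \<in> C"
      using smC[of "lincomb E X (\<lambda>_. 0) (\<lambda>x. x)" 0] Xc by (auto simp: C_def)
    fix a assume "a \<in> C"
    then show "\<ominus>\<^bsub>E\<^esub> a \<in> C" using smC[of a "- 1"] CE by (auto simp: a_inv_smult)
  next
    fix a b assume "a \<in> C" "b \<in> C"
    then obtain c d where "a = lincomb E X c (\<lambda>x. x)" "b = lincomb E X d (\<lambda>x. x)" by (auto simp: C_def)
    then show "a \<oplus>\<^bsub>E\<^esub> b \<in> C" using lincomb_add[OF X(1), of "\<lambda>x. x" c d, symmetric] Xc by (simp add: C_def)
  qed (use CE smC in auto)
  moreover have XC: "X \<subseteq> C"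
  proof
    fix x assume x: "x \<in> X"
    have "lincomb E I (\<lambda>y. if y = x then 1 else 0) (\<lambda>x. x) = (if x \<in> I then x else \<zero>\<^bsub>E\<^esub>)" if "finite I" "I \<subseteq> X" for I
      using that
    proof (induction I rule: finite_induct)
      case (insert y I)
      then have "y \<in> carrier E" "\<And>i. i \<in> I \<Longrightarrow> i \<in> carrier E" using Xc by auto
      then show ?case using insert x Xc by (auto simp: lincomb_insert)
    qed simp
    from this[OF X(1) order_refl] x have *: "x = lincomb E X (\<lambda>y. if y = x then 1 else 0) (\<lambda>x. x)" by simp
    show "x \<in> C" unfolding C_def by (rule range_eqI) (rule *)
  qed
  ultimately have "E\<lparr>carrier := C\<rparr> \<in> FIN E"
    using X(1) unfolding FIN_def C_def lincomb_def by blast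
  then show ?thesis using that XC by force
qed

end

section \<open>Local reflexivity and weak-star nets\<close>

text \<open>Only an isometric linear map into the bidual is fixed; surjectivity is postponed to
  \<open>bidual_iso\<close>. The locale thus covers the bidual itself, with the identity, as well as
  its copies in other types.\<close>

locale bidual_copy = E: normed_space E + G: normed_space G
  for E :: "('k::rc_field, 'v) nspace" and G :: "('k, 'w) nspace" +
  fixes \<Phi> :: "'w \<Rightarrow> ('v \<Rightarrow> 'k) \<Rightarrow> 'k"
  assumes \<Phi>_linear: "linear_map G (bidual E) \<Phi>"
    and \<Phi>_nrm: "x \<in> carrier G \<Longrightarrow> nrm (bidual E) (\<Phi> x) = nrm G x"
begin

sublocale D: normed_space "dual E" by (rule E.normed_space_dual)

lemma \<Phi>_cl [simp, intro]: "x \<in> carrier G \<Longrightarrow> \<Phi> x \<in> carrier (bidual E)"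
  using \<Phi>_linear by (rule linear_map_cl)

lemma \<Phi>_form: "linear_map G scalar_space (\<lambda>x. \<Phi> x f)"
  using linear_map_add[OF \<Phi>_linear] linear_map_smult[OF \<Phi>_linear] by (simp add: linear_form_iff)

lemma \<Phi>_bound: "x \<in> carrier G \<Longrightarrow> f \<in> carrier (dual E) \<Longrightarrow> norm (\<Phi> x f) \<le> nrm G x * op_norm E scalar_space f"
  using D.dual_bound[of "\<Phi> x" f] \<Phi>_nrm[of x] by simp

lemma \<Phi>_inj:
  assumes "x \<in> carrier G" "y \<in> carrier G" "\<And>f. f \<in> carrier (dual E) \<Longrightarrow> \<Phi> x f = \<Phi> y f"
  shows "x = y"
proof (rule G.eq_if_nrm_diff_0)
  have "\<Phi> (x \<ominus>\<^bsub>G\<^esub> y) = (\<lambda>_. 0)"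
  proof
    fix f show "\<Phi> (x \<ominus>\<^bsub>G\<^esub> y) f = 0"
      using G.linear_form_diff[OF \<Phi>_form, of x y f] assms dual_off[OF \<Phi>_cl, of "x \<ominus>\<^bsub>G\<^esub> y" f]
      by (cases "f \<in> carrier (dual E)") auto
  qed
  then show "nrm G (x \<ominus>\<^bsub>G\<^esub> y) = 0"
    using \<Phi>_nrm[of "x \<ominus>\<^bsub>G\<^esub> y"] normed_space.nrm_zero[OF D.normed_space_dual] assms by simp
qed (use assms in auto)

text \<open>Interpolation is applied to the image of \<open>M\<close> under \<open>\<Phi>\<close>.
  The points are then functionals on \<open>E\<close>, and the coordinates of \<open>x\<close> are
  the values \<open>\<Phi> x z\<close>; the coefficient function of the combination is
  \<open>\<Phi> x\<close> itself.\<close>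

lemma FIN_coordinates:
  assumes M: "M \<in> FIN G"
  obtains Z b where "finite Z" "Z \<subseteq> carrier (dual E)" "\<And>z. z \<in> Z \<Longrightarrow> b z \<in> carrier M"
    "\<And>x. x \<in> carrier M \<Longrightarrow> x = lincomb G Z (\<Phi> x) b"
    "\<And>x f. x \<in> carrier M \<Longrightarrow> \<Phi> x f = (\<Sum>z\<in>Z. \<Phi> x z * \<Phi> (b z) f)"
proof -
  interpret M: normed_space M by (rule G.normed_space_FIN[OF M])
  note MG = subsetD[OF G.FIN_subset[OF M]] and simps = FIN_simps[OF M]
  obtain B where B: "finite B" "B \<subseteq> carrier M" "\<And>x. x \<in> carrier M \<Longrightarrow> \<exists>c. x = lincomb G B c (\<lambda>b. b)"
    using G.FIN_span[OF M] by blast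
  have MB: "b \<in> B \<Longrightarrow> b \<in> carrier G" for b using B(2) MG by blast
  have add: "\<Phi> (x \<oplus>\<^bsub>G\<^esub> y) = (\<lambda>f. \<Phi> x f + \<Phi> y f)" if "x \<in> carrier G" "y \<in> carrier G" for x y
    using linear_map_add[OF \<Phi>_linear that] by simp
  have smult: "\<Phi> (c \<odot>\<^bsub>G\<^esub> x) = (\<lambda>f. c * \<Phi> x f)" if "x \<in> carrier G" for c x
    using linear_map_smult[OF \<Phi>_linear that] by simp
  define S where "S = \<Phi> ` carrier M"
  have S: "fun_subspace S" unfolding fun_subspace_def
  proof (intro conjI ballI allI)
    have "\<Phi> \<zero>\<^bsub>G\<^esub> = (\<lambda>_. 0)" using smult[of "\<zero>\<^bsub>G\<^esub>" 0] by simp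
    then show "(\<lambda>_. 0) \<in> S" using M.zero_cl unfolding S_def simps by (metis imageI)
    fix f g assume "f \<in> S" "g \<in> S"
    then obtain x y where x: "x \<in> carrier M" "f = \<Phi> x" "y \<in> carrier M" "g = \<Phi> y" by (auto simp: S_def)
    have "(\<lambda>f. \<Phi> x f + \<Phi> y f) = \<Phi> (x \<oplus>\<^bsub>M\<^esub> y)" using x MG add by (simp add: simps)
    then show "(\<lambda>f'. f f' + g f') \<in> S" using x by (auto simp: S_def)
  next
    fix c f assume "f \<in> S"
    then obtain x where x: "x \<in> carrier M" "f = \<Phi> x" by (auto simp: S_def)
    have "(\<lambda>f. c * \<Phi> x f) = \<Phi> (c \<odot>\<^bsub>M\<^esub> x)" using x MG smult by (simp add: simps)
    then show "(\<lambda>f'. c * f f') \<in> S" using x by (auto simp: S_def)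
  qed
  have span: "\<exists>c. \<forall>f. g f = (\<Sum>i\<in>B. c i * \<Phi> i f)" if "g \<in> S" for g
  proof -
    obtain x where x: "x \<in> carrier M" "g = \<Phi> x" using \<open>g \<in> S\<close> by (auto simp: S_def)
    obtain c where c: "x = lincomb G B c (\<lambda>b. b)" using B(3)[OF x(1)] by blast
    have "\<Phi> x f = (\<Sum>i\<in>B. c i * \<Phi> i f)" for f
      unfolding c by (rule G.linear_form_lincomb[OF \<Phi>_form B(1) MB])
    then show ?thesis using x(2) by blast
  qed
  have off: "g f = 0" if "g \<in> S" "f \<notin> carrier (dual E)" for g f
    using that MG dual_off[OF \<Phi>_cl] by (auto simp: S_def)
  obtain Z e where Z: "finite Z" "Z \<subseteq> carrier (dual E)" and e: "\<And>z. z \<in> Z \<Longrightarrow> e z \<in> S"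
    and interp: "\<And>g f. g \<in> S \<Longrightarrow> g f = (\<Sum>z\<in>Z. g z * e z f)"
    by (rule finite_interpolation[where b=\<Phi> and X="carrier (dual E)", OF S B(1)], erule span, erule (1) off, rule that)
  have "\<forall>z. \<exists>x. z \<in> Z \<longrightarrow> x \<in> carrier M \<and> e z = \<Phi> x" using e by (auto simp: S_def)
  then obtain b where b: "\<And>z. z \<in> Z \<Longrightarrow> b z \<in> carrier M" "\<And>z. z \<in> Z \<Longrightarrow> e z = \<Phi> (b z)" by metis
  have exp: "\<Phi> x f = (\<Sum>z\<in>Z. \<Phi> x z * \<Phi> (b z) f)" if "x \<in> carrier M" for x f
  proof -
    have "\<Phi> x \<in> S" using that by (simp add: S_def)
    from interp[OF this, of f] show ?thesis using b(2) by simp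
  qed
  moreover have "x = lincomb G Z (\<Phi> x) b" if x: "x \<in> carrier M" for x
  proof (rule \<Phi>_inj)
    fix f
    have "\<Phi> (lincomb G Z (\<Phi> x) b) f = (\<Sum>z\<in>Z. \<Phi> x z * \<Phi> (b z) f)"
      by (intro G.linear_form_lincomb[OF \<Phi>_form Z(1)] MG b(1))
    also have "\<dots> = \<Phi> x f" by (rule exp[OF x, symmetric])
    finally show "\<Phi> x f = \<Phi> (lincomb G Z (\<Phi> x) b) f" by (rule sym)
  qed (use x b(1) MG in auto)
  ultimately show ?thesis by (intro that[of Z b] Z b(1))
qed

text \<open>Bounded coordinates fall into finitely many grid cells. Vectors with the same cells in
  all coordinates are close, and finitely many representatives exhaust the occurring codes.\<close>

lemma FIN_net:
  assumes M: "M \<in> FIN G" and \<delta>: "\<delta> > 0"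
  obtains Y where "finite Y" "Y \<subseteq> carrier M" "\<And>y. y \<in> Y \<Longrightarrow> nrm G y \<le> 1"
    "\<And>x. x \<in> carrier M \<Longrightarrow> nrm G x \<le> 1 \<Longrightarrow> \<exists>y\<in>Y. nrm G (x \<ominus>\<^bsub>G\<^esub> y) \<le> \<delta>"
proof -
  note MG = subsetD[OF G.FIN_subset[OF M]]
  obtain Z b where Z: "finite Z" "Z \<subseteq> carrier (dual E)" "\<And>z. z \<in> Z \<Longrightarrow> b z \<in> carrier M"
    and exp: "\<And>x. x \<in> carrier M \<Longrightarrow> x = lincomb G Z (\<Phi> x) b"
    and exp\<Phi>: "\<And>x f. x \<in> carrier M \<Longrightarrow> \<Phi> x f = (\<Sum>z\<in>Z. \<Phi> x z * \<Phi> (b z) f)"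
    by (rule FIN_coordinates[OF M], rule that)
  have bG: "z \<in> Z \<Longrightarrow> b z \<in> carrier G" for z using Z(3) MG by blast
  \<comment> \<open>A coordinate error of \<open>\<delta> / K\<close> costs at most
    \<open>\<delta> / K * (K - 1)\<close> in norm; adding 1 also makes \<open>K\<close>
    positive.\<close>
  define K where "K = (\<Sum>z\<in>Z. nrm G (b z)) + 1"
  have K: "K > 0" unfolding K_def using bG by (intro add_nonneg_pos sum_nonneg) auto
  define R where "R = (\<Sum>z\<in>Z. op_norm E scalar_space z)"
  obtain cell :: "'k \<Rightarrow> int \<times> int" where cell: "finite (cell ` {x. norm x \<le> R})" "\<And>x y. cell x = cell y \<Longrightarrow> norm (x - y) \<le> \<delta> / K"
    using rc_field_totally_bounded[of "\<delta> / K" R] \<delta> K by auto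
  define U where "U = {x \<in> carrier M. nrm G x \<le> 1}"
  define code where "code x = restrict (\<lambda>z. cell (\<Phi> x z)) Z" for x
  have "code ` U \<subseteq> (\<Pi>\<^sub>E z\<in>Z. cell ` {x. norm x \<le> R})"
  proof clarify
    fix x assume x: "x \<in> U"
    have "norm (\<Phi> x z) \<le> R" if z: "z \<in> Z" for z
    proof -
      have zE: "z \<in> carrier (dual E)" using z Z(2) by blast
      have "norm (\<Phi> x z) \<le> nrm G x * op_norm E scalar_space z" using \<Phi>_bound[OF _ zE] x MG by (auto simp: U_def)
      also have "\<dots> \<le> 1 * op_norm E scalar_space z"
        using x E.dual_nonneg[OF zE] by (intro mult_right_mono) (auto simp: U_def)
      also have "\<dots> \<le> R" unfolding R_def using z Z E.dual_nonneg by (simp, intro member_le_sum) auto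
      finally show ?thesis .
    qed
    then show "code x \<in> (\<Pi>\<^sub>E z\<in>Z. cell ` {x. norm x \<le> R})" by (auto simp: code_def)
  qed
  then have "finite (code ` U)" by (rule finite_subset) (intro finite_PiE Z(1) cell(1))
  then obtain Y where Y: "Y \<subseteq> U" "finite Y" "code ` U = code ` Y"
    using finite_subset_image[of "code ` U" code U] by blast
  have "\<exists>y\<in>Y. nrm G (x \<ominus>\<^bsub>G\<^esub> y) \<le> \<delta>" if x: "x \<in> carrier M" "nrm G x \<le> 1" for x
  proof -
    have "code x \<in> code ` Y" using x Y(3) by (auto simp: U_def)
    then obtain y where y: "y \<in> Y" "code x = code y" by blast
    have yM: "y \<in> carrier M" using y Y(1) by (auto simp: U_def)
    have close: "norm (\<Phi> x z - \<Phi> y z) \<le> \<delta> / K" if "z \<in> Z" for z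
      using fun_cong[OF y(2), of z] that by (intro cell(2)) (simp add: code_def)
    have "x \<ominus>\<^bsub>G\<^esub> y = lincomb G Z (\<lambda>z. \<Phi> x z - \<Phi> y z) b"
    proof (rule \<Phi>_inj)
      fix f
      have "\<Phi> (x \<ominus>\<^bsub>G\<^esub> y) f = \<Phi> x f - \<Phi> y f" using x yM MG by (intro G.linear_form_diff[OF \<Phi>_form]) auto
      also have "\<Phi> x f = (\<Sum>z\<in>Z. \<Phi> x z * \<Phi> (b z) f)"
        by (rule exp\<Phi>[OF x(1)])
      also have "\<Phi> y f = (\<Sum>z\<in>Z. \<Phi> y z * \<Phi> (b z) f)"
        by (rule exp\<Phi>[OF yM])
      also have "(\<Sum>z\<in>Z. \<Phi> x z * \<Phi> (b z) f) - (\<Sum>z\<in>Z. \<Phi> y z * \<Phi> (b z) f) = (\<Sum>z\<in>Z. (\<Phi> x z - \<Phi> y z) * \<Phi> (b z) f)"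
        by (simp add: sum_subtractf left_diff_distrib)
      also have "\<dots> = \<Phi> (lincomb G Z (\<lambda>z. \<Phi> x z - \<Phi> y z) b) f"
        by (rule sym, rule G.linear_form_lincomb[OF \<Phi>_form Z(1)]) (rule bG)
      finally show "\<Phi> (x \<ominus>\<^bsub>G\<^esub> y) f = \<Phi> (lincomb G Z (\<lambda>z. \<Phi> x z - \<Phi> y z) b) f" .
    qed (use x yM MG bG in auto)
    then have "nrm G (x \<ominus>\<^bsub>G\<^esub> y) \<le> (\<Sum>z\<in>Z. norm (\<Phi> x z - \<Phi> y z) * nrm G (b z))"
      using G.nrm_lincomb_le[OF Z(1) bG] by simp
    also have "\<dots> \<le> (\<Sum>z\<in>Z. \<delta> / K * nrm G (b z))" using close bG by (intro sum_mono mult_right_mono) auto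
    also have "\<dots> = \<delta> / K * (K - 1)" by (simp add: sum_distrib_left K_def)
    also have "\<dots> \<le> \<delta> / K * K" using \<delta> K by (intro mult_left_mono) auto
    also have "\<dots> = \<delta>" using K by simp
    finally show ?thesis using y(1) by blast
  qed
  moreover have "Y \<subseteq> carrier M" "\<And>y. y \<in> Y \<Longrightarrow> nrm G y \<le> 1" using Y(1) by (auto simp: U_def)
  ultimately show ?thesis by (intro that[OF Y(2)])
qed

text \<open>Helly's theorem bounds \<open>T\<close> only on a finite net of the unit ball. Once
  \<open>T\<close> is known to be bounded, its norm \<open>t\<close> satisfies
  \<open>t \<le> 1 + \<delta> + t * \<delta>\<close>, which can be solved for
  \<open>t\<close>.\<close>

theorem local_reflexivity:
  assumes M: "M \<in> FIN G" and F: "finite F" "F \<subseteq> carrier (dual E)" and \<epsilon>: "\<epsilon> > 0"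
  obtains T where "linear_map M E T" "\<And>x. x \<in> carrier M \<Longrightarrow> nrm E (T x) \<le> (1 + \<epsilon>) * nrm G x"
    "\<And>x f. x \<in> carrier M \<Longrightarrow> f \<in> F \<Longrightarrow> f (T x) = \<Phi> x f"
proof -
  interpret M: normed_space M by (rule G.normed_space_FIN[OF M])
  note MG = subsetD[OF G.FIN_subset[OF M]] and simps = FIN_simps[OF M]
  \<comment> \<open>Chosen so that \<open>(1 + \<delta>) / (1 - \<delta>)\<close> equals
    \<open>1 + \<epsilon>\<close>.\<close>
  define \<delta> where "\<delta> = \<epsilon> / (2 + \<epsilon>)"
  have \<delta>: "\<delta> > 0" "\<delta> < 1" "1 + \<delta> = (1 + \<epsilon>) * (1 - \<delta>)" using \<epsilon> by (auto simp: \<delta>_def field_simps)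
  obtain Z b where Z: "finite Z" "Z \<subseteq> carrier (dual E)" "\<And>z. z \<in> Z \<Longrightarrow> b z \<in> carrier M"
    and "\<And>x. x \<in> carrier M \<Longrightarrow> x = lincomb G Z (\<Phi> x) b"
    and exp: "\<And>x f. x \<in> carrier M \<Longrightarrow> \<Phi> x f = (\<Sum>z\<in>Z. \<Phi> x z * \<Phi> (b z) f)"
    by (rule FIN_coordinates[OF M], rule that)
  obtain Y where Y: "finite Y" "Y \<subseteq> carrier M" "\<And>y. y \<in> Y \<Longrightarrow> nrm G y \<le> 1"
    and net: "\<And>x. x \<in> carrier M \<Longrightarrow> nrm G x \<le> 1 \<Longrightarrow> \<exists>y\<in>Y. nrm G (x \<ominus>\<^bsub>G\<^esub> y) \<le> \<delta>"
    by (rule FIN_net[OF M \<delta>(1)], rule that)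
  \<comment> \<open>By interpolation the sum is \<open>\<Phi> y g\<close>, so the hypothesis of
    Helly's theorem says just that \<open>y\<close> lies in the unit ball.\<close>
  have a: "norm (\<Sum>z\<in>Z. \<Phi> y z * \<Phi> (b z) g) \<le> op_norm E scalar_space g" if y: "y \<in> Y" and g: "g \<in> carrier (dual E)" for y g
  proof -
    have "norm (\<Phi> y g) \<le> nrm G y * op_norm E scalar_space g" using y Y(2) MG g by (intro \<Phi>_bound) auto
    also have "\<dots> \<le> 1 * op_norm E scalar_space g" using Y(3)[OF y] E.dual_nonneg[OF g] by (intro mult_right_mono)
    finally show ?thesis using exp[of y g] y Y(2) by auto
  qed
  have e: "\<Phi> (b z) \<in> carrier (bidual E)" if "z \<in> Z" for z using Z(3)[OF that] MG by blast
  obtain \<xi> where \<xi>: "\<And>z. z \<in> Z \<Longrightarrow> \<xi> z \<in> carrier E" "\<And>f z. f \<in> F \<Longrightarrow> z \<in> Z \<Longrightarrow> f (\<xi> z) = \<Phi> (b z) f"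
    and \<xi>Y: "\<And>y. y \<in> Y \<Longrightarrow> nrm E (lincomb E Z (\<Phi> y) \<xi>) \<le> 1 + \<delta>"
    by (rule E.Helly[where e="\<lambda>z. \<Phi> (b z)" and a=\<Phi>, OF Z(1) Y(1) F e a \<delta>(1)];
      (assumption | rule that))
  define T where "T x = lincomb E Z (\<Phi> x) \<xi>" for x
  have T: "linear_map M E T"
    unfolding linear_map_def
  proof (intro conjI ballI allI funcsetI)
    show "T x \<in> carrier E" for x using \<xi>(1) by (auto simp: T_def)
    fix x y assume "x \<in> carrier M" "y \<in> carrier M"
    then show "T (x \<oplus>\<^bsub>M\<^esub> y) = T x \<oplus>\<^bsub>E\<^esub> T y"
      using E.lincomb_add[OF Z(1), of \<xi> "\<Phi> x" "\<Phi> y"] \<xi>(1) linear_map_add[OF \<Phi>_linear] MG by (simp add: T_def simps)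
  next
    fix c x assume "x \<in> carrier M"
    then show "T (c \<odot>\<^bsub>M\<^esub> x) = c \<odot>\<^bsub>E\<^esub> T x"
      using E.lincomb_smult[OF Z(1), of \<xi> c "\<Phi> x"] \<xi>(1) linear_map_smult[OF \<Phi>_linear] MG by (simp add: T_def simps)
  qed
  note T_cl = linear_map_cl[OF T]
  \<comment> \<open>A crude bound from the coordinates, which makes the operator norm a genuine
    supremum before the net is used.\<close>
  define L where "L = (\<Sum>z\<in>Z. op_norm E scalar_space z * nrm E (\<xi> z))"
  have "nrm E (T x) \<le> L * nrm M x" if x: "x \<in> carrier M" for x
  proof -
    have "nrm E (T x) \<le> (\<Sum>z\<in>Z. norm (\<Phi> x z) * nrm E (\<xi> z))"
      unfolding T_def using \<xi>(1) by (intro E.nrm_lincomb_le Z)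
    also have "\<dots> \<le> (\<Sum>z\<in>Z. (nrm G x * op_norm E scalar_space z) * nrm E (\<xi> z))"
      using \<xi>(1) x MG Z(2) by (intro sum_mono mult_right_mono \<Phi>_bound) auto
    also have "\<dots> = L * nrm M x" by (simp add: L_def sum_distrib_left sum_distrib_right simps mult_ac)
    finally show ?thesis .
  qed
  then have bT: "bounded_linear_map M E T" using T by (auto simp: bounded_linear_map_def)
  note T_bound = op_norm_bound[OF M.normed_space_axioms E.normed_space_axioms bT]
  have "nrm E (T x) \<le> 1 + \<delta> + op_norm M E T * \<delta>" if x: "x \<in> carrier M" "nrm G x \<le> 1" for x
  proof -
    obtain y where y: "y \<in> Y" "nrm G (x \<ominus>\<^bsub>G\<^esub> y) \<le> \<delta>" using net[OF x] by blast
    have yM: "y \<in> carrier M" using y Y(2) by blast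
    have d: "x \<ominus>\<^bsub>M\<^esub> y \<in> carrier M" "nrm M (x \<ominus>\<^bsub>M\<^esub> y) \<le> \<delta>"
      by (rule M.a_minus_cl[OF x(1) yM]) (use y(2) in \<open>simp add: G.a_minus_FIN[OF M x(1) yM] simps(4)\<close>)
    have "x = y \<oplus>\<^bsub>M\<^esub> (x \<ominus>\<^bsub>M\<^esub> y)"
      using x yM by (simp add: a_minus_def M.M.a_lcomm M.M.r_neg)
    then have "nrm E (T x) = nrm E (T y \<oplus>\<^bsub>E\<^esub> T (x \<ominus>\<^bsub>M\<^esub> y))"
      using linear_map_add[OF T yM d(1)] by simp
    also have "\<dots> \<le> nrm E (T y) + nrm E (T (x \<ominus>\<^bsub>M\<^esub> y))" by (intro E.nrm_triangle T_cl yM d)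
    also have "\<dots> \<le> (1 + \<delta>) + op_norm M E T * \<delta>"
    proof (rule add_mono)
      show "nrm E (T y) \<le> 1 + \<delta>" using \<xi>Y[OF y(1)] by (simp add: T_def)
      show "nrm E (T (x \<ominus>\<^bsub>M\<^esub> y)) \<le> op_norm M E T * \<delta>"
        using T_bound[OF d(1)] mult_left_mono[OF d(2) op_norm_nonneg[OF M.normed_space_axioms E.normed_space_axioms bT]] by simp
    qed
    finally show ?thesis .
  qed
  then have "op_norm M E T \<le> 1 + \<delta> + op_norm M E T * \<delta>"
    unfolding op_norm_def[of M E T] using M.zero_cl by (intro cSup_least) (auto simp: simps intro: exI[of _ "\<zero>\<^bsub>G\<^esub>"])
  then have "op_norm M E T * (1 - \<delta>) \<le> (1 + \<epsilon>) * (1 - \<delta>)" using \<delta>(3) by (simp add: algebra_simps)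
  then have op: "op_norm M E T \<le> 1 + \<epsilon>" using \<delta>(2) by simp
  have "nrm E (T x) \<le> (1 + \<epsilon>) * nrm G x" if x: "x \<in> carrier M" for x
    using T_bound[OF x] mult_right_mono[OF op, of "nrm G x"] x MG by (simp add: simps)
  moreover have "f (T x) = \<Phi> x f" if x: "x \<in> carrier M" and f: "f \<in> F" for x f
  proof -
    have "f (T x) = (\<Sum>z\<in>Z. \<Phi> x z * f (\<xi> z))"
      unfolding T_def using F(2) f \<xi>(1) Z(1) by (intro E.linear_form_lincomb dual_linear) auto
    also have "\<dots> = \<Phi> x f" unfolding exp[OF x, of f] by (intro sum.cong) (auto simp: \<xi>(2)[OF f])
    finally show ?thesis .
  qed
  ultimately show ?thesis by (intro that[OF T])
qed

end

section \<open>Bounded weak-star nets\<close>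

context normed_space
begin

lemma bidual_copy_id: "bidual_copy E (bidual E) (\<lambda>x. x)"
proof -
  interpret D: normed_space "dual E" by (rule normed_space_dual)
  interpret B: normed_space "bidual E" by (rule D.normed_space_dual)
  show ?thesis by unfold_locales (auto simp: linear_map_def)
qed

text \<open>Goldstine's theorem with constant 2: local reflexivity with
  \<open>\<epsilon> = 1\<close>, on a finite-dimensional space containing \<open>x''\<close>,
  matches finitely many functionals exactly within twice the norm of \<open>x''\<close>. The sets of
  such vectors generate the filter. Hence the nets chosen in \<open>bidual_extension\<close>
  exist.\<close>

lemma weak_star_net_exists:
  assumes x: "x'' \<in> carrier (bidual E)"
  shows "\<exists>\<F>. weak_star_net E x'' \<F>"
proof -
  interpret B: bidual_copy E "bidual E" "\<lambda>x. x" by (rule bidual_copy_id)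
  define C where "C = 2 * nrm (bidual E) x''"
  define S where "S f = {x \<in> carrier E. nrm E x \<le> C \<and> f x = x'' f}" for f
  define \<F> where "\<F> = (INF f\<in>carrier (dual E). principal (S f))"
  have "\<F> \<noteq> bot" unfolding \<F>_def
  proof (rule INF_filter_not_bot)
    fix F assume F: "F \<subseteq> carrier (dual E)" "finite F"
    obtain M where M: "M \<in> FIN (bidual E)" "{x''} \<subseteq> carrier M"
      using B.G.FIN_containing[of "{x''}"] x by auto
    obtain T where T: "linear_map M E T" "\<And>x. x \<in> carrier M \<Longrightarrow> nrm E (T x) \<le> (1 + 1) * nrm (bidual E) x"
      "\<And>x f. x \<in> carrier M \<Longrightarrow> f \<in> F \<Longrightarrow> f (T x) = x f"
      using B.local_reflexivity[OF M(1) F(2,1), of 1] by auto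
    have "T x'' \<in> (\<Inter>f\<in>F. S f)"
      using T(2)[of x''] T(3)[of x''] linear_map_cl[OF T(1), of x''] M(2) by (auto simp: S_def C_def)
    moreover have "(INF f\<in>F. principal (S f)) = principal (\<Inter>f\<in>F. S f)" using F(2) by (rule INF_principal_finite)
    ultimately show "(INF f\<in>F. principal (S f)) \<noteq> bot" by (auto simp: principal_eq_bot_iff)
  qed
  moreover have ev: "\<forall>\<^sub>F x in \<F>. x \<in> S f" if "f \<in> carrier (dual E)" for f
    using that unfolding \<F>_def by (rule eventually_INF1) (simp add: eventually_principal)
  have "\<forall>\<^sub>F x in \<F>. x \<in> carrier E \<and> nrm E x \<le> C"
    using ev[OF fun_subspace_zero[OF fun_subspace_dual]] by (rule eventually_mono) (auto simp: S_def)
  moreover have "(f \<longlongrightarrow> x'' f) \<F>" if "f \<in> carrier (dual E)" for f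
    using ev[OF that] by (intro tendsto_eventually) (auto simp: S_def elim: eventually_mono)
  ultimately show ?thesis unfolding weak_star_net_def by blast
qed

end

section \<open>Multilinear forms\<close>

lemma tuples_0 [simp]: "xs \<in> tuples 0 E \<longleftrightarrow> xs = []"
  by (auto simp: tuples_def)

lemma tuples_Cons [simp]: "x # xs \<in> tuples (Suc n) E \<longleftrightarrow> x \<in> carrier E \<and> xs \<in> tuples n E"
  by (auto simp: tuples_def)

lemma tuples_SucE:
  assumes "xs \<in> tuples (Suc n) E"
  obtains y ys where "xs = y # ys" "y \<in> carrier E" "ys \<in> tuples n E"
  using assms by (cases xs) (auto simp: tuples_def)

lemma tuples_update: "xs \<in> tuples n E \<Longrightarrow> y \<in> carrier E \<Longrightarrow> xs[i := y] \<in> tuples n E"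
  using set_update_subset_insert[of xs i y] by (auto simp: tuples_def)

lemma replicate_tuples: "x \<in> carrier E \<Longrightarrow> replicate n x \<in> tuples n E"
  by (auto simp: tuples_def)

lemma map_tuples: "xs \<in> tuples n E \<Longrightarrow> (\<And>x. x \<in> carrier E \<Longrightarrow> T x \<in> carrier F) \<Longrightarrow> map T xs \<in> tuples n F"
  by (auto simp: tuples_def)

text \<open>The first variable is separated from the others for inductions along lists. The
  definition updates whole tuples, so one vector has to exist that can stand in the updated first
  place.\<close>

lemma multilinear_form_Suc_iff:
  assumes "carrier E \<noteq> {}"
  shows "multilinear_form (Suc n) E A \<longleftrightarrow>
    (\<forall>ys\<in>tuples n E. linear_map E scalar_space (\<lambda>y. A (y # ys))) \<and>
    (\<forall>y\<in>carrier E. multilinear_form n E (\<lambda>ys. A (y # ys)))"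
proof (intro iffI conjI ballI)
  assume A: "multilinear_form (Suc n) E A"
  obtain x where x: "x \<in> carrier E" using assms by blast
  show "linear_map E scalar_space (\<lambda>y. A (y # ys))" if "ys \<in> tuples n E" for ys
    using A that x unfolding multilinear_form_def
    by (auto dest!: bspec[of _ _ "x # ys"] spec[of _ 0])
  show "multilinear_form n E (\<lambda>ys. A (y # ys))" if y: "y \<in> carrier E" for y
    unfolding multilinear_form_def
  proof (intro ballI allI impI)
    fix xs i assume xs: "xs \<in> tuples n E" and i: "i < n"
    then have "linear_map E scalar_space (\<lambda>z. A ((y # xs)[Suc i := z]))"
      using A y unfolding multilinear_form_def by (meson Suc_less_eq tuples_Cons)
    then show "linear_map E scalar_space (\<lambda>z. A (y # xs[i := z]))" by simp
  qed
next
  assume A: "(\<forall>ys\<in>tuples n E. linear_map E scalar_space (\<lambda>y. A (y # ys))) \<and>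
    (\<forall>y\<in>carrier E. multilinear_form n E (\<lambda>ys. A (y # ys)))"
  show "multilinear_form (Suc n) E A" unfolding multilinear_form_def
  proof (intro ballI allI impI)
    fix xs i assume xs: "xs \<in> tuples (Suc n) E" and i: "i < Suc n"
    obtain y ys where y: "xs = y # ys" "y \<in> carrier E" "ys \<in> tuples n E"
      using xs by (rule tuples_SucE)
    show "linear_map E scalar_space (\<lambda>z. A (xs[i := z]))"
    proof (cases i)
      case 0
      then show ?thesis using A y by simp
    next
      case (Suc j)
      then show ?thesis using A y i unfolding multilinear_form_def by simp
    qed
  qed
qed

lemma multilinear_form_0 [simp]: "multilinear_form 0 E A"
  by (simp add: multilinear_form_def)

text \<open>Unlike in \<open>associated_form\<close>, the constant is explicit and symmetry is not
  asked: fixing a variable changes the constant to \<open>C * nrm E y\<close>, and the extension to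
  the bidual may lose symmetry.\<close>

definition bounded_form :: "nat \<Rightarrow> ('k::rc_field, 'v) nspace \<Rightarrow> real \<Rightarrow> ('v list \<Rightarrow> 'k) \<Rightarrow> bool" where
  "bounded_form n E C A \<longleftrightarrow> multilinear_form n E A \<and>
     (\<forall>xs\<in>tuples n E. norm (A xs) \<le> C * prod_list (map (nrm E) xs))"

lemma bounded_formD:
  assumes "bounded_form n E C A"
  shows bounded_form_multilinear: "multilinear_form n E A"
    and bounded_form_bound: "xs \<in> tuples n E \<Longrightarrow> norm (A xs) \<le> C * prod_list (map (nrm E) xs)"
  using assms by (auto simp: bounded_form_def)

lemma linear_form_smult:
  "linear_map E scalar_space f \<Longrightarrow> linear_map E scalar_space (\<lambda>x. c * f x)"
  by (simp add: linear_form_iff algebra_simps)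

lemma linear_form_sum:
  "(\<And>i. i \<in> I \<Longrightarrow> linear_map E scalar_space (f i)) \<Longrightarrow> linear_map E scalar_space (\<lambda>x. \<Sum>i\<in>I. f i x)"
  by (simp add: linear_form_iff sum.distrib sum_distrib_left)

context normed_space
begin

lemma carrier_ne [simp]: "carrier E \<noteq> {}"
  using zero_cl by blast

lemmas multilinear_form_Suc = multilinear_form_Suc_iff[OF carrier_ne]

lemma prod_nrm_nonneg: "xs \<in> tuples n E \<Longrightarrow> 0 \<le> prod_list (map (nrm E) xs)"
  by (induction n arbitrary: xs) (auto elim!: tuples_SucE)

lemma bounded_form_Cons:
  assumes "bounded_form (Suc n) E C A" "y \<in> carrier E"
  shows "bounded_form n E (C * nrm E y) (\<lambda>ys. A (y # ys))"
  using assms bounded_form_bound[OF assms(1), of "y # _"]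
  by (auto simp: bounded_form_def multilinear_form_Suc mult.assoc)

lemma bounded_form_slice:
  assumes "bounded_form (Suc n) E C A" "ys \<in> tuples n E"
  shows "linear_map E scalar_space (\<lambda>y. A (y # ys))"
  using assms by (auto simp: bounded_form_def multilinear_form_Suc)

text \<open>The index lists have length \<open>n\<close> and may repeat indices: for the average of
  \<open>m\<close> operators the expansion has \<open>m ^ n\<close> terms of equal weight.\<close>

lemma multilinear_form_lincomb:
  assumes A: "multilinear_form n E A" and I: "finite I" "\<And>i. i \<in> I \<Longrightarrow> b i \<in> carrier E"
  shows "A (replicate n (lincomb E I c b)) =
    (\<Sum>is\<in>{is. set is \<subseteq> I \<and> length is = n}. prod_list (map c is) * A (map b is))"
  using A
proof (induction n arbitrary: A)
  case 0
  have "{is. set is \<subseteq> I \<and> length is = 0} = {[]}" by auto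
  then show ?case by simp
next
  case (Suc n)
  define v where "v = lincomb E I c b"
  define W where "W = {is. set is \<subseteq> I \<and> length is = n}"
  have v: "v \<in> carrier E" using I by (auto simp: v_def)
  have lin: "linear_map E scalar_space (\<lambda>y. A (y # replicate n v))"
    and mul: "\<And>y. y \<in> carrier E \<Longrightarrow> multilinear_form n E (\<lambda>ys. A (y # ys))"
    using Suc.prems replicate_tuples[OF v] by (auto simp: multilinear_form_Suc)
  have "A (replicate (Suc n) v) = (\<Sum>i\<in>I. c i * A (b i # replicate n v))"
    using linear_form_lincomb[OF lin I(1), of b c] I(2) by (simp add: v_def)
  also have "\<dots> = (\<Sum>i\<in>I. \<Sum>is\<in>W. c i * (prod_list (map c is) * A (b i # map b is)))"
    by (intro sum.cong refl) (simp add: v_def W_def Suc.IH[OF mul] I(2) sum_distrib_left)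
  also have "\<dots> = (\<Sum>(i, is)\<in>I \<times> W. prod_list (map c (i # is)) * A (map b (i # is)))"
    by (simp add: sum.cartesian_product mult.assoc)
  also have "\<dots> = (\<Sum>is\<in>(\<lambda>(i, is). i # is) ` (I \<times> W). prod_list (map c is) * A (map b is))"
    by (subst sum.reindex) (auto simp: inj_on_def intro: sum.cong)
  also have "(\<lambda>(i, is). i # is) ` (I \<times> W) = {is. set is \<subseteq> I \<and> length is = Suc n}"
    by (auto simp: W_def length_Suc_conv image_iff)
  finally show ?case by (simp add: v_def)
qed

end

section \<open>Symmetrization of multilinear forms\<close>

lemma prod_list_mset_cong:
  fixes f :: "'a \<Rightarrow> 'b::comm_monoid_mult"
  assumes "mset xs = mset ys" shows "prod_list (map f xs) = prod_list (map f ys)"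
  by (metis assms mset_map prod_mset_prod_list)

definition symmetrization :: "nat \<Rightarrow> ('v list \<Rightarrow> 'k::rc_field) \<Rightarrow> 'v list \<Rightarrow> 'k" where
  "symmetrization n B xs = inverse (fact n) * (\<Sum>\<sigma> | \<sigma> permutes {..<n}. B (permute_list \<sigma> xs))"

lemma permute_list_update:
  assumes "\<sigma> permutes {..<length xs}" "i < length xs"
  shows "permute_list \<sigma> (xs[i := y]) = (permute_list \<sigma> xs)[inv_into UNIV \<sigma> i := y]"
proof (rule nth_equalityI)
  fix j assume "j < length (permute_list \<sigma> (xs[i := y]))"
  then have j: "j < length xs" by simp
  have "\<sigma> j < length xs" using permutes_in_image[OF assms(1), of j] j by simp
  moreover have "inv_into UNIV \<sigma> i < length xs" using permutes_in_image[OF permutes_inv[OF assms(1)], of i] assms(2) by simp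
  moreover have "\<sigma> j = i \<longleftrightarrow> j = inv_into UNIV \<sigma> i" using permutes_inverses[OF assms(1)] by metis
  ultimately show "permute_list \<sigma> (xs[i := y]) ! j = (permute_list \<sigma> xs)[inv_into UNIV \<sigma> i := y] ! j"
    using assms j by (auto simp: permute_list_nth nth_list_update)
qed simp

lemma permute_list_tuples:
  "\<sigma> permutes {..<n} \<Longrightarrow> xs \<in> tuples n E \<Longrightarrow> permute_list \<sigma> xs \<in> tuples n E"
  by (auto simp: tuples_def)

text \<open>Membership in \<open>polynomials\<close> asks for a symmetric form, while forms on the
  bidual arise without symmetry. Averaging over permutations keeps the diagonal, and it keeps the
  bound because permuted tuples have the same product of norms.\<close>

lemma (in normed_space) associated_form_symmetrization:
  assumes B: "bounded_form n E C B" and P: "\<And>x. x \<in> carrier E \<Longrightarrow> P x = B (replicate n x)"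
  shows "associated_form n E P (symmetrization n B)"
  unfolding associated_form_def
proof (intro conjI ballI impI)
  let ?S = "{\<sigma>. \<sigma> permutes {..<n}}"
  have fin: "finite ?S" by (intro finite_permutations) simp
  have card: "card ?S = fact n" by (intro card_permutations) auto
  show "multilinear_form n E (symmetrization n B)"
    unfolding multilinear_form_def
  proof (intro ballI allI impI)
    fix xs i assume xs: "xs \<in> tuples n E" and i: "i < n"
    have len: "length xs = n" using xs by (simp add: tuples_def)
    show "linear_map E scalar_space (\<lambda>y. symmetrization n B (xs[i := y]))"
      unfolding symmetrization_def
    proof (intro linear_form_smult linear_form_sum)
      fix \<sigma> assume \<sigma>: "\<sigma> \<in> ?S"
      have "inv_into UNIV \<sigma> i < n" using permutes_in_image[OF permutes_inv, of \<sigma> "{..<n}" i] \<sigma> i by simp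
      then have "linear_map E scalar_space (\<lambda>y. B ((permute_list \<sigma> xs)[inv_into UNIV \<sigma> i := y]))"
        using bounded_form_multilinear[OF B] permute_list_tuples[of \<sigma> n xs E] \<sigma> xs
        unfolding multilinear_form_def by blast
      then show "linear_map E scalar_space (\<lambda>y. B (permute_list \<sigma> (xs[i := y])))"
        using \<sigma> i len by (simp add: permute_list_update)
    qed
  qed
  show "symmetrization n B xs = symmetrization n B ys"
    if xs: "xs \<in> tuples n E" "ys \<in> tuples n E" "mset xs = mset ys" for xs ys
  proof -
    obtain \<pi> where \<pi>: "\<pi> permutes {..<length ys}" "permute_list \<pi> ys = xs"
      using mset_eq_permutation[OF xs(3)] by blast
    then have \<pi>n: "\<pi> permutes {..<n}" using xs by (simp add: tuples_def)
    have "(\<Sum>\<sigma>\<in>?S. B (permute_list \<sigma> xs)) = (\<Sum>\<sigma>\<in>?S. B (permute_list (\<pi> \<circ> \<sigma>) ys))"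
      using xs(2) by (intro sum.cong refl) (auto simp: permute_list_compose \<pi>(2)[symmetric] tuples_def)
    also have "\<dots> = (\<Sum>\<sigma>\<in>(\<lambda>\<sigma>. \<pi> \<circ> \<sigma>) ` ?S. B (permute_list \<sigma> ys))"
    proof (subst sum.reindex)
      show "inj_on (\<lambda>\<sigma>. \<pi> \<circ> \<sigma>) ?S" 
        by (rule inj_onI) (metis \<pi>n comp_assoc id_comp permutes_inv_o(2))
    qed simp
    also have "(\<lambda>\<sigma>. \<pi> \<circ> \<sigma>) ` ?S = ?S" using image_compose_permutations_left[OF \<pi>n] by (simp add: setcompr_eq_image)
    finally show ?thesis by (simp add: symmetrization_def)
  qed
  show "\<exists>C. \<forall>xs\<in>tuples n E. norm (symmetrization n B xs) \<le> C * prod_list (map (nrm E) xs)"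
  proof (intro exI[of _ C] ballI)
    fix xs assume xs: "xs \<in> tuples n E"
    have "norm (\<Sum>\<sigma>\<in>?S. B (permute_list \<sigma> xs)) \<le> (\<Sum>\<sigma>\<in>?S. C * prod_list (map (nrm E) xs))"
    proof (rule order_trans[OF norm_sum], rule sum_mono)
      fix \<sigma> assume \<sigma>: "\<sigma> \<in> ?S"
      have "mset (permute_list \<sigma> xs) = mset xs" using \<sigma> xs by (intro mset_permute_list) (simp add: tuples_def)
      then have "prod_list (map (nrm E) (permute_list \<sigma> xs)) = prod_list (map (nrm E) xs)"
        by (rule prod_list_mset_cong)
      then show "norm (B (permute_list \<sigma> xs)) \<le> C * prod_list (map (nrm E) xs)"
        using bounded_form_bound[OF B permute_list_tuples[of \<sigma> n xs E]] \<sigma> xs by simp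
    qed
    also have "\<dots> = fact n * (C * prod_list (map (nrm E) xs))" by (simp add: card)
    finally show "norm (symmetrization n B xs) \<le> C * prod_list (map (nrm E) xs)"
      by (simp add: symmetrization_def norm_mult norm_inverse norm_divide field_simps)
  qed
  show "P x = symmetrization n B (replicate n x)" if x: "x \<in> carrier E" for x
  proof -
    have "permute_list \<sigma> (replicate n x) = replicate n x" if "\<sigma> \<in> ?S" for \<sigma>
      using that permutes_in_image[of \<sigma> "{..<n}"] by (intro nth_equalityI) (auto simp: permute_list_nth)
    then have "(\<Sum>\<sigma>\<in>?S. B (permute_list \<sigma> (replicate n x))) = (\<Sum>\<sigma>\<in>?S. B (replicate n x))"
      by (intro sum.cong refl) simp
    then show ?thesis by (simp add: symmetrization_def card P[OF x])
  qed
qed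

section \<open>The canonical extension to the bidual\<close>

text \<open>The iterated limit without nets: along a net converging weak-star to \<open>x''\<close>
  a functional tends to its value under \<open>x''\<close>. The first variable is outermost and is
  applied to the function obtained by extending in the remaining ones; the cutoff off the carrier
  lets that function be an element of the dual.\<close>

fun canonical_ext ::
    "('k::rc_field, 'v) nspace \<Rightarrow> ('v list \<Rightarrow> 'k) \<Rightarrow> (('v \<Rightarrow> 'k) \<Rightarrow> 'k) list \<Rightarrow> 'k" where
  "canonical_ext E A [] = A []"
| "canonical_ext E A (x'' # xs'') =
     x'' (\<lambda>y. if y \<in> carrier E then canonical_ext E (\<lambda>ys. A (y # ys)) xs'' else 0)"

lemma canonical_ext_cong:
  "(\<And>ys. ys \<in> tuples (length xs) E \<Longrightarrow> A ys = B ys) \<Longrightarrow> canonical_ext E A xs = canonical_ext E B xs"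
proof (induction xs arbitrary: A B)
  case (Cons x xs)
  have "(\<lambda>y. if y \<in> carrier E then canonical_ext E (\<lambda>ys. A (y # ys)) xs else 0) =
      (\<lambda>y. if y \<in> carrier E then canonical_ext E (\<lambda>ys. B (y # ys)) xs else 0)"
  proof
    fix y
    show "(if y \<in> carrier E then canonical_ext E (\<lambda>ys. A (y # ys)) xs else 0) =
      (if y \<in> carrier E then canonical_ext E (\<lambda>ys. B (y # ys)) xs else 0)"
      using Cons.IH[of "\<lambda>ys. A (y # ys)" "\<lambda>ys. B (y # ys)"] Cons.prems by simp
  qed
  then show ?case unfolding canonical_ext.simps by (rule arg_cong)
qed simp

context normed_space
begin

definition slice :: "('v list \<Rightarrow> 'k) \<Rightarrow> (('v \<Rightarrow> 'k) \<Rightarrow> 'k) list \<Rightarrow> 'v \<Rightarrow> 'k" where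
  "slice A xs = (\<lambda>y. if y \<in> carrier E then canonical_ext E (\<lambda>ys. A (y # ys)) xs else 0)"

lemma canonical_ext_Cons: "canonical_ext E A (x # xs) = x (slice A xs)"
  by (simp add: slice_def)

text \<open>The four claims depend on each other: \<open>slice\<close> lies in the dual because the
  extensions of the shorter forms are additive, homogeneous and bounded, and these three properties
  pass to the next length because the first variable is a bounded functional evaluated at
  \<open>slice\<close>.\<close>

lemma canonical_ext_props:
  assumes "xs \<in> tuples n (bidual E)"
  shows "\<And>A B C D. bounded_form n E C A \<Longrightarrow> bounded_form n E D B \<Longrightarrow>
      canonical_ext E (\<lambda>ys. A ys + B ys) xs = canonical_ext E A xs + canonical_ext E B xs"
    and "\<And>A C c. bounded_form n E C A \<Longrightarrow> canonical_ext E (\<lambda>ys. c * A ys) xs = c * canonical_ext E A xs"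
    and "\<And>A C. bounded_form n E C A \<Longrightarrow> 0 \<le> C \<Longrightarrow>
      norm (canonical_ext E A xs) \<le> C * prod_list (map (nrm (bidual E)) xs)"
    and "\<And>A C. bounded_form (Suc n) E C A \<Longrightarrow> 0 \<le> C \<Longrightarrow> slice A xs \<in> carrier (dual E)"
proof -
  interpret D: normed_space "dual E" by (rule normed_space_dual)
  interpret B: normed_space "bidual E" by (rule D.normed_space_dual)
  have slice: "slice A xs \<in> carrier (dual E)"
    if add: "\<And>A B C D. bounded_form n E C A \<Longrightarrow> bounded_form n E D B \<Longrightarrow>
      canonical_ext E (\<lambda>ys. A ys + B ys) xs = canonical_ext E A xs + canonical_ext E B xs"
    and smult: "\<And>A C c. bounded_form n E C A \<Longrightarrow> canonical_ext E (\<lambda>ys. c * A ys) xs = c * canonical_ext E A xs"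
    and bound: "\<And>A C. bounded_form n E C A \<Longrightarrow> 0 \<le> C \<Longrightarrow>
      norm (canonical_ext E A xs) \<le> C * prod_list (map (nrm (bidual E)) xs)"
    and xs: "xs \<in> tuples n (bidual E)" and A: "bounded_form (Suc n) E C A" "0 \<le> C"
    for n xs A C
  proof -
    note lin = bounded_form_slice[OF A(1)] and bf = bounded_form_Cons[OF A(1)]
    have len: "length xs = n" using xs by (simp add: tuples_def)
    show ?thesis
    proof (rule dualI[where C="C * prod_list (map (nrm (bidual E)) xs)"])
      fix x y assume x: "x \<in> carrier E" and y: "y \<in> carrier E"
      have "canonical_ext E (\<lambda>ys. A ((x \<oplus>\<^bsub>E\<^esub> y) # ys)) xs = canonical_ext E (\<lambda>ys. A (x # ys) + A (y # ys)) xs"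
        by (rule canonical_ext_cong) (use linear_map_add[OF lin x y] len in simp)
      then show "slice A xs (x \<oplus>\<^bsub>E\<^esub> y) = slice A xs x + slice A xs y"
        using add[OF bf[OF x] bf[OF y]] x y by (simp add: slice_def)
    next
      fix c x assume x: "x \<in> carrier E"
      have "canonical_ext E (\<lambda>ys. A ((c \<odot>\<^bsub>E\<^esub> x) # ys)) xs = canonical_ext E (\<lambda>ys. c * A (x # ys)) xs"
        by (rule canonical_ext_cong) (use linear_map_smult[OF lin x] len in simp)
      then show "slice A xs (c \<odot>\<^bsub>E\<^esub> x) = c * slice A xs x"
        using smult[OF bf[OF x]] x by (simp add: slice_def)
    next
      fix x assume x: "x \<in> carrier E"
      show "norm (slice A xs x) \<le> C * prod_list (map (nrm (bidual E)) xs) * nrm E x"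
        using bound[OF bf[OF x]] x A(2) by (simp add: slice_def mult_ac)
    qed (simp add: slice_def)
  qed
  have *: "(\<forall>A B C D. bounded_form n E C A \<longrightarrow> bounded_form n E D B \<longrightarrow>
      canonical_ext E (\<lambda>ys. A ys + B ys) xs = canonical_ext E A xs + canonical_ext E B xs) \<and>
    (\<forall>A C c. bounded_form n E C A \<longrightarrow> canonical_ext E (\<lambda>ys. c * A ys) xs = c * canonical_ext E A xs) \<and>
    (\<forall>A C. bounded_form n E C A \<longrightarrow> 0 \<le> C \<longrightarrow>
      norm (canonical_ext E A xs) \<le> C * prod_list (map (nrm (bidual E)) xs))"
    using assms
  proof (induction n arbitrary: xs)
    case 0
    then show ?case by (auto simp: bounded_form_def)
  next
    case (Suc n)
    obtain x ys where x: "xs = x # ys" "x \<in> carrier (bidual E)" and ys: "ys \<in> tuples n (bidual E)"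
      using Suc.prems by (rule tuples_SucE)
    have add: "canonical_ext E (\<lambda>zs. A zs + B zs) ys = canonical_ext E A ys + canonical_ext E B ys"
      if "bounded_form n E C A" "bounded_form n E D B" for A B C D
      using Suc.IH[OF ys] that by blast
    have smult: "canonical_ext E (\<lambda>zs. c * A zs) ys = c * canonical_ext E A ys" if "bounded_form n E C A" for A C c
      using Suc.IH[OF ys] that by blast
    have bound: "norm (canonical_ext E A ys) \<le> C * prod_list (map (nrm (bidual E)) ys)"
      if "bounded_form n E C A" "0 \<le> C" for A C
      using Suc.IH[OF ys] that by blast
    \<comment> \<open>Additivity and homogeneity are claimed for constants of either sign; the
      absolute value supplies the sign that membership of \<open>slice\<close> in the dual
      requires.\<close>
    have pos: "bounded_form k E \<bar>C\<bar> A" if "bounded_form k E C A" for k C A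
      using that prod_nrm_nonneg[of _ k] unfolding bounded_form_def
      by (meson abs_ge_self mult_right_mono order_trans)
    have sl: "slice A ys \<in> carrier (dual E)" if "bounded_form (Suc n) E C A" for A C
      by (rule slice[where n=n and C="\<bar>C\<bar>"]) (fact add smult bound ys | use pos[OF that] in simp)+
    show ?case
    proof (intro conjI allI impI)
      fix A B C D assume A: "bounded_form (Suc n) E C A" and B: "bounded_form (Suc n) E D B"
      have "slice (\<lambda>ys. A ys + B ys) ys = (\<lambda>y. slice A ys y + slice B ys y)"
        using add[OF bounded_form_Cons[OF A] bounded_form_Cons[OF B]] by (auto simp: slice_def)
      then show "canonical_ext E (\<lambda>ys. A ys + B ys) xs = canonical_ext E A xs + canonical_ext E B xs"
        using linear_map_add[OF dual_linear[OF x(2)] sl[OF A] sl[OF B]] unfolding x(1) canonical_ext_Cons by simp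
    next
      fix A C c assume A: "bounded_form (Suc n) E C A"
      have "slice (\<lambda>ys. c * A ys) ys = (\<lambda>y. c * slice A ys y)"
        using smult[OF bounded_form_Cons[OF A]] by (auto simp: slice_def)
      then show "canonical_ext E (\<lambda>ys. c * A ys) xs = c * canonical_ext E A xs"
        using linear_map_smult[OF dual_linear[OF x(2)] sl[OF A]] unfolding x(1) canonical_ext_Cons by simp
    next
      fix A C assume A: "bounded_form (Suc n) E C A" and C: "0 \<le> C"
      have "norm (slice A ys y) \<le> (C * prod_list (map (nrm (bidual E)) ys)) * nrm E y" if "y \<in> carrier E" for y
        using bound[OF bounded_form_Cons[OF A that]] that C by (simp add: slice_def mult_ac)
      then have "op_norm E scalar_space (slice A ys) \<le> C * prod_list (map (nrm (bidual E)) ys)"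
        using C B.prod_nrm_nonneg[OF ys] by (intro dual_norm_le) auto
      then have "op_norm E scalar_space (slice A ys) * nrm (bidual E) x
          \<le> C * prod_list (map (nrm (bidual E)) ys) * nrm (bidual E) x"
        using B.nrm_nonneg[OF x(2)] by (intro mult_right_mono) auto
      moreover have "norm (x (slice A ys)) \<le> nrm (bidual E) x * op_norm E scalar_space (slice A ys)"
        using D.dual_bound[OF x(2) sl[OF A]] by simp
      ultimately show "norm (canonical_ext E A xs) \<le> C * prod_list (map (nrm (bidual E)) xs)"
        unfolding x(1) canonical_ext_Cons by (simp add: mult_ac)
    qed
  qed
  show a: "\<And>A B C D. bounded_form n E C A \<Longrightarrow> bounded_form n E D B \<Longrightarrow>
      canonical_ext E (\<lambda>ys. A ys + B ys) xs = canonical_ext E A xs + canonical_ext E B xs"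
    and b: "\<And>A C c. bounded_form n E C A \<Longrightarrow> canonical_ext E (\<lambda>ys. c * A ys) xs = c * canonical_ext E A xs"
    and c: "\<And>A C. bounded_form n E C A \<Longrightarrow> 0 \<le> C \<Longrightarrow>
      norm (canonical_ext E A xs) \<le> C * prod_list (map (nrm (bidual E)) xs)"
    using * by blast+
  show "\<And>A C. bounded_form (Suc n) E C A \<Longrightarrow> 0 \<le> C \<Longrightarrow> slice A xs \<in> carrier (dual E)"
    by (rule slice[where n=n and xs=xs]) (erule (1) a | erule b | erule (1) c | rule assms | assumption)+
qed

lemmas canonical_ext_bound = canonical_ext_props(3)
lemmas slice_dual = canonical_ext_props(4)

text \<open>In the first variable linearity is immediate, as the operations of the bidual are
  pointwise. In a later variable it is first obtained for \<open>slice\<close> from the shorter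
  forms and then passes through the functional \<open>x\<close>.\<close>

lemma bounded_form_canonical_ext:
  assumes "bounded_form n E C A" "0 \<le> C"
  shows "bounded_form n (bidual E) C (canonical_ext E A)"
proof -
  interpret D: normed_space "dual E" by (rule normed_space_dual)
  interpret B: normed_space "bidual E" by (rule D.normed_space_dual)
  have "multilinear_form n (bidual E) (canonical_ext E A)" using assms
  proof (induction n arbitrary: A C)
    case (Suc n)
    note sl = slice_dual[OF _ Suc.prems]
    show ?case unfolding B.multilinear_form_Suc
    proof (intro conjI ballI)
      show "linear_map (bidual E) scalar_space (\<lambda>x. canonical_ext E A (x # ys))" for ys
        unfolding canonical_ext_Cons by (simp add: linear_form_iff)
      fix x assume x: "x \<in> carrier (bidual E)"
      show "multilinear_form n (bidual E) (\<lambda>ys. canonical_ext E A (x # ys))"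
        unfolding multilinear_form_def canonical_ext_Cons
      proof (intro ballI allI impI)
        fix ys i assume ys: "ys \<in> tuples n (bidual E)" and i: "i < n"
        have lin: "linear_map (bidual E) scalar_space (\<lambda>z. canonical_ext E (\<lambda>ys. A (u # ys)) (ys[i := z]))"
          if u: "u \<in> carrier E" for u
          using Suc.IH[OF bounded_form_Cons[OF Suc.prems(1) u]] u ys i Suc.prems(2)
          by (simp add: multilinear_form_def)
        show "linear_map (bidual E) scalar_space (\<lambda>z. x (slice A (ys[i := z])))"
          unfolding linear_form_iff
        proof (intro conjI ballI allI)
          fix z w assume z: "z \<in> carrier (bidual E)" and w: "w \<in> carrier (bidual E)"
          have "slice A (ys[i := z \<oplus>\<^bsub>bidual E\<^esub> w]) = (\<lambda>u. slice A (ys[i := z]) u + slice A (ys[i := w]) u)"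
            using linear_map_add[OF lin z w] by (auto simp: slice_def)
          then show "x (slice A (ys[i := z \<oplus>\<^bsub>bidual E\<^esub> w])) = x (slice A (ys[i := z])) + x (slice A (ys[i := w]))"
            using linear_map_add[OF dual_linear[OF x] sl[OF tuples_update[OF ys z]] sl[OF tuples_update[OF ys w]]] by simp
        next
          fix c z assume z: "z \<in> carrier (bidual E)"
          have "slice A (ys[i := c \<odot>\<^bsub>bidual E\<^esub> z]) = (\<lambda>u. c * slice A (ys[i := z]) u)"
            using linear_map_smult[OF lin z] by (auto simp: slice_def)
          then show "x (slice A (ys[i := c \<odot>\<^bsub>bidual E\<^esub> z])) = c * x (slice A (ys[i := z]))"
            using linear_map_smult[OF dual_linear[OF x] sl[OF tuples_update[OF ys z]]] by simp
        qed
      qed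
    qed
  qed simp
  then show ?thesis using canonical_ext_bound assms by (simp add: bounded_form_def)
qed

text \<open>Independence of the nets: the inner limits eventually equal \<open>slice\<close> along
  the outer filter, and \<open>slice\<close> is in the dual, to which weak-star convergence applies.
  So each \<open>Lim\<close> is a true limit.\<close>

lemma iterated_lim_eq_canonical_ext:
  assumes "bounded_form n E C A" "0 \<le> C" "xs \<in> tuples n (bidual E)"
    "list_all2 (weak_star_net E) xs \<F>s"
  shows "iterated_lim \<F>s A = canonical_ext E A xs"
  using assms
proof (induction n arbitrary: A C xs \<F>s)
  case (Suc n)
  obtain x ys where x: "xs = x # ys" "x \<in> carrier (bidual E)" and ys: "ys \<in> tuples n (bidual E)"
    using Suc.prems(3) by (rule tuples_SucE)
  obtain \<F> \<G>s where F: "\<F>s = \<F> # \<G>s" "weak_star_net E x \<F>" "list_all2 (weak_star_net E) ys \<G>s"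
    using Suc.prems(4) by (auto simp: x(1) list_all2_Cons1)
  note sl = slice_dual[OF ys Suc.prems(1,2)]
  have "iterated_lim \<G>s (\<lambda>zs. A (y # zs)) = slice A ys y" if "y \<in> carrier E" for y
    using Suc.IH[OF bounded_form_Cons[OF Suc.prems(1) that] _ ys F(3)] Suc.prems(2) that by (simp add: slice_def)
  moreover have "\<forall>\<^sub>F y in \<F>. y \<in> carrier E"
    using F(2) unfolding weak_star_net_def by (auto elim: eventually_mono)
  ultimately have "\<forall>\<^sub>F y in \<F>. iterated_lim \<G>s (\<lambda>zs. A (y # zs)) = slice A ys y"
    by (auto elim: eventually_mono)
  moreover have "(slice A ys \<longlongrightarrow> x (slice A ys)) \<F>" using F(2) sl by (simp add: weak_star_net_def)
  ultimately have "((\<lambda>y. iterated_lim \<G>s (\<lambda>zs. A (y # zs))) \<longlongrightarrow> x (slice A ys)) \<F>"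
    using tendsto_cong by metis
  then show ?case using F(2) unfolding x(1) F(1) canonical_ext_Cons
    by (simp add: tendsto_Lim weak_star_net_def)
qed simp

lemma bidual_extension_eq_canonical_ext:
  assumes "bounded_form n E C A" "0 \<le> C" "xs \<in> tuples n (bidual E)"
  shows "bidual_extension E A xs = canonical_ext E A xs"
proof -
  have "list_all2 (weak_star_net E) xs (map (\<lambda>x''. SOME \<F>. weak_star_net E x'' \<F>) xs)"
    using assms(3) someI_ex[OF weak_star_net_exists] by (auto simp: list_all2_conv_all_nth tuples_def subset_iff)
  then show ?thesis unfolding bidual_extension_def by (rule iterated_lim_eq_canonical_ext[OF assms])
qed

section \<open>The canonical embedding into the bidual\<close>

definition canonical_embedding :: "'v \<Rightarrow> ('v \<Rightarrow> 'k) \<Rightarrow> 'k" where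
  "canonical_embedding x f = (if f \<in> carrier (dual E) then f x else 0)"

lemma canonical_embedding:
  assumes x: "x \<in> carrier E"
  shows "canonical_embedding x \<in> carrier (bidual E)" "nrm (bidual E) (canonical_embedding x) \<le> nrm E x"
proof -
  interpret D: normed_space "dual E" by (rule normed_space_dual)
  have b: "norm (canonical_embedding x f) \<le> nrm E x * nrm (dual E) f" if "f \<in> carrier (dual E)" for f
    using dual_bound[OF that x] that by (simp add: canonical_embedding_def mult.commute)
  show "canonical_embedding x \<in> carrier (bidual E)"
  proof (rule dualI)
    fix f g assume fg: "f \<in> carrier (dual E)" "g \<in> carrier (dual E)"
    then show "canonical_embedding x (f \<oplus>\<^bsub>dual E\<^esub> g) = canonical_embedding x f + canonical_embedding x g"
      using fun_subspace_add[OF fun_subspace_dual fg] by (simp add: canonical_embedding_def)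
  next
    fix c f assume f: "f \<in> carrier (dual E)"
    then show "canonical_embedding x (c \<odot>\<^bsub>dual E\<^esub> f) = c * canonical_embedding x f"
      using fun_subspace_smult[OF fun_subspace_dual f, of c] by (simp add: canonical_embedding_def)
  qed (use b in \<open>auto simp: canonical_embedding_def\<close>)
  show "nrm (bidual E) (canonical_embedding x) \<le> nrm E x"
    using D.dual_norm_le[of "nrm E x", OF _ b] x by simp
qed

text \<open>On embedded vectors each variable of the extension becomes evaluation at a point. This
  is the source of the reverse norm estimates.\<close>

lemma canonical_ext_embedding:
  assumes "bounded_form n E C A" "0 \<le> C" "xs \<in> tuples n E"
  shows "canonical_ext E A (map canonical_embedding xs) = A xs"
  using assms
proof (induction n arbitrary: A C xs)
  case (Suc n)
  obtain x ys where x: "xs = x # ys" "x \<in> carrier E" and ys: "ys \<in> tuples n E"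
    using Suc.prems(3) by (rule tuples_SucE)
  have "map canonical_embedding ys \<in> tuples n (bidual E)"
    using ys canonical_embedding(1) by (rule map_tuples)
  then have "slice A (map canonical_embedding ys) \<in> carrier (dual E)"
    by (rule slice_dual) (fact Suc.prems)+
  then have "canonical_embedding x (slice A (map canonical_embedding ys)) = slice A (map canonical_embedding ys) x"
    by (simp add: canonical_embedding_def)
  also have "\<dots> = A (x # ys)"
    using Suc.IH[OF bounded_form_Cons[OF Suc.prems(1) x(2)] _ ys] Suc.prems(2) x by (simp add: slice_def)
  finally show ?case unfolding x(1) list.map canonical_ext_Cons .
qed simp

end

section \<open>Approximating the Aron-Berner extension along operators into the space\<close>

text \<open>The proportion of lists with a repetition is at most \<open>n^2 / m\<close>, stated
  without division. In such a list of length \<open>n + 1\<close> either the tail has a repetition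
  or the head is one of the at most \<open>n\<close> entries of the tail, and \<open>n^2 + n\<close>
  stays below \<open>(n + 1)^2\<close>.\<close>

lemma card_nondistinct_lists:
  "card {ks. set ks \<subseteq> {..<m::nat} \<and> length ks = n \<and> \<not> distinct ks} * m \<le> n\<^sup>2 * m ^ n"
proof (induction n)
  case 0
  have "{ks. set ks \<subseteq> {..<m::nat} \<and> length ks = 0 \<and> \<not> distinct ks} = {}" by auto
  then show ?case by (simp only: card.empty)
next
  case (Suc n)
  define W where "W = {ks. set ks \<subseteq> {..<m} \<and> length ks = n}"
  define N where "N = {ks. set ks \<subseteq> {..<m} \<and> length ks = n \<and> \<not> distinct ks}"
  have W: "finite W" "card W = m ^ n"
    unfolding W_def using finite_lists_length_eq[of "{..<m}" n] card_lists_length_eq[of "{..<m}" n] by auto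
  have N: "finite N" by (rule finite_subset[OF _ W(1)]) (auto simp: N_def W_def)
  define U where "U = {..<m} \<times> N"
  define V where "V = Sigma W (\<lambda>ks. set ks)"
  have fin: "finite U" "finite V" using W N by (auto simp: U_def V_def)
  have "{ks. set ks \<subseteq> {..<m} \<and> length ks = Suc n \<and> \<not> distinct ks} \<subseteq>
      (\<lambda>(i, ks). i # ks) ` U \<union> (\<lambda>(ks, i). i # ks) ` V"
  proof
    fix ks assume "ks \<in> {ks. set ks \<subseteq> {..<m} \<and> length ks = Suc n \<and> \<not> distinct ks}"
    then obtain i js where "ks = i # js" "i < m" "set js \<subseteq> {..<m}" "length js = n" "i \<in> set js \<or> \<not> distinct js"
      by (cases ks) auto
    then show "ks \<in> (\<lambda>(i, ks). i # ks) ` U \<union> (\<lambda>(ks, i). i # ks) ` V"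
      by (auto simp: U_def V_def N_def W_def image_iff)
  qed
  then have "card {ks. set ks \<subseteq> {..<m} \<and> length ks = Suc n \<and> \<not> distinct ks} \<le>
      card ((\<lambda>(i, ks). i # ks) ` U \<union> (\<lambda>(ks, i). i # ks) ` V)"
    by (rule card_mono[rotated]) (use fin in simp)
  also have "\<dots> \<le> card U + card V"
    by (rule order_trans[OF card_Un_le]) (intro add_mono card_image_le fin)
  also have "card V = (\<Sum>ks\<in>W. card (set ks))" unfolding V_def by (rule card_SigmaI) (use W in auto)
  also have "\<dots> \<le> (\<Sum>ks\<in>W. n)" by (intro sum_mono) (auto simp: W_def intro: card_length)
  finally have "card {ks. set ks \<subseteq> {..<m} \<and> length ks = Suc n \<and> \<not> distinct ks} * m \<le> (m * card N + m ^ n * n) * m"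
    using W by (intro mult_right_mono) (simp_all add: U_def card_cartesian_product)
  also have "\<dots> = m * (card N * m) + n * m ^ Suc n" by (simp add: algebra_simps)
  also have "\<dots> \<le> m * (n\<^sup>2 * m ^ n) + n * m ^ Suc n"
    using Suc.IH by (intro add_mono mult_left_mono) (simp_all add: N_def)
  also have "\<dots> = (n\<^sup>2 + n) * m ^ Suc n" by (simp add: algebra_simps)
  also have "\<dots> \<le> (Suc n)\<^sup>2 * m ^ Suc n" by (intro mult_right_mono) (simp_all add: power2_eq_square)
  finally show ?case .
qed

lemma (in normed_space) bounded_form_append:
  assumes "bounded_form (k + m) E C A" "xs \<in> tuples k E"
  shows "bounded_form m E (C * prod_list (map (nrm E) xs)) (\<lambda>zs. A (xs @ zs))"
  using assms
proof (induction k arbitrary: C A xs)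
  case (Suc k)
  obtain x ys where x: "xs = x # ys" "x \<in> carrier E" "ys \<in> tuples k E"
    using Suc.prems(2) by (rule tuples_SucE)
  have "bounded_form (k + m) E (C * nrm E x) (\<lambda>zs. A (x # zs))"
    by (rule bounded_form_Cons) (use Suc.prems(1) x in simp_all)
  from Suc.IH[OF this x(3)] show ?case by (simp add: x(1) mult.assoc)
qed simp

text \<open>The argument of Davie and Gamelin: operators \<open>T 0, T 1, \<dots>\<close> are chosen successively so that
  the symmetric form takes the value of the extension at distinct \<open>T i\<close>. In the average of \<open>m\<close>
  of them the proportion of index tuples with a repetition is \<open>O(1/m)\<close>.\<close>

context bidual_copy
begin

lemma operator_sequence:
  assumes A: "bounded_form n E C A" "0 \<le> C" and M: "M \<in> FIN G" and X: "finite X" "X \<subseteq> carrier M" and \<epsilon>: "\<epsilon> > 0"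
  obtains T :: "nat \<Rightarrow> 'w \<Rightarrow> 'v" where "\<And>j. linear_map M E (T j)"
    "\<And>j x. x \<in> carrier M \<Longrightarrow> nrm E (T j x) \<le> (1 + \<epsilon>) * nrm G x"
    "\<And>x ks. x \<in> X \<Longrightarrow> sorted_wrt (<) ks \<Longrightarrow> length ks = n \<Longrightarrow>
       A (map (\<lambda>i. T i x) ks) = canonical_ext E A (replicate n (\<Phi> x))"
proof -
  \<comment> \<open>The form with its first variables occupied by the operators listed in
    \<open>ks\<close>.\<close>
  define B where "B T x ks = (\<lambda>zs. A (map (\<lambda>i. T i x) ks @ zs))" for T :: "nat \<Rightarrow> 'w \<Rightarrow> 'v" and x ks
  \<comment> \<open>The functional to which \<open>\<Phi> x\<close> is applied when the next
    variable is extended. If \<open>T j\<close> matches it, extending in that variable gives the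
    same as inserting \<open>T j x\<close>; after it \<open>n - Suc (length ks)\<close> variables
    are left.\<close>
  define f where "f T x ks = E.slice (B T x ks) (replicate (n - Suc (length ks)) (\<Phi> x))" for T x ks
  \<comment> \<open>There are finitely many increasing lists below \<open>j\<close>, hence finitely
    many functionals for \<open>T j\<close> to match.\<close>
  define I where "I j = {ks. sorted_wrt (<) ks \<and> set ks \<subseteq> {..<j} \<and> length ks < n}" for j :: nat
  have finI: "finite (I j)" for j
    by (rule finite_subset[OF _ finite_lists_length_le[of "{..<j}" n]]) (auto simp: I_def)
  have XG: "x \<in> X \<Longrightarrow> x \<in> carrier G" for x using X(2) G.FIN_subset[OF M] by blast
  have f_dual: "f T x ks \<in> carrier (dual E)" if T: "\<And>i. i \<in> set ks \<Longrightarrow> linear_map M E (T i)" and x: "x \<in> X"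
    and len: "length ks < n" for T x ks
  proof -
    define xs where "xs = map (\<lambda>i. T i x) ks"
    have xs: "xs \<in> tuples (length ks) E"
      using T x X(2) by (auto simp: xs_def tuples_def intro: linear_map_cl)
    have "bounded_form (length ks + Suc (n - Suc (length ks))) E C A" using A(1) len by simp
    from E.bounded_form_append[OF this xs]
    have "bounded_form (Suc (n - Suc (length ks))) E (C * prod_list (map (nrm E) xs)) (B T x ks)"
      by (simp add: B_def xs_def)
    then show ?thesis unfolding f_def
      using A(2) E.prod_nrm_nonneg[OF xs] XG[OF x]
      by (intro E.slice_dual[where n="n - Suc (length ks)" and C="C * prod_list (map (nrm E) xs)"] replicate_tuples) auto
  qed
  define P where "P T j r \<longleftrightarrow> linear_map M E r \<and> (\<forall>x\<in>carrier M. nrm E (r x) \<le> (1 + \<epsilon>) * nrm G x) \<and>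
    (\<forall>x\<in>X. \<forall>ks\<in>I j. f T x ks (r x) = \<Phi> x (f T x ks))" for T j r
  have "\<exists>T. \<forall>j. P T j (T j)"
  proof (rule dependent_wellorder_choice)
    fix r :: "'w \<Rightarrow> 'v" and T T' :: "nat \<Rightarrow> 'w \<Rightarrow> 'v" and j
    assume eq: "\<And>i. i < j \<Longrightarrow> T i = T' i"
    \<comment> \<open>\<open>f\<close> reads the operators only at the indices in \<open>ks\<close>,
      all below \<open>j\<close>; this makes the successive choice legitimate.\<close>
    have "f T x ks = f T' x ks" if "ks \<in> I j" for x ks
    proof -
      have "map (\<lambda>i. T i x) ks = map (\<lambda>i. T' i x) ks" using that eq by (auto simp: I_def)
      then show ?thesis unfolding f_def B_def by (simp only:)
    qed
    then show "P T j r = P T' j r" unfolding P_def by auto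
  next
    fix j and T :: "nat \<Rightarrow> 'w \<Rightarrow> 'v" assume T: "\<And>i. i < j \<Longrightarrow> P T i (T i)"
    have F: "(\<lambda>(x, ks). f T x ks) ` (X \<times> I j) \<subseteq> carrier (dual E)"
      using T by (auto intro!: f_dual simp: I_def P_def)
    obtain r where "linear_map M E r" "\<And>x. x \<in> carrier M \<Longrightarrow> nrm E (r x) \<le> (1 + \<epsilon>) * nrm G x"
      "\<And>x g. x \<in> carrier M \<Longrightarrow> g \<in> (\<lambda>(x, ks). f T x ks) ` (X \<times> I j) \<Longrightarrow> g (r x) = \<Phi> x g"
      by (rule local_reflexivity[OF M _ F \<epsilon>], use X(1) finI in simp, rule that)
    then have "P T j r" unfolding P_def using X(2) by blast
    then show "\<exists>r. P T j r" by blast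
  qed
  then obtain T where PT: "\<And>j. P T j (T j)" by blast
  have T: "linear_map M E (T j)" for j using PT by (simp add: P_def)
  \<comment> \<open>One variable is converted at a time. The induction appends at the end, because
    the last index is the largest and its operator was chosen to match functionals built from the
    earlier ones.\<close>
  have key: "canonical_ext E (B T x ks) (replicate (n - length ks) (\<Phi> x)) = canonical_ext E A (replicate n (\<Phi> x))"
    if "x \<in> X" "sorted_wrt (<) ks" "length ks \<le> n" for x ks
    using that(2,3)
  proof (induction ks rule: rev_induct)
    case Nil
    then show ?case by (simp add: B_def)
  next
    case (snoc j ks)
    have isI: "ks \<in> I j" using snoc.prems by (auto simp: I_def sorted_wrt_append)
    have n: "n - length ks = Suc (n - Suc (length ks))" using snoc.prems by simp
    have "canonical_ext E A (replicate n (\<Phi> x)) = canonical_ext E (B T x ks) (replicate (n - length ks) (\<Phi> x))"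
      using snoc by (simp add: sorted_wrt_append)
    also have "\<dots> = \<Phi> x (f T x ks)" unfolding n replicate_Suc E.canonical_ext_Cons f_def ..
    also have "\<dots> = f T x ks (T j x)" using PT[of j] isI \<open>x \<in> X\<close> by (simp add: P_def)
    also have "\<dots> = canonical_ext E (\<lambda>ys. B T x ks (T j x # ys)) (replicate (n - Suc (length ks)) (\<Phi> x))"
      using linear_map_cl[OF T, of x j] \<open>x \<in> X\<close> X(2) by (auto simp: f_def E.slice_def)
    also have "(\<lambda>ys. B T x ks (T j x # ys)) = B T x (ks @ [j])" by (simp add: B_def)
    finally show ?case by simp
  qed
  show ?thesis
  proof (rule that[of T])
    show "A (map (\<lambda>i. T i x) ks) = canonical_ext E A (replicate n (\<Phi> x))"
      if "x \<in> X" "sorted_wrt (<) ks" "length ks = n" for x ks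
      using key[OF that(1,2)] that(3) by (simp add: B_def)
  qed (use PT in \<open>auto simp: P_def\<close>)
qed

theorem canonical_ext_approx:
  assumes A: "bounded_form n E C A" "0 \<le> C"
    and sym: "\<And>xs ys. xs \<in> tuples n E \<Longrightarrow> ys \<in> tuples n E \<Longrightarrow> mset xs = mset ys \<Longrightarrow> A xs = A ys"
    and M: "M \<in> FIN G" and X: "finite X" "X \<subseteq> carrier M" and \<epsilon>: "\<epsilon> > 0"
  obtains T where "linear_map M E T" "\<And>x. x \<in> carrier M \<Longrightarrow> nrm E (T x) \<le> (1 + \<epsilon>) * nrm G x"
    "\<And>x. x \<in> X \<Longrightarrow> norm (A (replicate n (T x)) - canonical_ext E A (replicate n (\<Phi> x))) \<le> \<epsilon>"
proof -
  note MG = subsetD[OF G.FIN_subset[OF M]] and simps = FIN_simps[OF M]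
  obtain S :: "nat \<Rightarrow> 'w \<Rightarrow> 'v" where S: "\<And>j. linear_map M E (S j)"
    and S_nrm: "\<And>j x. x \<in> carrier M \<Longrightarrow> nrm E (S j x) \<le> (1 + \<epsilon>) * nrm G x"
    and S_eq: "\<And>x ks. x \<in> X \<Longrightarrow> sorted_wrt (<) ks \<Longrightarrow> length ks = n \<Longrightarrow>
       A (map (\<lambda>i. S i x) ks) = canonical_ext E A (replicate n (\<Phi> x))"
    by (rule operator_sequence[OF A M X \<epsilon>], rule that)
  have S_cl: "x \<in> carrier M \<Longrightarrow> S j x \<in> carrier E" for j x by (rule linear_map_cl[OF S])
  have XM: "x \<in> X \<Longrightarrow> x \<in> carrier M" for x using X(2) by blast
  define R where "R x = canonical_ext E A (replicate n (\<Phi> x))" for x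
  \<comment> \<open>A bound for the error at a single index tuple, whatever its repetitions: the
    first term bounds the form, the second is the norm of the extension. \<open>L\<close> makes it
    uniform in \<open>x\<close>.\<close>
  define K where "K x = C * ((1 + \<epsilon>) * nrm G x) ^ n + norm (R x)" for x
  have K0: "0 \<le> K x" if "x \<in> X" for x using A(2) \<epsilon> G.nrm_nonneg[OF MG[OF XM[OF that]]] by (simp add: K_def)
  define L where "L = (\<Sum>x\<in>X. K x)"
  have KL: "K x \<le> L" if "x \<in> X" for x unfolding L_def using that X(1) K0 by (intro member_le_sum) auto
  \<comment> \<open>Index tuples with a repetition make up a share of at most
    \<open>n^2 / m\<close>, each with error at most \<open>L\<close>; \<open>m\<close> brings the
    total below \<open>\<epsilon>\<close>.\<close>
  obtain m :: nat where m: "real n ^ 2 * L / \<epsilon> < real m" using reals_Archimedean2 by blast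
  have L0: "0 \<le> L" unfolding L_def using K0 by (intro sum_nonneg)
  have "0 \<le> real n ^ 2 * L / \<epsilon>" using \<epsilon> L0 by simp
  then have m0: "m > 0" using m by linarith
  define T where "T x = lincomb E {..<m} (\<lambda>_. inverse (of_nat m)) (\<lambda>i. S i x)" for x
  have "linear_map M E T"
    unfolding linear_map_def
  proof (intro conjI ballI allI funcsetI)
    show "T x \<in> carrier E" if "x \<in> carrier M" for x using S_cl[OF that] by (auto simp: T_def)
    fix x y assume x: "x \<in> carrier M" "y \<in> carrier M"
    have "T (x \<oplus>\<^bsub>M\<^esub> y) = lincomb E {..<m} (\<lambda>_. inverse (of_nat m)) (\<lambda>i. S i x \<oplus>\<^bsub>E\<^esub> S i y)"
      using linear_map_add[OF S x] by (simp add: T_def)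
    then show "T (x \<oplus>\<^bsub>M\<^esub> y) = T x \<oplus>\<^bsub>E\<^esub> T y" using S_cl x by (simp add: T_def E.lincomb_add_vec)
  next
    fix c x assume x: "x \<in> carrier M"
    have "T (c \<odot>\<^bsub>M\<^esub> x) = lincomb E {..<m} (\<lambda>_. inverse (of_nat m)) (\<lambda>i. c \<odot>\<^bsub>E\<^esub> S i x)"
      using linear_map_smult[OF S x] by (simp add: T_def)
    then show "T (c \<odot>\<^bsub>M\<^esub> x) = c \<odot>\<^bsub>E\<^esub> T x" using S_cl x by (simp add: T_def E.lincomb_smult_vec)
  qed
  moreover have "nrm E (T x) \<le> (1 + \<epsilon>) * nrm G x" if x: "x \<in> carrier M" for x
  proof -
    have "nrm E (T x) \<le> (\<Sum>i<m. norm (inverse (of_nat m) :: 'k) * nrm E (S i x))"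
      unfolding T_def using S_cl[OF x] by (intro E.nrm_lincomb_le) auto
    also have "\<dots> \<le> (\<Sum>i<m. norm (inverse (of_nat m) :: 'k) * ((1 + \<epsilon>) * nrm G x))"
      by (intro sum_mono mult_left_mono S_nrm x) simp
    also have "\<dots> = (1 + \<epsilon>) * nrm G x" using m0 by (simp add: norm_inverse norm_divide)
    finally show ?thesis .
  qed
  moreover have "norm (A (replicate n (T x)) - R x) \<le> \<epsilon>" if x: "x \<in> X" for x
  proof -
    define W where "W = {ks. set ks \<subseteq> {..<m} \<and> length ks = n}"
    define N where "N = {ks. set ks \<subseteq> {..<m} \<and> length ks = n \<and> \<not> distinct ks}"
    have W: "finite W" "card W = m ^ n"
      unfolding W_def using finite_lists_length_eq[of "{..<m}" n] card_lists_length_eq[of "{..<m}" n] by auto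
    have NW: "N \<subseteq> W" by (auto simp: N_def W_def)
    define c where "c = inverse (of_nat m ^ n :: 'k)"
    have "A (replicate n (T x)) = (\<Sum>ks\<in>W. c * A (map (\<lambda>i. S i x) ks))"
      unfolding T_def W_def using E.multilinear_form_lincomb[OF bounded_form_multilinear[OF A(1)], of "{..<m}" "\<lambda>i. S i x"]
      by (auto simp: S_cl[OF XM[OF x]] c_def map_replicate_const power_inverse intro!: sum.cong)
    moreover have "R x = (\<Sum>ks\<in>W. c * R x)" using m0 by (simp add: W(2) c_def)
    ultimately have "A (replicate n (T x)) - R x = (\<Sum>ks\<in>W. c * (A (map (\<lambda>i. S i x) ks) - R x))"
      by (simp add: sum_subtractf right_diff_distrib)
    \<comment> \<open>A tuple without repetition contributes nothing: symmetry of \<open>A\<close>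
      on \<open>E\<close> allows its indices to be sorted, and on increasing tuples the value is
      exactly \<open>R x\<close>.\<close>
    also have "\<dots> = (\<Sum>ks\<in>N. c * (A (map (\<lambda>i. S i x) ks) - R x))"
    proof (rule sum.mono_neutral_right[OF W(1) NW], intro ballI)
      fix ks assume "ks \<in> W - N"
      then have ks: "distinct ks" "length ks = n" by (auto simp: W_def N_def)
      have t: "map (\<lambda>i. S i x) ks \<in> tuples n E" "map (\<lambda>i. S i x) (sort ks) \<in> tuples n E"
        using ks S_cl[OF XM[OF x]] by (auto simp: tuples_def)
      have "A (map (\<lambda>i. S i x) ks) = A (map (\<lambda>i. S i x) (sort ks))"
        by (rule sym[OF t]) simp
      also have "\<dots> = R x" unfolding R_def by (rule S_eq[OF x]) (use ks in \<open>simp_all add: strict_sorted_iff\<close>)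
      finally show "c * (A (map (\<lambda>i. S i x) ks) - R x) = 0" by simp
    qed
    also have "norm \<dots> \<le> (\<Sum>ks\<in>N. norm c * L)"
    proof (rule order_trans[OF norm_sum], rule sum_mono)
      fix ks assume "ks \<in> N"
      then have len: "length ks = n" by (simp add: N_def)
      have t: "map (\<lambda>i. S i x) ks \<in> tuples n E" using len S_cl[OF XM[OF x]] by (auto simp: tuples_def)
      have pl: "prod_list (map (\<lambda>i. nrm E (S i x)) js) \<le> ((1 + \<epsilon>) * nrm G x) ^ length js" for js
        by (induction js) (use S_nrm[OF XM[OF x]] S_cl[OF XM[OF x]] \<epsilon> G.nrm_nonneg[OF MG[OF XM[OF x]]]
            in \<open>auto intro!: mult_mono prod_list_nonneg\<close>)
      have "norm (A (map (\<lambda>i. S i x) ks)) \<le> C * prod_list (map (nrm E) (map (\<lambda>i. S i x) ks))"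
        by (rule bounded_form_bound[OF A(1) t])
      also have "\<dots> \<le> C * ((1 + \<epsilon>) * nrm G x) ^ n"
        using pl[of ks] len A(2) by (intro mult_left_mono) (simp_all add: o_def)
      finally have "norm (A (map (\<lambda>i. S i x) ks) - R x) \<le> K x"
        unfolding K_def using norm_triangle_ineq4[of "A (map (\<lambda>i. S i x) ks)" "R x"] by linarith
      then show "norm (c * (A (map (\<lambda>i. S i x) ks) - R x)) \<le> norm c * L"
        unfolding norm_mult using KL[OF x] by (intro mult_left_mono) auto
    qed
    also have "\<dots> = real (card N) * L / real m ^ n"
      by (simp add: c_def norm_inverse norm_power norm_divide field_simps)
    also have "\<dots> \<le> \<epsilon>"
    proof -
      have "real (card N * m) \<le> real (n\<^sup>2 * m ^ n)"
        using card_nondistinct_lists[of m n] unfolding N_def of_nat_le_iff .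
      then have "real (card N) * real m * L \<le> real n ^ 2 * real m ^ n * L"
        using L0 by (intro mult_right_mono) simp_all
      also have "\<dots> = (real n ^ 2 * L) * real m ^ n" by simp
      also have "\<dots> \<le> (\<epsilon> * real m) * real m ^ n"
        using m \<epsilon> by (intro mult_right_mono) (auto simp: field_simps)
      finally have "real m * (real (card N) * L) \<le> real m * (\<epsilon> * real m ^ n)" by (simp add: mult_ac)
      then have "real (card N) * L \<le> \<epsilon> * real m ^ n" using m0 by simp
      then show ?thesis using m0 by (simp add: field_simps)
    qed
    finally show ?thesis .
  qed
  ultimately show ?thesis unfolding R_def by (rule that)
qed

end

section \<open>The Aron-Berner extension\<close>

text \<open>Differences, and with them Cauchy sequences and limits, travel along the isometry;
  copies of the bidual thus become eligible for the notions stated for Banach spaces.\<close>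

lemma isometric_iso_banach_space:
  fixes G :: "('k::rc_field, 'v) nspace" and F :: "('k, 'w) nspace"
  assumes iso: "isometric_iso G F \<Phi>" and F: "banach_space F"
  shows "banach_space G"
proof -
  have lin: "linear_map G F \<Phi>" and bij: "bij_betw \<Phi> (carrier G) (carrier F)"
    and nrm: "\<And>x. x \<in> carrier G \<Longrightarrow> nrm F (\<Phi> x) = nrm G x" and "normed_space G"
    using iso by (auto simp: isometric_iso_def)
  interpret F: banach_space F by fact
  interpret G: normed_space G by fact
  have diff: "nrm F (\<Phi> x \<ominus>\<^bsub>F\<^esub> \<Phi> y) = nrm G (x \<ominus>\<^bsub>G\<^esub> y)" if "x \<in> carrier G" "y \<in> carrier G" for x y
  proof -
    have "\<Phi> (x \<ominus>\<^bsub>G\<^esub> y) = \<Phi> x \<ominus>\<^bsub>F\<^esub> \<Phi> y"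
      using that linear_map_cl[OF lin] by (simp add: G.a_minus_smult F.a_minus_smult linear_mapD[OF lin])
    then show ?thesis using nrm[of "x \<ominus>\<^bsub>G\<^esub> y"] that by simp
  qed
  show ?thesis
  proof (intro banach_space.intro banach_space_axioms.intro G.normed_space_axioms)
    fix s :: "nat \<Rightarrow> 'v"
    assume s: "\<And>j. s j \<in> carrier G"
      and cau: "\<And>e. e > 0 \<Longrightarrow> \<exists>N. \<forall>p\<ge>N. \<forall>q\<ge>N. nrm G (s p \<ominus>\<^bsub>G\<^esub> s q) < e"
    have "\<exists>l\<in>carrier F. (\<lambda>j. nrm F (\<Phi> (s j) \<ominus>\<^bsub>F\<^esub> l)) \<longlonglongrightarrow> 0"
      by (rule F.complete) (use linear_map_cl[OF lin s] cau in \<open>simp_all add: diff s\<close>)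
    then obtain l where l: "l \<in> carrier F" "(\<lambda>j. nrm F (\<Phi> (s j) \<ominus>\<^bsub>F\<^esub> l)) \<longlonglongrightarrow> 0" by blast
    then obtain k where "k \<in> carrier G" "l = \<Phi> k" using bij by (auto simp: bij_betw_def)
    then show "\<exists>l\<in>carrier G. (\<lambda>j. nrm G (s j \<ominus>\<^bsub>G\<^esub> l)) \<longlonglongrightarrow> 0"
      using l(2) by (auto simp: diff s)
  qed
qed

lemma associated_formD:
  assumes "associated_form n E P A"
  shows associated_form_multilinear: "multilinear_form n E A"
    and associated_form_sym: "xs \<in> tuples n E \<Longrightarrow> ys \<in> tuples n E \<Longrightarrow> mset xs = mset ys \<Longrightarrow> A xs = A ys"
    and associated_form_bound: "\<exists>C. \<forall>xs\<in>tuples n E. norm (A xs) \<le> C * prod_list (map (nrm E) xs)"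
    and associated_form_diag: "x \<in> carrier E \<Longrightarrow> P x = A (replicate n x)"
proof -
  note * = assms[unfolded associated_form_def]
  show "multilinear_form n E A" by (rule conjunct1[OF *])
  show "A xs = A ys" if "xs \<in> tuples n E" "ys \<in> tuples n E" "mset xs = mset ys"
    by (rule mp[OF bspec[OF bspec[OF conjunct1[OF conjunct2[OF *]] that(1)] that(2)] that(3)])
  show "\<exists>C. \<forall>xs\<in>tuples n E. norm (A xs) \<le> C * prod_list (map (nrm E) xs)"
    by (rule conjunct1[OF conjunct2[OF conjunct2[OF *]]])
  show "P x = A (replicate n x)" if "x \<in> carrier E"
    by (rule bspec[OF conjunct2[OF conjunct2[OF conjunct2[OF *]]] that])
qed

lemma (in normed_space) associated_form_bounded:
  assumes "associated_form n E P A"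
  obtains C where "0 \<le> C" "bounded_form n E C A"
proof -
  obtain C where C: "\<forall>xs\<in>tuples n E. norm (A xs) \<le> C * prod_list (map (nrm E) xs)"
    using associated_form_bound[OF assms] by (elim exE)
  have "norm (A xs) \<le> \<bar>C\<bar> * prod_list (map (nrm E) xs)" if "xs \<in> tuples n E" for xs
    using bspec[OF C that] mult_right_mono[OF abs_ge_self prod_nrm_nonneg[OF that], of C] by linarith
  then have "bounded_form n E \<bar>C\<bar> A"
    using associated_form_multilinear[OF assms] by (simp add: bounded_form_def)
  then show ?thesis by (rule that[rotated]) simp
qed

lemma comp_on_apply [simp]: "x \<in> carrier E \<Longrightarrow> comp_on E f T x = f (T x)"
  by (simp add: comp_on_def)

context bidual_copy
begin

text \<open>\<open>AB\<close> involves two choices, of an associated form and of nets. Both are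
  eliminated here, and all later facts are drawn from one symmetric bounded form and its canonical
  extension.\<close>

lemma AB_canonical_ext:
  assumes P: "P \<in> polynomials n E"
  obtains A C where "bounded_form n E C A" "0 \<le> C"
    "\<And>xs ys. xs \<in> tuples n E \<Longrightarrow> ys \<in> tuples n E \<Longrightarrow> mset xs = mset ys \<Longrightarrow> A xs = A ys"
    "\<And>x. x \<in> carrier E \<Longrightarrow> P x = A (replicate n x)"
    "\<And>x. x \<in> carrier G \<Longrightarrow> comp_on G (AB n E P) \<Phi> x = canonical_ext E A (replicate n (\<Phi> x))"
proof -
  define A where "A = (SOME A. associated_form n E P A)"
  have A: "associated_form n E P A"
    using P someI_ex[of "associated_form n E P"] by (auto simp: polynomials_def A_def)
  obtain C where C: "0 \<le> C" "bounded_form n E C A" using E.associated_form_bounded[OF A] .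
  show ?thesis
  proof (rule that[OF C(2,1)])
    show "A xs = A ys" if "xs \<in> tuples n E" "ys \<in> tuples n E" "mset xs = mset ys" for xs ys
      using associated_form_sym[OF A that] .
    show "P x = A (replicate n x)" if "x \<in> carrier E" for x
      using associated_form_diag[OF A that] .
    show "comp_on G (AB n E P) \<Phi> x = canonical_ext E A (replicate n (\<Phi> x))" if "x \<in> carrier G" for x
      using E.bidual_extension_eq_canonical_ext[OF C(2,1) replicate_tuples[OF \<Phi>_cl[OF that]]] that
      by (simp add: AB_def A_def[symmetric])
  qed
qed

text \<open>The canonical extension is pulled back along \<open>\<Phi>\<close> to a form on
  \<open>G\<close> with the same constant. It is possibly not symmetric, so its symmetrization
  serves as the associated form.\<close>

lemma AB_polynomial:
  assumes P: "P \<in> polynomials n E"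
  shows "comp_on G (AB n E P) \<Phi> \<in> polynomials n G"
proof -
  obtain A C where A: "bounded_form n E C A" "0 \<le> C"
    and "\<And>xs ys. xs \<in> tuples n E \<Longrightarrow> ys \<in> tuples n E \<Longrightarrow> mset xs = mset ys \<Longrightarrow> A xs = A ys"
    and "\<And>x. x \<in> carrier E \<Longrightarrow> P x = A (replicate n x)"
    and R: "\<And>x. x \<in> carrier G \<Longrightarrow> comp_on G (AB n E P) \<Phi> x = canonical_ext E A (replicate n (\<Phi> x))"
    by (rule AB_canonical_ext[OF P], rule that)
  define B where "B xs = canonical_ext E A (map \<Phi> xs)" for xs
  have ext: "bounded_form n (bidual E) C (canonical_ext E A)"
    by (rule E.bounded_form_canonical_ext[OF A])
  have tup: "map \<Phi> xs \<in> tuples n (bidual E)" if "xs \<in> tuples n G" for xs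
    using that \<Phi>_cl by (rule map_tuples)
  have "bounded_form n G C B"
    unfolding bounded_form_def
  proof (intro conjI ballI)
    show "multilinear_form n G B" unfolding multilinear_form_def
    proof (intro ballI allI impI)
      fix xs i assume xs: "xs \<in> tuples n G" and i: "i < n"
      have "linear_map (bidual E) scalar_space (\<lambda>y. canonical_ext E A ((map \<Phi> xs)[i := y]))"
        using bounded_form_multilinear[OF ext] tup[OF xs] i unfolding multilinear_form_def by blast
      then show "linear_map G scalar_space (\<lambda>y. B (xs[i := y]))"
        using linear_mapD[OF \<Phi>_linear] by (simp add: B_def map_update linear_form_iff)
    qed
    fix xs assume xs: "xs \<in> tuples n G"
    have "map (nrm (bidual E)) (map \<Phi> xs) = map (nrm G) xs"
      using xs \<Phi>_nrm by (auto simp: tuples_def)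
    then show "norm (B xs) \<le> C * prod_list (map (nrm G) xs)"
      using bounded_form_bound[OF ext tup[OF xs]] by (simp only: B_def)
  qed
  then have "associated_form n G (comp_on G (AB n E P) \<Phi>) (symmetrization n B)"
    by (rule G.associated_form_symmetrization) (simp add: R B_def del: comp_on_apply)
  then show ?thesis by (auto simp: polynomials_def vanishing_off_def comp_on_def)
qed

text \<open>The averaging result in the shape that both halves of the theorem use: a bound on
  \<open>op_norm\<close> is what the mapping inequalities of tensor norms and ideals take as
  input.\<close>

lemma AB_approx:
  assumes P: "P \<in> polynomials n E" and M: "M \<in> FIN G" and X: "finite X" "X \<subseteq> carrier M" and \<epsilon>: "\<epsilon> > 0"
  obtains T where "bounded_linear_map M E T" "op_norm M E T \<le> 1 + \<epsilon>"
    "\<And>x. x \<in> X \<Longrightarrow> norm (P (T x) - comp_on G (AB n E P) \<Phi> x) \<le> \<epsilon>"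
proof -
  note MG = subsetD[OF G.FIN_subset[OF M]]
  obtain A C where A: "bounded_form n E C A" "0 \<le> C"
    and sym: "\<And>xs ys. xs \<in> tuples n E \<Longrightarrow> ys \<in> tuples n E \<Longrightarrow> mset xs = mset ys \<Longrightarrow> A xs = A ys"
    and PA: "\<And>x. x \<in> carrier E \<Longrightarrow> P x = A (replicate n x)"
    and R: "\<And>x. x \<in> carrier G \<Longrightarrow> comp_on G (AB n E P) \<Phi> x = canonical_ext E A (replicate n (\<Phi> x))"
    by (rule AB_canonical_ext[OF P], rule that)
  obtain T where T: "linear_map M E T" "\<And>x. x \<in> carrier M \<Longrightarrow> nrm E (T x) \<le> (1 + \<epsilon>) * nrm G x"
    and app: "\<And>x. x \<in> X \<Longrightarrow> norm (A (replicate n (T x)) - canonical_ext E A (replicate n (\<Phi> x))) \<le> \<epsilon>"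
    by (rule canonical_ext_approx[OF A sym M X \<epsilon>]; (assumption | rule that))
  show ?thesis
  proof (rule that[of T])
    show "bounded_linear_map M E T" using T by (auto simp: bounded_linear_map_def FIN_simps[OF M])
    show "op_norm M E T \<le> 1 + \<epsilon>"
      using T(2) \<epsilon> by (intro op_norm_le[OF G.normed_space_FIN[OF M]]) (simp_all add: FIN_simps[OF M])
    show "norm (P (T x) - comp_on G (AB n E P) \<Phi> x) \<le> \<epsilon>" if "x \<in> X" for x
    proof -
      have "x \<in> carrier M" using that X(2) by blast
      then show ?thesis using app[OF that] by (simp only: PA[OF linear_map_cl[OF T(1)]] R[OF MG])
    qed
  qed
qed

end

text \<open>Surjectivity lets the canonical embedding of \<open>E\<close>, whose values lie in the
  bidual, be pulled back into \<open>G\<close>.\<close>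

locale bidual_iso = bidual_copy E G \<Phi>
  for E G :: "('k::rc_field, 'u) nspace" and \<Phi> :: "'u \<Rightarrow> ('u \<Rightarrow> 'k) \<Rightarrow> 'k" +
  assumes surj: "\<Phi> ` carrier G = carrier (bidual E)"
begin

text \<open>\<open>J\<close> is the canonical embedding followed by an inverse of
  \<open>\<Phi>\<close>, obtained by choice. Its linearity is inherited because vectors of
  \<open>G\<close> are separated by the functionals on \<open>E\<close>.\<close>

lemma embedding:
  obtains J where "bounded_linear_map E G J" "op_norm E G J \<le> 1"
    "\<And>n P x. P \<in> polynomials n E \<Longrightarrow> x \<in> carrier E \<Longrightarrow> comp_on G (AB n E P) \<Phi> (J x) = P x"
proof -
  have "\<forall>x. \<exists>y. x \<in> carrier E \<longrightarrow> y \<in> carrier G \<and> \<Phi> y = E.canonical_embedding x"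
  proof
    fix x show "\<exists>y. x \<in> carrier E \<longrightarrow> y \<in> carrier G \<and> \<Phi> y = E.canonical_embedding x"
    proof (cases "x \<in> carrier E")
      case True
      then have "E.canonical_embedding x \<in> \<Phi> ` carrier G" unfolding surj by (rule E.canonical_embedding)
      then show ?thesis by auto
    qed simp
  qed
  then obtain J where "\<forall>x. x \<in> carrier E \<longrightarrow> J x \<in> carrier G \<and> \<Phi> (J x) = E.canonical_embedding x" by metis
  then have J: "x \<in> carrier E \<Longrightarrow> J x \<in> carrier G" "x \<in> carrier E \<Longrightarrow> \<Phi> (J x) = E.canonical_embedding x" for x
    by auto
  have lin: "linear_map E G J"
    unfolding linear_map_def
  proof (intro conjI ballI allI funcsetI J(1))
    fix x y assume x: "x \<in> carrier E" "y \<in> carrier E"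
    show "J (x \<oplus>\<^bsub>E\<^esub> y) = J x \<oplus>\<^bsub>G\<^esub> J y"
      by (rule \<Phi>_inj) (use x in \<open>simp_all add: J linear_map_add[OF \<Phi>_linear] E.canonical_embedding_def dual_add\<close>)
  next
    fix c x assume x: "x \<in> carrier E"
    show "J (c \<odot>\<^bsub>E\<^esub> x) = c \<odot>\<^bsub>G\<^esub> J x"
      by (rule \<Phi>_inj) (use x in \<open>simp_all add: J linear_map_smult[OF \<Phi>_linear] E.canonical_embedding_def dual_smult\<close>)
  qed
  have nrm: "nrm G (J x) \<le> 1 * nrm E x" if "x \<in> carrier E" for x
    using E.canonical_embedding(2)[OF that] \<Phi>_nrm[OF J(1)[OF that]] J(2)[OF that] by simp
  show ?thesis
  proof (rule that[of J])
    show "bounded_linear_map E G J" using lin nrm unfolding bounded_linear_map_def by blast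
    show "op_norm E G J \<le> 1" using nrm by (intro op_norm_le[OF E.normed_space_axioms]) auto
    fix n P x assume P: "P \<in> polynomials n E" and x: "x \<in> carrier E"
    obtain A C where A: "bounded_form n E C A" "0 \<le> C"
      and "\<And>xs ys. xs \<in> tuples n E \<Longrightarrow> ys \<in> tuples n E \<Longrightarrow> mset xs = mset ys \<Longrightarrow> A xs = A ys"
      and PA: "\<And>x. x \<in> carrier E \<Longrightarrow> P x = A (replicate n x)"
      and R: "\<And>x. x \<in> carrier G \<Longrightarrow> comp_on G (AB n E P) \<Phi> x = canonical_ext E A (replicate n (\<Phi> x))"
      by (rule AB_canonical_ext[OF P], rule that)
    show "comp_on G (AB n E P) \<Phi> (J x) = P x"
      using E.canonical_ext_embedding[OF A replicate_tuples[OF x]] R[OF J(1)[OF x]] PA[OF x] J(2)[OF x] by simp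
  qed
qed

end

section \<open>Duals of symmetric tensor products\<close>

lemma sym_tensorsI:
  fixes m :: nat
  shows
  "(\<And>j. j < m \<Longrightarrow> x j \<in> carrier E) \<Longrightarrow> (\<lambda>A. \<Sum>j<m. c j * tensor_power n E (x j) A) \<in> sym_tensors n E"
  unfolding sym_tensors_def by (intro CollectI exI[of _ m] exI[of _ c] exI[of _ x]) simp

lemma sym_tensorsE:
  assumes "z \<in> sym_tensors n E"
  obtains m c x where "\<And>j. j < (m::nat) \<Longrightarrow> x j \<in> carrier E"
    "z = (\<lambda>A. \<Sum>j<m. c j * tensor_power n E (x j) A)"
  using assms unfolding sym_tensors_def by blast

text \<open>A symmetric tensor is a functional on forms, so evaluating it at a form associated with
  \<open>P\<close> yields the sum for every representation at once; hence the value described in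
  \<open>linearization\<close> is unique.\<close>

lemma linearization_eq:
  fixes m :: nat
  assumes P: "P \<in> polynomials n E" and x: "\<And>j. j < m \<Longrightarrow> x j \<in> carrier E"
  shows "linearization n E P (\<lambda>A. \<Sum>j<m. c j * tensor_power n E (x j) A) = (\<Sum>j<m. c j * P (x j))"
proof -
  obtain A where A: "associated_form n E P A" using P by (auto simp: polynomials_def)
  have val: "(\<Sum>j<k. d j * tensor_power n E (y j) A) = (\<Sum>j<k. d j * P (y j))"
    if "\<forall>j<k. y j \<in> carrier E" for k :: nat and d y
    using that by (intro sum.cong) (simp_all add: tensor_power_def associated_form_multilinear[OF A] associated_form_diag[OF A])
  show ?thesis unfolding linearization_def
  proof (rule the_equality)
    show "\<exists>(k::nat) d y. (\<forall>j<k. y j \<in> carrier E) \<and>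
        (\<lambda>A. \<Sum>j<m. c j * tensor_power n E (x j) A) = (\<lambda>A. \<Sum>j<k. d j * tensor_power n E (y j) A) \<and>
        (\<Sum>j<m. c j * P (x j)) = (\<Sum>j<k. d j * P (y j))"
      using x by (intro exI[of _ m] exI[of _ c] exI[of _ x]) simp
    fix v assume "\<exists>(k::nat) d y. (\<forall>j<k. y j \<in> carrier E) \<and>
        (\<lambda>A. \<Sum>j<m. c j * tensor_power n E (x j) A) = (\<lambda>A. \<Sum>j<k. d j * tensor_power n E (y j) A) \<and>
        v = (\<Sum>j<k. d j * P (y j))"
    then obtain k :: nat and d y where y: "\<forall>j<k. y j \<in> carrier E"
      "(\<lambda>A. \<Sum>j<m. c j * tensor_power n E (x j) A) = (\<lambda>A. \<Sum>j<k. d j * tensor_power n E (y j) A)"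
      "v = (\<Sum>j<k. d j * P (y j))" by blast
    show "v = (\<Sum>j<m. c j * P (x j))"
      using fun_cong[OF y(2), of A] val[OF y(1), of d] val[of m x c] x y(3) by simp
  qed
qed

text \<open>Being evaluation at a form, the linearization is visibly linear in
  \<open>z\<close>.\<close>

lemma linearization_eval:
  assumes A: "associated_form n E P A" and P: "P \<in> polynomials n E" and z: "z \<in> sym_tensors n E"
  shows "linearization n E P z = z A"
proof -
  obtain m :: nat and c x where x: "\<And>j. j < m \<Longrightarrow> x j \<in> carrier E" and z: "z = (\<lambda>A. \<Sum>j<m. c j * tensor_power n E (x j) A)"
    by (rule sym_tensorsE[OF z], rule that[rotated])
  have "linearization n E P z = (\<Sum>j<m. c j * P (x j))" unfolding z by (rule linearization_eq[OF P x])
  also have "\<dots> = z A"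
    unfolding z using x by (intro sum.cong) (simp_all add: tensor_power_def associated_form_multilinear[OF A] associated_form_diag[OF A])
  finally show ?thesis .
qed

section \<open>Induced maps of symmetric tensors\<close>

lemma multilinear_form_map:
  assumes T: "linear_map E F T" and A: "multilinear_form n F A"
  shows "multilinear_form n E (\<lambda>xs. A (map T xs))"
  unfolding multilinear_form_def
proof (intro ballI allI impI)
  fix xs i assume xs: "xs \<in> tuples n E" and i: "i < n"
  have "map T xs \<in> tuples n F" using xs linear_map_cl[OF T] by (rule map_tuples)
  then have "linear_map F scalar_space (\<lambda>y. A ((map T xs)[i := y]))"
    using A i unfolding multilinear_form_def by blast
  then show "linear_map E scalar_space (\<lambda>y. A (map T (xs[i := y])))"
    using linear_mapD[OF T] by (simp add: map_update linear_form_iff)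
qed

lemma tensor_map_eq:
  fixes m :: nat
  assumes "linear_map E F T"
  shows "tensor_map n F T (\<lambda>A. \<Sum>j<m. c j * tensor_power n E (x j) A) =
    (\<lambda>A. \<Sum>j<m. c j * tensor_power n F (T (x j)) A)"
  using multilinear_form_map[OF assms]
  by (auto simp: tensor_map_def tensor_power_def map_replicate)

lemma tensor_map_sym_tensors:
  assumes T: "linear_map E F T" and "z \<in> sym_tensors n E"
  shows "tensor_map n F T z \<in> sym_tensors n F"
proof -
  obtain m :: nat and c x where x: "\<And>j. j < m \<Longrightarrow> x j \<in> carrier E" and z: "z = (\<lambda>A. \<Sum>j<m. c j * tensor_power n E (x j) A)"
    by (rule sym_tensorsE[OF assms(2)], rule that[rotated])
  show ?thesis unfolding z tensor_map_eq[OF T] by (intro sym_tensorsI linear_map_cl[OF T] x)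
qed

lemma s_tensor_normD:
  assumes "s_tensor_norm n \<alpha>"
  shows s_tensor_norm_space: "normed_space E \<Longrightarrow> normed_space (fun_space (sym_tensors n E) (\<alpha> E))"
    and s_tensor_norm_map: "normed_space E \<Longrightarrow> normed_space F \<Longrightarrow> bounded_linear_map E F T \<Longrightarrow>
      w \<in> sym_tensors n E \<Longrightarrow> \<alpha> F (tensor_map n F T w) \<le> op_norm E F T ^ n * \<alpha> E w"
  using assms unfolding s_tensor_norm_def by blast+

lemma tensor_dual_norm_op_norm:
  "tensor_dual_norm \<alpha> n E P = op_norm (fun_space (sym_tensors n E) (\<alpha> E)) scalar_space (linearization n E P)"
  by (simp add: tensor_dual_norm_def op_norm_def)

lemma bounded_linear_linearization:
  assumes P: "P \<in> tensor_dual \<alpha> n E" and sp: "normed_space (fun_space (sym_tensors n E) (\<alpha> E))"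
  shows "bounded_linear_map (fun_space (sym_tensors n E) (\<alpha> E)) scalar_space (linearization n E P)"
proof -
  have pol: "P \<in> polynomials n E" using P by (simp add: tensor_dual_def)
  then obtain A where A: "associated_form n E P A" by (auto simp: polynomials_def)
  interpret S: normed_space "fun_space (sym_tensors n E) (\<alpha> E)" by fact
  have "linear_map (fun_space (sym_tensors n E) (\<alpha> E)) scalar_space (\<lambda>z. z A)"
    by (simp add: linear_form_iff)
  moreover have "linearization n E P z = z A" if "z \<in> sym_tensors n E" for z
    by (rule linearization_eval[OF A pol that])
  ultimately show ?thesis
    using P S.M.a_closed S.smult_cl
    by (auto simp: bounded_linear_map_def tensor_dual_def linear_form_iff)
qed

context bidual_iso
begin

text \<open>Finite generation reduces the estimate to a representation of \<open>z\<close> in some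
  \<open>M\<close>. Transporting it to \<open>E\<close> by an approximating \<open>T\<close> costs a
  factor \<open>(1 + \<epsilon>) ^ n\<close> through the metric mapping property, and replacing
  \<open>R (x j)\<close> by \<open>P (T (x j))\<close> costs \<open>\<epsilon>\<close> times the sum
  of the moduli of the coefficients; then \<open>\<epsilon>\<close> tends to 0.\<close>

lemma linearization_AB_le:
  fixes \<alpha> :: "('k, 'u) tensor_norm"
  assumes \<alpha>: "s_tensor_norm n \<alpha>" "finitely_generated n \<alpha>" and G: "banach_space G"
    and P: "P \<in> polynomials n E" and K: "0 \<le> K" "\<And>z. z \<in> sym_tensors n E \<Longrightarrow> norm (linearization n E P z) \<le> K * \<alpha> E z"
    and z: "z \<in> sym_tensors n G"
  shows "norm (linearization n G (comp_on G (AB n E P) \<Phi>) z) \<le> K * \<alpha> G z"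
proof -
  define R where "R = comp_on G (AB n E P) \<Phi>"
  have R: "R \<in> polynomials n G" unfolding R_def by (rule AB_polynomial[OF P])
  define S where "S = {\<alpha> M w | M w. M \<in> FIN G \<and> w \<in> sym_tensors n M \<and> tensor_map n G (\<lambda>x. x) w = z}"
  have incl: "linear_map M G (\<lambda>x. x)" if "M \<in> FIN G" for M
    using G.FIN_subset[OF that] by (auto simp: linear_map_def FIN_simps[OF that])
  have Inf: "\<alpha> G z = Inf S" using \<alpha>(2) G z unfolding finitely_generated_def S_def by blast
  \<comment> \<open>The infimum of an empty set of reals carries no information, so some
    \<open>M\<close> has to be exhibited: one containing the vectors of a representation of
    \<open>z\<close>.\<close>
  have ne: "S \<noteq> {}"
  proof -
    obtain m :: nat and c x where x: "\<And>j. j < m \<Longrightarrow> x j \<in> carrier G" and zeq: "z = (\<lambda>A. \<Sum>j<m. c j * tensor_power n G (x j) A)"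
      by (rule sym_tensorsE[OF z], rule that[rotated])
    obtain M where M: "M \<in> FIN G" "x ` {..<m} \<subseteq> carrier M"
      by (rule G.FIN_containing[of "x ` {..<m}"]) (use x in auto)
    have "(\<lambda>A. \<Sum>j<m. c j * tensor_power n M (x j) A) \<in> sym_tensors n M"
      by (rule sym_tensorsI) (use M in auto)
    moreover have "tensor_map n G (\<lambda>x. x) (\<lambda>A. \<Sum>j<m. c j * tensor_power n M (x j) A) = z"
      unfolding zeq by (rule tensor_map_eq[OF incl[OF M(1)]])
    ultimately show ?thesis unfolding S_def using M(1) by blast
  qed
  have le: "norm (linearization n G R z) \<le> K * s" if "s \<in> S" for s
  proof -
    obtain M w where M: "M \<in> FIN G" and w: "w \<in> sym_tensors n M" "tensor_map n G (\<lambda>x. x) w = z" and s: "s = \<alpha> M w"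
      using \<open>s \<in> S\<close> by (auto simp: S_def)
    note nM = G.normed_space_FIN[OF M]
    obtain m :: nat and c x where x: "\<And>j. j < m \<Longrightarrow> x j \<in> carrier M" and weq: "w = (\<lambda>A. \<Sum>j<m. c j * tensor_power n M (x j) A)"
      by (rule sym_tensorsE[OF w(1)], rule that[rotated])
    have xG: "j < m \<Longrightarrow> x j \<in> carrier G" for j using x G.FIN_subset[OF M] by blast
    have zeq: "z = (\<lambda>A. \<Sum>j<m. c j * tensor_power n G (x j) A)"
      unfolding w(2)[symmetric] weq by (rule tensor_map_eq[OF incl[OF M]])
    have s0: "0 \<le> s"
      using normed_space.nrm_nonneg[OF s_tensor_norm_space[OF \<alpha>(1) nM], of w] w(1) by (simp add: s)
    \<comment> \<open>The representation is fixed before \<open>\<epsilon>\<close>, so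
      \<open>L\<close> is independent of \<open>\<epsilon>\<close>.\<close>
    define L where "L = (\<Sum>j<m. norm (c j))"
    have step: "norm (linearization n G R z) \<le> K * ((1 + \<epsilon>) ^ n * s) + \<epsilon> * L" if \<epsilon>: "\<epsilon> > 0" for \<epsilon>
    proof -
      have X: "finite (x ` {..<m})" "x ` {..<m} \<subseteq> carrier M" using x by auto
      obtain T where T: "bounded_linear_map M E T" "op_norm M E T \<le> 1 + \<epsilon>"
        and app: "\<And>y. y \<in> x ` {..<m} \<Longrightarrow> norm (P (T y) - R y) \<le> \<epsilon>"
        by (rule AB_approx[OF P M X \<epsilon>, folded R_def], rule that)
      have Tl: "linear_map M E T" using T(1) by (simp add: bounded_linear_map_def)
      have lin_T: "linearization n E P (tensor_map n E T w) = (\<Sum>j<m. c j * P (T (x j)))"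
        unfolding weq tensor_map_eq[OF Tl] by (rule linearization_eq[OF P linear_map_cl[OF Tl x]])
      have "norm (linearization n E P (tensor_map n E T w)) \<le> K * \<alpha> E (tensor_map n E T w)"
        by (rule K(2)[OF tensor_map_sym_tensors[OF Tl w(1)]])
      also have "\<dots> \<le> K * (op_norm M E T ^ n * s)"
        unfolding s by (intro mult_left_mono K(1) s_tensor_norm_map[OF \<alpha>(1)] nM E.normed_space_axioms T(1) w(1))
      also have "\<dots> \<le> K * ((1 + \<epsilon>) ^ n * s)"
        by (intro mult_left_mono mult_right_mono power_mono T(2) K(1) s0 op_norm_nonneg[OF nM E.normed_space_axioms T(1)])
      finally have 1: "norm (\<Sum>j<m. c j * P (T (x j))) \<le> K * ((1 + \<epsilon>) ^ n * s)" by (simp only: lin_T)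
      have "(\<Sum>j<m. c j * P (T (x j))) - (\<Sum>j<m. c j * R (x j)) = (\<Sum>j<m. c j * (P (T (x j)) - R (x j)))"
        by (simp add: sum_subtractf right_diff_distrib)
      also have "norm \<dots> \<le> (\<Sum>j<m. norm (c j) * \<epsilon>)"
        by (rule order_trans[OF norm_sum], rule sum_mono) (auto simp: norm_mult intro!: mult_left_mono app)
      also have "\<dots> = \<epsilon> * L" by (simp add: L_def sum_distrib_left mult.commute)
      finally have 2: "norm ((\<Sum>j<m. c j * P (T (x j))) - (\<Sum>j<m. c j * R (x j))) \<le> \<epsilon> * L" .
      have "linearization n G R z = (\<Sum>j<m. c j * R (x j))"
        unfolding zeq by (rule linearization_eq[OF R xG])
      then show ?thesis
        using 1 2 norm_triangle_sub[of "\<Sum>j<m. c j * R (x j)" "\<Sum>j<m. c j * P (T (x j))"]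
        by (simp add: norm_minus_commute)
    qed
    have "((\<lambda>\<epsilon>. K * ((1 + \<epsilon>) ^ n * s) + \<epsilon> * L) \<longlongrightarrow> K * ((1 + 0) ^ n * s) + 0 * L) (at_right 0)"
      by (intro tendsto_intros)
    moreover have "\<forall>\<^sub>F \<epsilon> in at_right 0. norm (linearization n G R z) \<le> K * ((1 + \<epsilon>) ^ n * s) + \<epsilon> * L"
      using step by (auto simp: eventually_at_right_field intro: exI[of _ 1])
    ultimately have "norm (linearization n G R z) \<le> K * ((1 + 0) ^ n * s) + 0 * L"
      by (rule tendsto_lowerbound) simp
    then show ?thesis by simp
  qed
  \<comment> \<open>The bound is moved to the infimum by dividing by \<open>K\<close>, which leaves
    the case \<open>K = 0\<close> apart.\<close>
  show ?thesis unfolding R_def[symmetric]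
  proof (cases "K = 0")
    case True
    then show "norm (linearization n G R z) \<le> K * \<alpha> G z" using ne le by auto
  next
    case False
    then have Kpos: "K > 0" using K(1) by simp
    have "norm (linearization n G R z) / K \<le> Inf S"
      using le Kpos by (intro cInf_greatest[OF ne]) (simp add: field_simps)
    then show "norm (linearization n G R z) \<le> K * \<alpha> G z" using Kpos Inf by (simp add: field_simps)
  qed
qed

text \<open>One inequality is the preceding estimate. For the other, a tensor over \<open>E\<close>
  is sent to \<open>G\<close> by the canonical embedding \<open>J\<close>, which has norm at most 1
  and along which \<open>R\<close> restricts to \<open>P\<close>.\<close>

theorem tensor_dual_AB:
  fixes \<alpha> :: "('k, 'u) tensor_norm"
  assumes \<alpha>: "s_tensor_norm n \<alpha>" "finitely_generated n \<alpha>" and G: "banach_space G"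
    and P: "P \<in> tensor_dual \<alpha> n E"
  shows "comp_on G (AB n E P) \<Phi> \<in> tensor_dual \<alpha> n G"
    and "tensor_dual_norm \<alpha> n E P = tensor_dual_norm \<alpha> n G (comp_on G (AB n E P) \<Phi>)"
proof -
  define R where "R = comp_on G (AB n E P) \<Phi>"
  have pol: "P \<in> polynomials n E" using P by (simp add: tensor_dual_def)
  have Rpol: "R \<in> polynomials n G" unfolding R_def by (rule AB_polynomial[OF pol])
  note spE = s_tensor_norm_space[OF \<alpha>(1) E.normed_space_axioms]
    and spG = s_tensor_norm_space[OF \<alpha>(1) G.normed_space_axioms]
  note blP = bounded_linear_linearization[OF P spE]
  note op0 = op_norm_nonneg[OF _ normed_space_scalar_space]
  have P_le: "norm (linearization n E P z) \<le> tensor_dual_norm \<alpha> n E P * \<alpha> E z" if "z \<in> sym_tensors n E" for z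
    using op_norm_bound[OF spE normed_space_scalar_space blP, of z] that by (simp add: tensor_dual_norm_op_norm)
  have P0: "0 \<le> tensor_dual_norm \<alpha> n E P"
    unfolding tensor_dual_norm_op_norm by (rule op0[OF spE blP])
  have R_le: "norm (linearization n G R z) \<le> tensor_dual_norm \<alpha> n E P * \<alpha> G z" if "z \<in> sym_tensors n G" for z
    unfolding R_def by (rule linearization_AB_le[OF \<alpha> G pol P0 P_le that])
  show Rdual: "comp_on G (AB n E P) \<Phi> \<in> tensor_dual \<alpha> n G"
    unfolding R_def[symmetric] using Rpol R_le by (auto simp: tensor_dual_def)
  note blR = bounded_linear_linearization[OF Rdual[folded R_def] spG]
  have le1: "tensor_dual_norm \<alpha> n G R \<le> tensor_dual_norm \<alpha> n E P"
    unfolding tensor_dual_norm_op_norm[of \<alpha> n G]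
    by (rule op_norm_le[OF spG P0]) (use R_le in simp)
  obtain J where J: "bounded_linear_map E G J" "op_norm E G J \<le> 1"
    and RJ: "\<And>n P x. P \<in> polynomials n E \<Longrightarrow> x \<in> carrier E \<Longrightarrow> comp_on G (AB n E P) \<Phi> (J x) = P x"
    by (rule embedding, rule that)
  have Jl: "linear_map E G J" using J(1) by (simp add: bounded_linear_map_def)
  have R0: "0 \<le> tensor_dual_norm \<alpha> n G R"
    unfolding tensor_dual_norm_op_norm by (rule op0[OF spG blR])
  have le2: "tensor_dual_norm \<alpha> n E P \<le> tensor_dual_norm \<alpha> n G R"
    unfolding tensor_dual_norm_op_norm[of \<alpha> n E]
  proof (rule op_norm_le[OF spE R0])
    fix z assume "z \<in> carrier (fun_space (sym_tensors n E) (\<alpha> E))"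
    then have z: "z \<in> sym_tensors n E" by simp
    obtain m :: nat and c x where x: "\<And>j. j < m \<Longrightarrow> x j \<in> carrier E" and zeq: "z = (\<lambda>A. \<Sum>j<m. c j * tensor_power n E (x j) A)"
      by (rule sym_tensorsE[OF z], rule that[rotated])
    have Jz: "tensor_map n G J z \<in> sym_tensors n G" by (rule tensor_map_sym_tensors[OF Jl z])
    have "linearization n G R (tensor_map n G J z) = (\<Sum>j<m. c j * R (J (x j)))"
      unfolding zeq tensor_map_eq[OF Jl] by (rule linearization_eq[OF Rpol linear_map_cl[OF Jl x]])
    also have "\<dots> = (\<Sum>j<m. c j * P (x j))"
      unfolding R_def by (intro sum.cong refl) (simp only: RJ[OF pol x] lessThan_iff)
    also have "\<dots> = linearization n E P z"
      unfolding zeq by (rule linearization_eq[OF pol x, symmetric])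
    finally have "norm (linearization n E P z) = norm (linearization n G R (tensor_map n G J z))" by simp
    also have "\<dots> \<le> tensor_dual_norm \<alpha> n G R * \<alpha> G (tensor_map n G J z)"
      using op_norm_bound[OF spG normed_space_scalar_space blR, of "tensor_map n G J z"] Jz
      by (simp add: tensor_dual_norm_op_norm)
    also have "\<dots> \<le> tensor_dual_norm \<alpha> n G R * (op_norm E G J ^ n * \<alpha> E z)"
      by (intro mult_left_mono R0 s_tensor_norm_map[OF \<alpha>(1)] E.normed_space_axioms G.normed_space_axioms J(1) z)
    also have "\<dots> \<le> tensor_dual_norm \<alpha> n G R * (1 * \<alpha> E z)"
    proof (intro mult_left_mono mult_right_mono R0)
      show "op_norm E G J ^ n \<le> 1"
        by (intro power_le_one J(2) op_norm_nonneg[OF E.normed_space_axioms G.normed_space_axioms J(1)])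
      show "0 \<le> \<alpha> E z" using normed_space.nrm_nonneg[OF spE, of z] z by simp
    qed
    finally show "nrm scalar_space (linearization n E P z) \<le>
        tensor_dual_norm \<alpha> n G R * nrm (fun_space (sym_tensors n E) (\<alpha> E)) z" by simp
  qed
  show "tensor_dual_norm \<alpha> n E P = tensor_dual_norm \<alpha> n G (comp_on G (AB n E P) \<Phi>)"
    using le1 le2 by (simp add: R_def)
qed

end

section \<open>Maximal polynomial ideals\<close>

context bidual_copy
begin

text \<open>The coordinates \<open>\<Phi> x z\<close> are Lipschitz in \<open>x\<close>, so they
  converge along a Cauchy sequence, and the combination with the limiting coefficients is the limit.
  This admits \<open>M\<close> to the ideal axioms, which speak of Banach spaces.\<close>

lemma banach_space_FIN:
  assumes M: "M \<in> FIN G"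
  shows "banach_space M"
proof -
  interpret M: normed_space M by (rule G.normed_space_FIN[OF M])
  note MG = subsetD[OF G.FIN_subset[OF M]] and simps = FIN_simps[OF M]
  obtain Z b where Z: "finite Z" "Z \<subseteq> carrier (dual E)" "\<And>z. z \<in> Z \<Longrightarrow> b z \<in> carrier M"
    and exp: "\<And>x. x \<in> carrier M \<Longrightarrow> x = lincomb G Z (\<Phi> x) b"
    and exp\<Phi>: "\<And>x f. x \<in> carrier M \<Longrightarrow> \<Phi> x f = (\<Sum>z\<in>Z. \<Phi> x z * \<Phi> (b z) f)"
    by (rule FIN_coordinates[OF M], rule that)
  have bG: "z \<in> Z \<Longrightarrow> b z \<in> carrier G" for z using Z(3) MG by blast
  show ?thesis
  proof (intro banach_space.intro banach_space_axioms.intro M.normed_space_axioms)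
    fix s :: "nat \<Rightarrow> 'w"
    assume s: "\<And>j. s j \<in> carrier M"
      and cau: "\<And>e. e > 0 \<Longrightarrow> \<exists>N. \<forall>p\<ge>N. \<forall>q\<ge>N. nrm M (s p \<ominus>\<^bsub>M\<^esub> s q) < e"
    have "\<exists>l. (\<lambda>j. \<Phi> (s j) z) \<longlonglongrightarrow> l" if z: "z \<in> Z" for z
    proof (rule rc_field_Cauchy_convergent)
      fix e :: real assume e: "e > 0"
      define K where "K = op_norm E scalar_space z + 1"
      have zE: "z \<in> carrier (dual E)" using z Z(2) by blast
      have K: "K > 0" using E.dual_nonneg[OF zE] by (simp add: K_def)
      obtain N where N: "\<forall>p\<ge>N. \<forall>q\<ge>N. nrm M (s p \<ominus>\<^bsub>M\<^esub> s q) < e / K"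
        using cau[of "e / K"] e K by auto
      have "norm (\<Phi> (s p) z - \<Phi> (s q) z) < e" if "p \<ge> N" "q \<ge> N" for p q
      proof -
        have d: "s p \<ominus>\<^bsub>G\<^esub> s q \<in> carrier G" using MG[OF s] by simp
        have "norm (\<Phi> (s p) z - \<Phi> (s q) z) = norm (\<Phi> (s p \<ominus>\<^bsub>G\<^esub> s q) z)"
          by (simp add: G.linear_form_diff[OF \<Phi>_form MG[OF s] MG[OF s]])
        also have "\<dots> \<le> nrm G (s p \<ominus>\<^bsub>G\<^esub> s q) * op_norm E scalar_space z"
          by (rule \<Phi>_bound[OF d zE])
        also have "\<dots> \<le> nrm G (s p \<ominus>\<^bsub>G\<^esub> s q) * K"
          using d by (intro mult_left_mono) (simp_all add: K_def)
        also have "nrm G (s p \<ominus>\<^bsub>G\<^esub> s q) * K < e / K * K"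
          using N that K by (intro mult_strict_right_mono) (auto simp: G.a_minus_FIN[OF M s s] simps(4))
        finally show ?thesis using K by simp
      qed
      then show "\<exists>N. \<forall>p\<ge>N. \<forall>q\<ge>N. norm (\<Phi> (s p) z - \<Phi> (s q) z) < e" by blast
    qed
    then obtain l where l: "\<And>z. z \<in> Z \<Longrightarrow> (\<lambda>j. \<Phi> (s j) z) \<longlonglongrightarrow> l z" by metis
    define L where "L = lincomb M Z l b"
    have L: "L \<in> carrier M" using Z(3) by (auto simp: L_def)
    have "(\<lambda>j. nrm M (s j \<ominus>\<^bsub>M\<^esub> L)) \<longlonglongrightarrow> 0"
    proof (rule tendsto_sandwich)
      show "\<forall>\<^sub>F j in sequentially. 0 \<le> nrm M (s j \<ominus>\<^bsub>M\<^esub> L)" using s L by simp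
      have "nrm M (s j \<ominus>\<^bsub>M\<^esub> L) \<le> (\<Sum>z\<in>Z. norm (\<Phi> (s j) z - l z) * nrm M (b z))" for j
      proof -
        have sj: "lincomb M Z (\<Phi> (s j)) b = s j"
          by (rule trans[OF G.lincomb_FIN[OF M Z(1,3)] exp[OF s, symmetric]])
        define d where "d = lincomb M Z (\<lambda>z. \<Phi> (s j) z - l z) b"
        have d: "d \<in> carrier M" using Z(3) by (auto simp: d_def)
        have "s j = L \<oplus>\<^bsub>M\<^esub> d"
          using M.lincomb_add[OF Z(1,3), where c=l and d="\<lambda>z. \<Phi> (s j) z - l z"] sj by (simp add: L_def d_def)
        then have "s j \<ominus>\<^bsub>M\<^esub> L = d"
          using L d M.M.a_comm[OF L d] by (simp add: a_minus_def M.M.a_assoc M.M.r_neg)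
        then have "s j \<ominus>\<^bsub>M\<^esub> L = lincomb M Z (\<lambda>z. \<Phi> (s j) z - l z) b" by (simp only: d_def)
        then show ?thesis using M.nrm_lincomb_le[OF Z(1,3)] by simp
      qed
      then show "\<forall>\<^sub>F j in sequentially. nrm M (s j \<ominus>\<^bsub>M\<^esub> L) \<le> (\<Sum>z\<in>Z. norm (\<Phi> (s j) z - l z) * nrm M (b z))"
        by simp
      have "(\<lambda>j. \<Sum>z\<in>Z. norm (\<Phi> (s j) z - l z) * nrm M (b z)) \<longlonglongrightarrow> (\<Sum>z\<in>Z. norm (l z - l z) * nrm M (b z))"
        by (intro tendsto_intros l)
      then show "(\<lambda>j. \<Sum>z\<in>Z. norm (\<Phi> (s j) z - l z) * nrm M (b z)) \<longlonglongrightarrow> 0" by simp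
    qed simp
    then show "\<exists>l\<in>carrier M. (\<lambda>j. nrm M (s j \<ominus>\<^bsub>M\<^esub> l)) \<longlonglongrightarrow> 0" using L by blast
  qed
qed

text \<open>Expanding the form in the coordinates \<open>\<Phi> x z\<close> exhibits the polynomial
  as a combination of monomials, the products of \<open>n\<close> coordinates. They are cut off
  outside \<open>M\<close>, where polynomials vanish.\<close>

lemma polynomials_FIN_span:
  assumes M: "M \<in> FIN G"
  obtains I :: "('v \<Rightarrow> 'k) list set" and mon where "finite I"
    "\<And>g. g \<in> polynomials n M \<Longrightarrow> \<exists>c. \<forall>x. g x = (\<Sum>i\<in>I. c i * mon i x)"
proof -
  interpret M: normed_space M by (rule G.normed_space_FIN[OF M])
  obtain Z b where Z: "finite Z" "Z \<subseteq> carrier (dual E)" "\<And>z. z \<in> Z \<Longrightarrow> b z \<in> carrier M"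
    and exp: "\<And>x. x \<in> carrier M \<Longrightarrow> x = lincomb G Z (\<Phi> x) b"
    and exp\<Phi>: "\<And>x f. x \<in> carrier M \<Longrightarrow> \<Phi> x f = (\<Sum>z\<in>Z. \<Phi> x z * \<Phi> (b z) f)"
    by (rule FIN_coordinates[OF M], rule that)
  define I where "I = {ks. set ks \<subseteq> Z \<and> length ks = n}"
  define mon where "mon ks x = (if x \<in> carrier M then prod_list (map (\<Phi> x) ks) else 0)" for ks x
  show ?thesis
  proof (rule that[of I mon])
    show "finite I" unfolding I_def using Z(1) by (rule finite_lists_length_eq)
    fix g assume g: "g \<in> polynomials n M"
    then obtain B where B: "associated_form n M g B" by (auto simp: polynomials_def)
    have "g x = (\<Sum>i\<in>I. B (map b i) * mon i x)" for x
    proof (cases "x \<in> carrier M")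
      case True
      have "lincomb M Z (\<Phi> x) b = x"
        by (rule trans[OF G.lincomb_FIN[OF M Z(1,3)] exp[OF True, symmetric]])
      then have "g x = B (replicate n (lincomb M Z (\<Phi> x) b))" using associated_form_diag[OF B True] by (simp only:)
      also have "\<dots> = (\<Sum>i\<in>I. prod_list (map (\<Phi> x) i) * B (map b i))"
        unfolding I_def by (rule M.multilinear_form_lincomb[OF associated_form_multilinear[OF B] Z(1,3)])
      finally show ?thesis using True by (simp add: mon_def mult.commute)
    next
      case False
      then show ?thesis using g by (simp add: polynomials_def vanishing_off_def mon_def)
    qed
    then show "\<exists>c. \<forall>x. g x = (\<Sum>i\<in>I. c i * mon i x)"
      by (intro exI[of _ "\<lambda>i. B (map b i)"] allI)
  qed
qed

end

context bidual_iso
begin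

text \<open>On a finite-dimensional \<open>M\<close> the values at finitely many points determine the members of
  \<open>Q M\<close>, so pointwise convergence of \<open>P \<circ> T\<close> implies convergence in the norm of \<open>Q M\<close>.\<close>

lemma ideal_norm_AB_FIN:
  assumes Q: "banach_polynomial_ideal n Q q" and E: "banach_space E" and P: "P \<in> Q E" and M: "M \<in> FIN G"
  shows "q M (comp_on M (comp_on G (AB n E P) \<Phi>) (\<lambda>x. x)) \<le> q E P"
proof -
  interpret M: normed_space M by (rule G.normed_space_FIN[OF M])
  define R where "R = comp_on G (AB n E P) \<Phi>"
  define r where "r = comp_on M R (\<lambda>x. x)"
  have bM: "banach_space M" by (rule banach_space_FIN[OF M])
  have QM: "Q M \<subseteq> polynomials n M" "banach_space (fun_space (Q M) (q M))"
    and QE: "Q E \<subseteq> polynomials n E" "banach_space (fun_space (Q E) (q E))"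
    using Q bM E unfolding banach_polynomial_ideal_def by blast+
  have pol: "P \<in> polynomials n E" using P QE by blast
  interpret QE: normed_space "fun_space (Q E) (q E)" by (rule banach_space.axioms(1)[OF QE(2)])
  interpret QM: normed_space "fun_space (Q M) (q M)" by (rule banach_space.axioms(1)[OF QM(2)])
  have sub: "fun_subspace (Q M)" by (rule fun_subspace_carrier[OF QM.vspace_axioms])
  have q0: "0 \<le> q E P" using QE.nrm_nonneg[of P] P by simp
  obtain I :: "('u \<Rightarrow> 'k) list set" and mon where I: "finite I"
    "\<And>g. g \<in> polynomials n M \<Longrightarrow> \<exists>c. \<forall>x. g x = (\<Sum>i\<in>I. c i * mon i x)"
    by (rule polynomials_FIN_span[OF M, of n], rule that)
  have span: "\<exists>c. \<forall>x. g x = (\<Sum>i\<in>I. c i * mon i x)" if "g \<in> Q M" for g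
    using that QM(1) I(2) by blast
  have off: "g x = 0" if "g \<in> Q M" "x \<notin> carrier M" for g x
    using that QM(1) by (auto simp: polynomials_def vanishing_off_def)
  obtain Y e where Y: "finite Y" "Y \<subseteq> carrier M" and e: "\<And>y. y \<in> Y \<Longrightarrow> e y \<in> Q M"
    and interp: "\<And>g x. g \<in> Q M \<Longrightarrow> g x = (\<Sum>y\<in>Y. g y * e y x)"
    by (rule finite_interpolation[where b=mon and X="carrier M", OF sub I(1)], erule span, erule (1) off, rule that)
  \<comment> \<open>The ideal property puts the composition of \<open>P\<close> with
    \<open>T\<close> into \<open>Q M\<close> with almost the right norm, but it is known to be close
    to \<open>r\<close> only at the prescribed points.\<close>
  have approx: "\<exists>g\<in>Q M. q M g \<le> q E P * (1 + \<epsilon>) ^ n \<and> (\<forall>x\<in>X. norm (g x - r x) \<le> \<epsilon>)"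
    if X: "finite X" "X \<subseteq> carrier M" and \<epsilon>: "\<epsilon> > 0" for X \<epsilon>
  proof -
    obtain T where T: "bounded_linear_map M E T" "op_norm M E T \<le> 1 + \<epsilon>"
      and app: "\<And>y. y \<in> X \<Longrightarrow> norm (P (T y) - R y) \<le> \<epsilon>"
      by (rule AB_approx[OF pol M X \<epsilon>, folded R_def], rule that)
    have "comp_on M P T \<in> Q M" "q M (comp_on M P T) \<le> q E P * op_norm M E T ^ n"
      using Q bM E T(1) P unfolding banach_polynomial_ideal_def by blast+
    moreover have "q E P * op_norm M E T ^ n \<le> q E P * (1 + \<epsilon>) ^ n"
      by (intro mult_left_mono power_mono T(2) q0 op_norm_nonneg[OF M.normed_space_axioms E.normed_space_axioms T(1)])
    moreover have "norm (comp_on M P T x - r x) \<le> \<epsilon>" if "x \<in> X" for x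
      using app[OF that] X(2) that by (auto simp: r_def)
    ultimately show ?thesis by (intro bexI[of _ "comp_on M P T"]) auto
  qed
  \<comment> \<open>\<open>r\<close> is not yet known to lie in \<open>Q M\<close>. The
    interpolation identity persists under pointwise limits, so it is tested on \<open>Y\<close> and
    at the single point \<open>x\<close>; membership then follows from it.\<close>
  have r_eq: "r x = (\<Sum>y\<in>Y. r y * e y x)" for x
  proof (cases "x \<in> carrier M")
    case False
    then show ?thesis using off[OF e False] by (simp add: r_def comp_on_def)
  next
    case True
    \<comment> \<open>The error at \<open>x\<close> counts once and the errors on \<open>Y\<close>
      with the weights \<open>norm (e y x)\<close>, so \<open>\<delta> / L\<close> at each point
      adds up to \<open>\<delta>\<close>.\<close>
    define L where "L = 1 + (\<Sum>y\<in>Y. norm (e y x))"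
    have L: "L > 0" unfolding L_def by (intro add_pos_nonneg sum_nonneg) auto
    have "norm (r x - (\<Sum>y\<in>Y. r y * e y x)) \<le> 0 + \<delta>" if \<delta>: "\<delta> > 0" for \<delta>
    proof -
      have \<epsilon>: "\<delta> / L > 0" using \<delta> L by simp
      obtain g where g: "g \<in> Q M" "\<forall>y\<in>insert x Y. norm (g y - r y) \<le> \<delta> / L"
        using approx[OF _ _ \<epsilon>, of "insert x Y"] Y True by auto
      have "r x - (\<Sum>y\<in>Y. r y * e y x) = (r x - g x) + (\<Sum>y\<in>Y. (g y - r y) * e y x)"
        using interp[OF g(1), of x] by (simp add: left_diff_distrib sum_subtractf)
      also have "norm \<dots> \<le> \<delta> / L + (\<Sum>y\<in>Y. \<delta> / L * norm (e y x))"
      proof (rule order_trans[OF norm_triangle_ineq add_mono])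
        show "norm (r x - g x) \<le> \<delta> / L" using g(2) by (simp add: norm_minus_commute)
        show "norm (\<Sum>y\<in>Y. (g y - r y) * e y x) \<le> (\<Sum>y\<in>Y. \<delta> / L * norm (e y x))"
          by (rule order_trans[OF norm_sum], rule sum_mono, unfold norm_mult, rule mult_right_mono) (use g(2) in auto)
      qed
      also have "\<dots> = \<delta> / L * L" by (simp add: L_def sum_distrib_left distrib_left)
      finally show ?thesis using L by simp
    qed
    then have "norm (r x - (\<Sum>y\<in>Y. r y * e y x)) \<le> 0" by (rule field_le_epsilon)
    then show ?thesis by simp
  qed
  have r_fun: "r = (\<lambda>x. \<Sum>y\<in>Y. r y * e y x)" by (rule ext) (rule r_eq)
  have rQ: "r \<in> Q M" by (subst r_fun) (intro fun_subspace_sum[OF sub Y(1)] e)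
  \<comment> \<open>Converts an error of \<open>\<epsilon>\<close> at the points of \<open>Y\<close>
    into an error of \<open>\<epsilon> * L\<close> in the norm of \<open>Q M\<close>.\<close>
  define L where "L = (\<Sum>y\<in>Y. q M (e y))"
  have lincomb_e: "lincomb (fun_space (Q M) (q M)) Y c e = (\<lambda>x. \<Sum>y\<in>Y. c y * e y x)" for c
    using Y(1) e
  proof (induction Y rule: finite_induct)
    case (insert y Y)
    then show ?case using QM.lincomb_insert[of Y y e c] by simp
  qed simp
  have step: "q M r \<le> q E P * (1 + \<epsilon>) ^ n + \<epsilon> * L" if \<epsilon>: "\<epsilon> > 0" for \<epsilon>
  proof -
    obtain g where g: "g \<in> Q M" "q M g \<le> q E P * (1 + \<epsilon>) ^ n" "\<forall>y\<in>Y. norm (g y - r y) \<le> \<epsilon>"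
      using approx[OF Y \<epsilon>] by blast
    define d where "d = lincomb (fun_space (Q M) (q M)) Y (\<lambda>y. r y - g y) e"
    have dQ: "d \<in> Q M" using QM.lincomb_cl[of Y e] e by (simp add: d_def)
    have "r x = g x + d x" for x
    proof -
      have "d x = (\<Sum>y\<in>Y. r y * e y x) - (\<Sum>y\<in>Y. g y * e y x)"
        by (simp add: d_def lincomb_e left_diff_distrib sum_subtractf)
      also have "\<dots> = r x - g x" using r_eq[of x] interp[OF g(1), of x] by simp
      finally show ?thesis by simp
    qed
    then have "r = (\<lambda>x. g x + d x)" by (rule ext)
    then have "q M r \<le> q M g + q M d" using QM.nrm_triangle[of g d] g(1) dQ by simp
    also have "q M d \<le> (\<Sum>y\<in>Y. norm (r y - g y) * q M (e y))"
      using QM.nrm_lincomb_le[OF Y(1), of e] e by (simp add: d_def)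
    also have "\<dots> \<le> (\<Sum>y\<in>Y. \<epsilon> * q M (e y))"
    proof (rule sum_mono, rule mult_right_mono)
      fix y assume "y \<in> Y"
      then show "norm (r y - g y) \<le> \<epsilon>" "0 \<le> q M (e y)"
        using g(3) QM.nrm_nonneg[of "e y"] e by (simp_all add: norm_minus_commute)
    qed
    also have "\<dots> = \<epsilon> * L" by (simp add: L_def sum_distrib_left)
    finally show ?thesis using g(2) by simp
  qed
  have "((\<lambda>\<epsilon>. q E P * (1 + \<epsilon>) ^ n + \<epsilon> * L) \<longlongrightarrow> q E P * (1 + 0) ^ n + 0 * L) (at_right 0)"
    by (intro tendsto_intros)
  moreover have "\<forall>\<^sub>F \<epsilon> in at_right 0. q M r \<le> q E P * (1 + \<epsilon>) ^ n + \<epsilon> * L"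
    using step by (auto simp: eventually_at_right_field intro: exI[of _ 1])
  ultimately have "q M r \<le> q E P * (1 + 0) ^ n + 0 * L"
    by (rule tendsto_lowerbound) simp
  then show ?thesis by (simp add: r_def R_def)
qed

text \<open>Maximality reduces membership and the upper bound to the finite-dimensional subspaces.
  For the lower bound the ideal property is applied to the canonical embedding \<open>J\<close>, of
  norm at most 1, along which \<open>R\<close> restricts to \<open>P\<close>.\<close>

theorem maximal_ideal_AB:
  assumes Q: "maximal_ideal n Q q" and E: "banach_space E" and G: "banach_space G" and P: "P \<in> Q E"
  shows "comp_on G (AB n E P) \<Phi> \<in> Q G" and "q E P = q G (comp_on G (AB n E P) \<Phi>)"
proof -
  define R where "R = comp_on G (AB n E P) \<Phi>"
  have ideal: "banach_polynomial_ideal n Q q"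
    and QG: "Q G = {P \<in> polynomials n G. max_norm q G P < \<infinity>}"
    and max: "\<And>P. P \<in> Q G \<Longrightarrow> ereal (q G P) = max_norm q G P"
    using Q G unfolding maximal_ideal_def by blast+
  have "Q E \<subseteq> polynomials n E" using ideal E unfolding banach_polynomial_ideal_def by blast
  then have pol: "P \<in> polynomials n E" using P by blast
  have le: "max_norm q G R \<le> ereal (q E P)"
    unfolding max_norm_def R_def
    by (rule SUP_least) (simp add: ideal_norm_AB_FIN[OF ideal E P])
  have "R \<in> polynomials n G" unfolding R_def by (rule AB_polynomial[OF pol])
  moreover have "max_norm q G R < \<infinity>" using le by (rule order_le_less_trans) simp
  ultimately have RQ: "R \<in> Q G" using QG by blast
  then show "comp_on G (AB n E P) \<Phi> \<in> Q G" by (simp only: R_def)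
  have le1: "q G R \<le> q E P" using max[OF RQ] le by (metis ereal_less_eq(3))
  obtain J where J: "bounded_linear_map E G J" "op_norm E G J \<le> 1"
    and RJ: "\<And>n P x. P \<in> polynomials n E \<Longrightarrow> x \<in> carrier E \<Longrightarrow> comp_on G (AB n E P) \<Phi> (J x) = P x"
    by (rule embedding, rule that)
  \<comment> \<open>Members of an ideal are functions on the whole type, so equality is required off
    the carrier too, where both sides are 0.\<close>
  have "comp_on E R J x = P x" for x
  proof (cases "x \<in> carrier E")
    case True
    then show ?thesis unfolding R_def using RJ[OF pol True] by simp
  next
    case False
    then show ?thesis using pol by (simp add: comp_on_def polynomials_def vanishing_off_def)
  qed
  then have "comp_on E R J = P" by (rule ext)
  moreover have "q E (comp_on E R J) \<le> q G R * op_norm E G J ^ n"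
    using ideal E G J(1) RQ unfolding banach_polynomial_ideal_def by blast
  moreover have "q G R * op_norm E G J ^ n \<le> q G R * 1"
  proof (rule mult_left_mono)
    show "op_norm E G J ^ n \<le> 1"
      by (intro power_le_one J(2) op_norm_nonneg[OF E.normed_space_axioms G.normed_space_axioms J(1)])
    have "banach_space (fun_space (Q G) (q G))" using ideal G unfolding banach_polynomial_ideal_def by blast
    then have "normed_space (fun_space (Q G) (q G))" by (rule banach_space.axioms(1))
    from normed_space.nrm_nonneg[OF this, of R] show "0 \<le> q G R" using RQ by simp
  qed
  ultimately have "q E P \<le> q G R" by simp
  then show "q E P = q G (comp_on G (AB n E P) \<Phi>)" using le1 by (simp add: R_def)
qed

end

theorem corollary3p4:
  fixes n :: nat
    and E Ebd :: "('k::rc_field, 'u) nspace"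
    and \<Phi> :: "'u \<Rightarrow> ('u \<Rightarrow> 'k) \<Rightarrow> 'k"
  assumes "n \<ge> 1"
    and "banach_space E"
    and "isometric_iso Ebd (bidual E) \<Phi>"
  shows "(\<forall>\<alpha>. s_tensor_norm n \<alpha> \<and> finitely_generated n \<alpha> \<longrightarrow>
           (\<forall>P\<in>tensor_dual \<alpha> n E.
              comp_on Ebd (AB n E P) \<Phi> \<in> tensor_dual \<alpha> n Ebd \<and>
              tensor_dual_norm \<alpha> n E P = tensor_dual_norm \<alpha> n Ebd (comp_on Ebd (AB n E P) \<Phi>))) \<and>
         (\<forall>Q q. maximal_ideal n Q q \<longrightarrow>
           (\<forall>P\<in>Q E.
              comp_on Ebd (AB n E P) \<Phi> \<in> Q Ebd \<and>
              q E P = q Ebd (comp_on Ebd (AB n E P) \<Phi>)))"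
proof -
  have E: "normed_space E" by (rule banach_space.axioms(1)[OF assms(2)])
  \<comment> \<open>The bidual is complete as the dual of the normed space \<open>dual E\<close>,
    and the isometry carries this over to the copy.\<close>
  have G: "banach_space Ebd"
    by (rule isometric_iso_banach_space[OF assms(3)])
      (intro normed_space.banach_space_dual normed_space.normed_space_dual E)
  have iso: "normed_space Ebd" "linear_map Ebd (bidual E) \<Phi>" "\<Phi> ` carrier Ebd = carrier (bidual E)"
    "\<And>x. x \<in> carrier Ebd \<Longrightarrow> nrm (bidual E) (\<Phi> x) = nrm Ebd x"
    using assms(3) by (auto simp: isometric_iso_def bij_betw_def)
  interpret bidual_iso E Ebd \<Phi>
    by (intro bidual_iso.intro bidual_copy.intro bidual_copy_axioms.intro bidual_iso_axioms.intro E iso)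
  show ?thesis
    using tensor_dual_AB[OF _ _ G] maximal_ideal_AB[OF _ assms(2) G] by blast
qed

end
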